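(* For each $n$ let $G_n$ be a random simple graph on the vertex set $[n]=\{1,\dots,n\}$, with law denoted $\mathbb P$. Fix $u\in[0,1]$ and $\theta\in\mathbb N$ with $\theta>1$, and put $c_{\theta,u}:=1+\theta\max\{u,1-u\}$. Assume: (a) for every $\varepsilon>0$ there exists $\eta>0$ such that $\mathbb P\bigl(\mathcal E_n(\eta,\varepsilon)\bigr)\to 1$ as $n\to\infty$, where $\mathcal E_n(\eta,\varepsilon)$ is the event that $e_{G_n}(S)\le(1+\varepsilon)|S|$ for every $S\subset[n]$ with $|S|\le\eta n$; (b) there exists $\alpha>0$ such that $|E(G_n)|/n\to\alpha$ in probability as $n\to\infty$. Assume moreover that $\alpha>c_{\theta,u}$. Then for every $\delta>0$ there exist $\eta>0$ and $c>0$ such that for every $$t\ge\frac{\theta\log\theta}{(\theta-1)(\alpha-c_{\theta,u})}+\delta$$ one has $$\mathbb P\left(\mathbb P^{G_n}_{\theta,t,u}(A_\eta)\ge c\right)\xrightarrow[n\to\infty]{}1.$$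
   Context: For a graph $G$ and a set $S$ of vertices, $e_G(S)$ is the number of edges of $G$ with both endpoints in $S$. Random loop model. Let $G=(V,E)$ be a finite simple graph with $|V|=n$, and $S^1=\mathbb R/\mathbb Z$. For $t\ge0$ and $u\in[0,1]$, let $\omega=(\omega_e)_{e\in E}$ be independent marked Poisson point processes on $S^1\times\{\times,\mid\}$ with intensity measure $t\,\mathrm ds\otimes(u\,\delta_\times+(1-u)\,\delta_\mid)$; the law of $\omega$ is $\rho^G_{t,u}$. A point $(s,\times)\in\omega_e$ is a cross, and a point $(s,\mid)\in\omega_e$ a bar, on the edge $e$ at time $s$. Almost surely there are finitely many marks, at distinct times. Loops: a particle moves in $G\times S^1\times\{-1,+1\}$, the third coordinate being its vertical direction. Between marks it moves vertically (in the $S^1$ coordinate) at unit speed in its current direction; when at vertex $x$ it meets a mark on an edge $\{x,y\}$, it jumps instantaneously from $x$ to $y$, keeping its direction if the mark is a cross and reversing it if the mark is a bar. All trajectories are closed; the resulting closed trajectories, regarded as (unoriented) subsets of $V\times S^1$, are the loops. $\mathcal L(\omega)$ is the set of loops and $\lambda(\omega)=|\mathcal L(\omega)|$. For a loop $\gamma$, $\operatorname{supp}_V(\gamma)=\{x\in V:\exists s\in S^1,\ (x,s)\in\gamma\}$. For $\theta>0$, the weighted measure is $\mathbb P^G_{\theta,t,u}(\mathrm d\omega)=Z_G(\theta,t,u)^{-1}\theta^{\lambda(\omega)}\rho^G_{t,u}(\mathrm d\omega)$ with $Z_G(\theta,t,u)=\int\theta^{\lambda(\omega)}\rho^G_{t,u}(\mathrm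 d\omega)$. For $\eta>0$, $A_\eta=\{\exists\gamma\in\mathcal L(\omega):|\operatorname{supp}_V(\gamma)|>\eta n\}$. For a random graph $G_n$, $\mathbb P^{G_n}_{\theta,t,u}$ is the loop measure conditional on $G_n$, so $\mathbb P^{G_n}_{\theta,t,u}(A_\eta)$ is a random variable depending on $G_n$. *)

theory Defs
  imports "HOL-Probability.Probability" "HOL-Combinatorics.Multiset_Permutations"
begin

section \<open>Graphs\<close>

text \<open>A graph is given by its vertex set and its set of edges, an edge being a two-element set
  of vertices.\<close>

definition simple_graph :: "'v set \<Rightarrow> 'v set set \<Rightarrow> bool" where
  "simple_graph V E \<longleftrightarrow> finite V \<and> (\<forall>e\<in>E. e \<subseteq> V \<and> card e = 2)"

definition edges_within :: "'v set set \<Rightarrow> 'v set \<Rightarrow> nat" where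
  "edges_within E S = card {e \<in> E. e \<subseteq> S}"


section \<open>Marked Poisson point processes\<close>

text \<open>The circle \<open>\<real>/\<int>\<close> is represented by \<open>[0,1)\<close>; addition on it is addition of reals
  followed by \<^const>\<open>frac\<close>.\<close>

definition circle :: "real measure" where
  "circle = restrict_space lborel {0..<1}"

datatype mark = Cross | Bar

definition mark_pmf :: "real \<Rightarrow> mark pmf" where
  "mark_pmf u = map_pmf (\<lambda>b. if b then Cross else Bar) (bernoulli_pmf u)"

text \<open>The library's \<^const>\<open>poisson_pmf\<close> is only specified for positive rates.\<close>

definition poisson0_pmf :: "real \<Rightarrow> nat pmf" where
  "poisson0_pmf r = (if r = 0 then return_pmf 0 else poisson_pmf r)"

text \<open>A Poisson point process whose intensity measure has total mass \<open>t\<close> and normalisation \<open>P\<close>: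
  a Poisson(\<open>t\<close>) number \<open>N\<close> together with an independent sequence of independent points with
  law \<open>P\<close>, of which the first \<open>N\<close> are the points of the process.\<close>

definition poisson_process :: "real \<Rightarrow> 'a measure \<Rightarrow> (nat \<times> (nat \<Rightarrow> 'a)) measure" where
  "poisson_process t P = measure_pmf (poisson0_pmf t) \<Otimes>\<^sub>M (\<Pi>\<^sub>M k\<in>UNIV. P)"

definition points :: "nat \<times> (nat \<Rightarrow> 'a) \<Rightarrow> 'a set" where
  "points \<xi> = snd \<xi> ` {..<fst \<xi>}"

text \<open>Points are counted with multiplicity; the points are almost surely distinct when \<open>P\<close> has no
  atoms, as for the mark processes below.\<close>

definition num_points :: "'a set \<Rightarrow> nat \<times> (nat \<Rightarrow> 'a) \<Rightarrow> nat" where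
  "num_points A \<xi> = card {k. k < fst \<xi> \<and> snd \<xi> k \<in> A}"

lemma card_functions_with_fibres:
  fixes c :: "'j \<Rightarrow> nat"
  assumes J: "finite J" and c: "sum c J = N"
  shows "real (card {\<sigma> \<in> {..<N} \<rightarrow>\<^sub>E J. \<forall>j\<in>J. card {k. k < N \<and> \<sigma> k = j} = c j}) =
           fact N / (\<Prod>j\<in>J. fact (c j))"
proof -
  define M where "M = (\<Sum>j\<in>J. replicate_mset (c j) j)"
  have count_M: "count M j = (if j \<in> J then c j else 0)" for j
    using J by (auto simp: M_def count_sum sum.delta' if_distrib cong: if_cong)
  have set_M: "set_mset M \<subseteq> J"
    using count_M by (metis not_in_iff subsetI)
  have size_M: "size M = N"
  proof -
    have "size (\<Sum>j\<in>J. replicate_mset (c j) j) = sum c J"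
      using J by (induction J rule: finite_induct) auto
    then show ?thesis using c by (simp add: M_def)
  qed
  let ?S = "{\<sigma> \<in> {..<N} \<rightarrow>\<^sub>E J. \<forall>j\<in>J. card {k. k < N \<and> \<sigma> k = j} = c j}"
  have count_map: "count (mset (map \<sigma> [0..<N])) j = card {k. k < N \<and> \<sigma> k = j}" for \<sigma> j
  proof -
    have "count (mset (map \<sigma> [0..<N])) j = length (filter ((=) j) (map \<sigma> [0..<N]))"
      by (simp add: count_mset count_list_eq_length_filter del: mset_map)
    also have "\<dots> = card {k. k < N \<and> j = \<sigma> k}"
      by (subst length_filter_conv_card) (auto intro!: arg_cong[where f=card])
    also have "{k. k < N \<and> j = \<sigma> k} = {k. k < N \<and> \<sigma> k = j}" by auto
    finally show ?thesis .
  qed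
  have "bij_betw (\<lambda>\<sigma>. map \<sigma> [0..<N]) ?S (permutations_of_multiset M)"
  proof (rule bij_betw_byWitness[where f' = "\<lambda>xs. \<lambda>k\<in>{..<N}. xs ! k"])
    show "\<forall>\<sigma>\<in>?S. (\<lambda>k\<in>{..<N}. map \<sigma> [0..<N] ! k) = \<sigma>"
      by (auto simp: fun_eq_iff PiE_def extensional_def)
    show "\<forall>xs\<in>permutations_of_multiset M. map (\<lambda>k\<in>{..<N}. xs ! k) [0..<N] = xs"
      using size_M by (auto simp: permutations_of_multiset_def intro!: nth_equalityI)
    show "(\<lambda>\<sigma>. map \<sigma> [0..<N]) ` ?S \<subseteq> permutations_of_multiset M"
    proof safe
      fix \<sigma> assume \<sigma>: "\<sigma> \<in> {..<N} \<rightarrow>\<^sub>E J" "\<forall>j\<in>J. card {k. k < N \<and> \<sigma> k = j} = c j"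
      have "mset (map \<sigma> [0..<N]) = M"
      proof (rule multiset_eqI)
        fix j
        show "count (mset (map \<sigma> [0..<N])) j = count M j"
          unfolding count_map count_M using \<sigma> by (auto simp: PiE_def Pi_def)
      qed
      then show "map \<sigma> [0..<N] \<in> permutations_of_multiset M"
        by (simp add: permutations_of_multiset_def)
    qed
    show "(\<lambda>xs. \<lambda>k\<in>{..<N}. xs ! k) ` permutations_of_multiset M \<subseteq> ?S"
    proof (rule image_subsetI)
      fix xs assume "xs \<in> permutations_of_multiset M"
      then have xs: "mset xs = M" by (simp add: permutations_of_multiset_def)
      then have len: "length xs = N" using size_M by auto
      let ?\<sigma> = "\<lambda>k\<in>{..<N}. xs ! k"
      have eq: "map ?\<sigma> [0..<N] = xs"
        using len by (auto intro!: nth_equalityI)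
      have "?\<sigma> k \<in> J" if "k < N" for k
        using that len xs set_M nth_mem[of k xs] by (metis (no_types, lifting) lessThan_iff restrict_apply' set_mset_mset subsetD)
      moreover have "card {k. k < N \<and> ?\<sigma> k = j} = c j" if "j \<in> J" for j
        using count_map[of ?\<sigma> j] that unfolding eq xs count_M by simp
      ultimately show "?\<sigma> \<in> ?S" by auto
    qed
  qed
  then have "card ?S = card (permutations_of_multiset M)"
    by (rule bij_betw_same_card)
  moreover have "(\<Prod>x\<in>set_mset M. fact (count M x)) = (\<Prod>j\<in>J. fact (c j) :: nat)"
    using J set_M by (intro prod.mono_neutral_cong_left) (auto simp: count_M not_in_iff)
  ultimately have "card ?S * (\<Prod>j\<in>J. fact (c j)) = fact N"
    using card_permutations_of_multiset_aux[of M] size_M by simp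
  then have "real (card ?S) * (\<Prod>j\<in>J. fact (c j)) = fact N"
    by (metis (mono_tags, lifting) of_nat_fact of_nat_mult of_nat_prod prod.cong)
  moreover have "(\<Prod>j\<in>J. fact (c j)) \<noteq> (0 :: real)"
    using J by simp
  ultimately show ?thesis
    by (simp only: eq_divide_eq if_True if_False simp_thms)
qed

lemma measure_PiM_counts:
  fixes B :: "'j \<Rightarrow> 'a set" and c :: "'j \<Rightarrow> nat"
  assumes P: "prob_space P" and J: "finite J"
    and B: "\<And>j. j \<in> J \<Longrightarrow> B j \<in> sets P" "disjoint_family_on B J" "(\<Union>j\<in>J. B j) = space P"
    and c: "sum c J = N"
  defines "Q \<equiv> \<Pi>\<^sub>M k\<in>(UNIV :: nat set). P"
  shows "{x \<in> space Q. \<forall>j\<in>J. card {k. k < N \<and> x k \<in> B j} = c j} \<in> sets Q" (is ?A)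
    and "measure Q {x \<in> space Q. \<forall>j\<in>J. card {k. k < N \<and> x k \<in> B j} = c j} =
           fact N * (\<Prod>j\<in>J. measure P (B j) ^ c j / fact (c j))" (is ?B)
proof -
  interpret PP: prob_space P by fact
  interpret product_prob_space "\<lambda>_::nat. P" UNIV by unfold_locales
  let ?S = "{\<sigma> \<in> {..<N} \<rightarrow>\<^sub>E J. \<forall>j\<in>J. card {k. k < N \<and> \<sigma> k = j} = c j}"
  let ?C = "\<lambda>\<sigma>. {x \<in> space Q. \<forall>k\<in>{..<N}. x k \<in> B (\<sigma> k)}"
  let ?E = "{x \<in> space Q. \<forall>j\<in>J. card {k. k < N \<and> x k \<in> B j} = c j}"
  have fin: "finite ?S"
    using J by (auto intro!: finite_PiE finite_subset[of ?S "{..<N} \<rightarrow>\<^sub>E J"])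
  have inB: "x \<in> B i \<Longrightarrow> i \<in> J \<Longrightarrow> j \<in> J \<Longrightarrow> x \<in> B j \<longleftrightarrow> i = j" for x i j
    using B(2) by (auto simp: disjoint_family_on_def)
  have E: "?E = (\<Union>\<sigma>\<in>?S. ?C \<sigma>)"
  proof safe
    fix x assume x: "x \<in> space Q" "\<forall>j\<in>J. card {k. k < N \<and> x k \<in> B j} = c j"
    have "\<forall>k. \<exists>j\<in>J. x k \<in> B j"
    proof
      fix k
      have "x k \<in> space P" using x(1) by (auto simp: Q_def space_PiM)
      then show "\<exists>j\<in>J. x k \<in> B j" unfolding B(3)[symmetric] by blast
    qed
    then obtain f where f: "\<And>k. f k \<in> J" "\<And>k. x k \<in> B (f k)" by metis
    have "restrict f {..<N} \<in> ?S"
    proof safe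
      fix j assume "j \<in> J"
      then have "{k. k < N \<and> restrict f {..<N} k = j} = {k. k < N \<and> x k \<in> B j}"
        using f inB[OF f(2) f(1) \<open>j \<in> J\<close>] by auto
      then show "card {k. k < N \<and> restrict f {..<N} k = j} = c j" using x \<open>j \<in> J\<close> by simp
    qed (use f in \<open>auto split: if_splits\<close>)
    moreover have "x \<in> ?C (restrict f {..<N})" using f x by auto
    ultimately show "x \<in> (\<Union>\<sigma>\<in>?S. ?C \<sigma>)" by blast
  next
    fix x \<sigma> j assume \<sigma>: "\<sigma> \<in> {..<N} \<rightarrow>\<^sub>E J" "\<forall>j\<in>J. card {k. k < N \<and> \<sigma> k = j} = c j"
      and x: "x \<in> space Q" "\<forall>k\<in>{..<N}. x k \<in> B (\<sigma> k)" and j: "j \<in> J"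
    have "{k. k < N \<and> x k \<in> B j} = {k. k < N \<and> \<sigma> k = j}"
      using \<sigma>(1) x j inB by (auto simp: PiE_def Pi_def) blast+
    then show "card {k. k < N \<and> x k \<in> B j} = c j" using \<sigma>(2) j by simp
  qed
  have C: "?C \<sigma> \<in> sets Q" "measure Q (?C \<sigma>) = (\<Prod>j\<in>J. measure P (B j) ^ c j)" if "\<sigma> \<in> ?S" for \<sigma>
  proof -
    have \<sigma>: "\<And>k. k < N \<Longrightarrow> \<sigma> k \<in> J" "\<And>j. j \<in> J \<Longrightarrow> card {k. k < N \<and> \<sigma> k = j} = c j"
      using that by auto
    have eq: "?C \<sigma> = prod_emb UNIV (\<lambda>_. P) {..<N} (Pi\<^sub>E {..<N} (\<lambda>k. B (\<sigma> k)))"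
      unfolding prod_emb_def Q_def by (auto simp: space_PiM Pi_iff)
    show "?C \<sigma> \<in> sets Q"
      unfolding eq unfolding Q_def using \<sigma>(1) B(1) by (intro sets_PiM_I) auto
    have "measure Q (?C \<sigma>) = (\<Prod>k<N. measure P (B (\<sigma> k)))"
      unfolding eq unfolding Q_def using \<sigma>(1) B(1) by (intro measure_PiM_emb) auto
    also have "\<dots> = (\<Prod>j\<in>J. \<Prod>k\<in>{k\<in>{..<N}. \<sigma> k = j}. measure P (B (\<sigma> k)))"
      using \<sigma>(1) J by (intro prod.group[symmetric]) auto
    also have "\<dots> = (\<Prod>j\<in>J. measure P (B j) ^ c j)"
      using \<sigma>(2) by (intro prod.cong refl) simp
    finally show "measure Q (?C \<sigma>) = (\<Prod>j\<in>J. measure P (B j) ^ c j)" .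
  qed
  show ?A unfolding E using C(1) fin by auto
  have disj: "disjoint_family_on ?C ?S"
    unfolding disjoint_family_on_def
  proof (intro ballI impI)
    fix \<sigma> \<tau> assume *: "\<sigma> \<in> ?S" "\<tau> \<in> ?S" "\<sigma> \<noteq> \<tau>"
    then obtain k where "k < N" "\<sigma> k \<noteq> \<tau> k"
      by (metis (no_types, lifting) PiE_ext lessThan_iff mem_Collect_eq)
    moreover have "\<sigma> k \<in> J" "\<tau> k \<in> J" using * \<open>k < N\<close> by auto
    ultimately show "?C \<sigma> \<inter> ?C \<tau> = {}"
      using B(2) \<open>k < N\<close> by (fastforce simp: disjoint_family_on_def)
  qed
  have "measure Q ?E = (\<Sum>\<sigma>\<in>?S. measure Q (?C \<sigma>))"
    unfolding E using fin disj C(1) unfolding Q_def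
    by (intro finite_measure_finite_Union) (auto simp: image_subset_iff)
  also have "\<dots> = real (card ?S) * (\<Prod>j\<in>J. measure P (B j) ^ c j)"
    using C(2) by simp
  also have "\<dots> = fact N * (\<Prod>j\<in>J. measure P (B j) ^ c j / fact (c j))"
    unfolding card_functions_with_fibres[OF J c] by (simp add: prod_dividef)
  finally show ?B .
qed


lemma pmf_poisson0: "0 \<le> r \<Longrightarrow> pmf (poisson0_pmf r) k = r ^ k / fact k * exp (- r)"
  by (cases "r = 0"; cases k) (auto simp: poisson0_pmf_def indicator_def)

lemma prob_space_poisson_process:
  assumes "prob_space P" shows "prob_space (poisson_process t P)"
proof -
  interpret A: prob_space "\<Pi>\<^sub>M k\<in>(UNIV::nat set). P" by (rule prob_space_PiM) (rule assms)
  interpret pair_prob_space "measure_pmf (poisson0_pmf t)" "\<Pi>\<^sub>M k\<in>(UNIV::nat set). P" ..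
  show ?thesis unfolding poisson_process_def by unfold_locales
qed

lemma measurable_num_points [measurable]:
  assumes [measurable]: "A \<in> sets P"
  shows "num_points A \<in> poisson_process t P \<rightarrow>\<^sub>M count_space UNIV"
proof -
  have "(\<lambda>\<xi>. (\<lambda>N \<xi>. card {k. k < N \<and> snd \<xi> k \<in> A}) (fst \<xi>) \<xi>)
          \<in> poisson_process t P \<rightarrow>\<^sub>M count_space UNIV"
    unfolding poisson_process_def
    by (rule measurable_compose_countable) measurable
  then show ?thesis by (simp add: num_points_def[abs_def])
qed

lemma measure_poisson_process_counts:
  fixes B :: "'j \<Rightarrow> 'a set" and c :: "'j \<Rightarrow> nat"
  assumes P: "prob_space P" and t: "0 \<le> t" and J: "finite J"
    and B: "\<And>j. j \<in> J \<Longrightarrow> B j \<in> sets P" "disjoint_family_on B J" "(\<Union>j\<in>J. B j) = space P"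
  shows "measure (poisson_process t P)
             {\<xi> \<in> space (poisson_process t P). \<forall>j\<in>J. num_points (B j) \<xi> = c j} =
           (\<Prod>j\<in>J. pmf (poisson0_pmf (t * measure P (B j))) (c j))"
proof -
  interpret PP: prob_space P by fact
  interpret Q: prob_space "\<Pi>\<^sub>M k\<in>(UNIV::nat set). P" by (rule prob_space_PiM) (rule P)
  let ?Q = "\<Pi>\<^sub>M k\<in>(UNIV::nat set). P"
  define N where "N = sum c J"
  let ?E = "{x \<in> space ?Q. \<forall>j\<in>J. card {k. k < N \<and> x k \<in> B j} = c j}"
  note E = measure_PiM_counts[OF P J B, of c N] N_def[symmetric]
  have total: "n = (\<Sum>j\<in>J. card {k. k < n \<and> x k \<in> B j})" if x: "x \<in> space ?Q" for n x
  proof -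
    have "x k \<in> space P" for k using x by (auto simp: space_PiM)
    then have "{..<n} = (\<Union>j\<in>J. {k. k < n \<and> x k \<in> B j})"
      unfolding B(3)[symmetric] by blast
    then have "card {..<n} = card (\<Union>j\<in>J. {k. k < n \<and> x k \<in> B j})" by simp
    also have "\<dots> = (\<Sum>j\<in>J. card {k. k < n \<and> x k \<in> B j})"
      using J B(2) by (intro card_UN_disjoint) (auto simp: disjoint_family_on_def)
    finally show ?thesis by simp
  qed
  have eq: "{\<xi> \<in> space (poisson_process t P). \<forall>j\<in>J. num_points (B j) \<xi> = c j} = {N} \<times> ?E"
  proof -
    have "fst \<xi> = N" if "snd \<xi> \<in> space ?Q" "\<forall>j\<in>J. num_points (B j) \<xi> = c j" for \<xi>
    proof -
      have "fst \<xi> = (\<Sum>j\<in>J. num_points (B j) \<xi>)"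
        unfolding num_points_def by (rule total) (rule that)
      also have "\<dots> = N" unfolding N_def using that(2) by (intro sum.cong) auto
      finally show ?thesis .
    qed
    moreover have "\<xi> \<in> space (poisson_process t P) \<longleftrightarrow> snd \<xi> \<in> space ?Q" for \<xi>
      by (cases \<xi>) (simp add: poisson_process_def space_pair_measure)
    moreover have "\<xi> \<in> {N} \<times> ?E \<longleftrightarrow>
        fst \<xi> = N \<and> snd \<xi> \<in> space ?Q \<and> (\<forall>j\<in>J. num_points (B j) \<xi> = c j)" for \<xi>
      unfolding num_points_def by (cases \<xi>) auto
    ultimately show ?thesis by blast
  qed
  have "emeasure (poisson_process t P) ({N} \<times> ?E) =
      emeasure (measure_pmf (poisson0_pmf t)) {N} * emeasure ?Q ?E"
    unfolding poisson_process_def using E by (intro Q.emeasure_pair_measure_Times) auto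
  then have "measure (poisson_process t P) ({N} \<times> ?E) = pmf (poisson0_pmf t) N * measure ?Q ?E"
    by (simp add: measure_def enn2real_mult pmf.rep_eq)
  also have "\<dots> = (t ^ N / fact N * exp (- t)) *
      (fact N * (\<Prod>j\<in>J. measure P (B j) ^ c j / fact (c j)))"
    using t E by (simp add: pmf_poisson0)
  also have "\<dots> = (\<Prod>j\<in>J. t ^ c j) * exp (- t) * (\<Prod>j\<in>J. measure P (B j) ^ c j / fact (c j))"
    by (simp add: N_def power_sum)
  also have "exp (- t) = (\<Prod>j\<in>J. exp (- (t * measure P (B j))))"
  proof -
    have "1 = measure P (\<Union>j\<in>J. B j)" using B(3) PP.prob_space by simp
    also have "\<dots> = (\<Sum>j\<in>J. measure P (B j))"
      using J B by (intro PP.finite_measure_finite_Union) auto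
    finally have "t = t * (\<Sum>j\<in>J. measure P (B j))" by simp
    then show ?thesis using J by (simp add: exp_sum[symmetric] sum_negf sum_distrib_left)
  qed
  also have "(\<Prod>j\<in>J. t ^ c j) * \<dots> * (\<Prod>j\<in>J. measure P (B j) ^ c j / fact (c j)) =
      (\<Prod>j\<in>J. pmf (poisson0_pmf (t * measure P (B j))) (c j))"
    using t by (simp add: pmf_poisson0 prod.distrib[symmetric] power_mult_distrib mult_ac)
  finally show ?thesis unfolding eq .
qed

lemma distr_poisson_process_counts:
  fixes B :: "'j \<Rightarrow> 'a set"
  assumes P: "prob_space P" and t: "0 \<le> t" and J: "finite J"
    and B: "\<And>j. j \<in> J \<Longrightarrow> B j \<in> sets P" "disjoint_family_on B J" "(\<Union>j\<in>J. B j) = space P"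
  shows "distr (poisson_process t P) (count_space UNIV)
             (\<lambda>\<xi> j. if j \<in> J then num_points (B j) \<xi> else 0) =
           measure_pmf (Pi_pmf J 0 (\<lambda>j. poisson0_pmf (t * measure P (B j))))"
    and "(\<lambda>\<xi> j. if j \<in> J then num_points (B j) \<xi> else 0)
           \<in> poisson_process t P \<rightarrow>\<^sub>M count_space UNIV"
proof -
  interpret R: prob_space "poisson_process t P" by (rule prob_space_poisson_process[OF P])
  let ?X = "\<lambda>\<xi> j. if j \<in> J then num_points (B j) \<xi> else 0"
  let ?\<Omega> = "PiE_dflt J 0 (\<lambda>_. UNIV :: nat set)"
  have count: "countable ?\<Omega>"
    using J by (subst dflt_image_PiE[symmetric]) (intro countable_image countable_PiE; simp)
  have sing: "{\<xi> \<in> space (poisson_process t P). ?X \<xi> = c} =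
      {\<xi> \<in> space (poisson_process t P). \<forall>j\<in>J. num_points (B j) \<xi> = c j}" if "c \<in> ?\<Omega>" for c
    using that by (auto simp: PiE_dflt_def fun_eq_iff)
  have meas: "{\<xi> \<in> space (poisson_process t P). ?X \<xi> = c} \<in> R.events" if "c \<in> ?\<Omega>" for c
    unfolding sing[OF that] using J B(1) by measurable
  have vim: "?X -` Y \<inter> space (poisson_process t P) =
      (\<Union>c\<in>Y \<inter> ?\<Omega>. {\<xi> \<in> space (poisson_process t P). ?X \<xi> = c})" for Y
    by (auto simp: PiE_dflt_def)
  show X: "?X \<in> poisson_process t P \<rightarrow>\<^sub>M count_space UNIV"
  proof (rule measurableI)
    fix Y :: "('j \<Rightarrow> nat) set"
    show "?X -` Y \<inter> space (poisson_process t P) \<in> R.events"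
      unfolding vim using count meas by (intro sets.countable_UN') auto
  qed auto
  show "distr (poisson_process t P) (count_space UNIV) ?X =
           measure_pmf (Pi_pmf J 0 (\<lambda>j. poisson0_pmf (t * measure P (B j))))"
  proof (rule measure_eqI_countable_AE[where \<Omega> = ?\<Omega>])
    show "AE c in distr (poisson_process t P) (count_space UNIV) ?X. c \<in> ?\<Omega>"
      by (subst AE_distr_iff[OF X]) (auto simp: PiE_dflt_def)
    show "AE c in measure_pmf (Pi_pmf J 0 (\<lambda>j. poisson0_pmf (t * measure P (B j)))). c \<in> ?\<Omega>"
      using set_Pi_pmf_subset[OF J, of 0 "\<lambda>j. poisson0_pmf (t * measure P (B j))"]
      by (auto simp: AE_measure_pmf_iff PiE_dflt_def)
    fix c assume c: "c \<in> ?\<Omega>"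
    have "emeasure (distr (poisson_process t P) (count_space UNIV) ?X) {c} =
        R.prob {\<xi> \<in> space (poisson_process t P). \<forall>j\<in>J. num_points (B j) \<xi> = c j}"
      unfolding sing[OF c, symmetric]
      by (subst emeasure_distr[OF X]) (auto simp: R.emeasure_eq_measure intro!: arg_cong[where f=R.prob])
    also have "\<dots> = ennreal (\<Prod>j\<in>J. pmf (poisson0_pmf (t * measure P (B j))) (c j))"
      using measure_poisson_process_counts[OF P t J B] by simp
    also have "\<dots> = emeasure (measure_pmf (Pi_pmf J 0 (\<lambda>j. poisson0_pmf (t * measure P (B j))))) {c}"
      using c J by (subst emeasure_pmf_single, subst pmf_Pi') (auto simp: PiE_dflt_def)
    finally show "emeasure (distr (poisson_process t P) (count_space UNIV) ?X) {c} = \<dots>" .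
  qed (use count in auto)
qed

text \<open>The defining property of a Poisson point process with intensity measure \<open>t \<cdot> P\<close>: the numbers
  of points in disjoint measurable sets \<open>A i\<close> are independent and Poisson(\<open>t \<cdot> P (A i)\<close>)
  distributed.\<close>

theorem poisson_process_characterisation:
  fixes A :: "'i \<Rightarrow> 'a set"
  assumes P: "prob_space P" and t: "0 \<le> t" and I: "finite I"
    and A: "\<And>i. i \<in> I \<Longrightarrow> A i \<in> sets P" "disjoint_family_on A I"
  shows "prob_space.indep_vars (poisson_process t P) (\<lambda>_. count_space UNIV) (\<lambda>i. num_points (A i)) I"
    and "i \<in> I \<Longrightarrow> distr (poisson_process t P) (count_space UNIV) (num_points (A i)) =
           measure_pmf (poisson0_pmf (t * measure P (A i)))"
proof -
  interpret R: prob_space "poisson_process t P" by (rule prob_space_poisson_process[OF P])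
  define J where "J = insert None (Some ` I)"
  define B where "B = case_option (space P - (\<Union>i\<in>I. A i)) A"
  let ?p = "\<lambda>j. poisson0_pmf (t * measure P (B j))"
  let ?\<mu> = "measure_pmf (Pi_pmf J 0 ?p)"
  let ?X = "\<lambda>\<xi> j. if j \<in> J then num_points (B j) \<xi> else 0"
  have J: "finite J" "J \<noteq> {}" using I by (auto simp: J_def)
  have B: "\<And>j. j \<in> J \<Longrightarrow> B j \<in> sets P" "disjoint_family_on B J" "(\<Union>j\<in>J. B j) = space P"
    using A I sets.sets_into_space[of _ P]
    by (auto simp: J_def B_def disjoint_family_on_def split: option.splits; blast)+
  note D = distr_poisson_process_counts[OF P t J(1) B]
  have marg: "distr (poisson_process t P) (count_space UNIV) (num_points (B j)) = measure_pmf (?p j)"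
    if j: "j \<in> J" for j
  proof -
    have "distr (poisson_process t P) (count_space UNIV) (num_points (B j)) =
        distr (poisson_process t P) (count_space UNIV) ((\<lambda>f. f j) \<circ> ?X)"
      using j by (intro distr_cong) auto
    also have "\<dots> = distr ?\<mu> (count_space UNIV) (\<lambda>f. f j)"
      by (subst distr_distr[OF _ D(2), symmetric]) (simp_all add: D(1))
    also have "\<dots> = measure_pmf (?p j)"
      unfolding map_pmf_rep_eq[symmetric] using j J by (subst Pi_pmf_component) auto
    finally show ?thesis .
  qed
  have "R.indep_vars (\<lambda>_. count_space UNIV) (\<lambda>j. num_points (B j)) J"
  proof (subst R.indep_vars_iff_distr_eq_PiM')
    have "distr (poisson_process t P) (\<Pi>\<^sub>M j\<in>J. count_space UNIV) (\<lambda>\<xi>. \<lambda>j\<in>J. num_points (B j) \<xi>) =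
        distr (poisson_process t P) (\<Pi>\<^sub>M j\<in>J. count_space UNIV) ((\<lambda>f. restrict f J) \<circ> ?X)"
      by (intro distr_cong) (auto simp: fun_eq_iff)
    also have "\<dots> = distr ?\<mu> (\<Pi>\<^sub>M j\<in>J. count_space UNIV) (\<lambda>f. restrict f J)"
      by (subst distr_distr[OF _ D(2), symmetric]) (simp_all add: D(1) space_PiM)
    also have "\<dots> = (\<Pi>\<^sub>M j\<in>J. distr ?\<mu> (count_space UNIV) (\<lambda>f. f j))"
      using indep_vars_Pi_pmf[OF J(1), of 0 ?p] J(2)
      by (subst (asm) prob_space.indep_vars_iff_distr_eq_PiM') (auto simp: measure_pmf.prob_space_axioms)
    also have "\<dots> = (\<Pi>\<^sub>M j\<in>J. distr (poisson_process t P) (count_space UNIV) (num_points (B j)))"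
      using J by (intro PiM_cong refl) (auto simp: marg map_pmf_rep_eq[symmetric] Pi_pmf_component)
    finally show "distr (poisson_process t P) (\<Pi>\<^sub>M j\<in>J. count_space UNIV)
        (\<lambda>\<xi>. \<lambda>j\<in>J. num_points (B j) \<xi>) = \<dots>" .
  qed (use J B in auto)
  then have "R.indep_vars (\<lambda>_. count_space UNIV) (\<lambda>j. num_points (B j)) (Some ` I)"
    by (rule R.indep_vars_subset) (auto simp: J_def)
  then have indep: "R.indep_sets (\<lambda>j. {num_points (B j) -` Y \<inter> space (poisson_process t P) | Y. Y \<in> sets (count_space UNIV)}) (Some ` I)"
    by (simp add: R.indep_vars_def2)
  show "R.indep_vars (\<lambda>_. count_space UNIV) (\<lambda>i. num_points (A i)) I"
    unfolding R.indep_vars_def2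
  proof (intro conjI ballI R.indep_setsI)
    fix K and F :: "'i \<Rightarrow> (nat \<times> (nat \<Rightarrow> 'a)) set"
    assume K: "K \<noteq> {}" "K \<subseteq> I" "finite K"
      and F: "\<forall>i\<in>K. F i \<in> {num_points (A i) -` Y \<inter> space (poisson_process t P) | Y. Y \<in> sets (count_space UNIV)}"
    have "R.prob (\<Inter>j\<in>Some ` K. F (the j)) = (\<Prod>j\<in>Some ` K. R.prob (F (the j)))"
      using K F by (intro R.indep_setsD[OF indep]) (auto simp: B_def)
    then show "R.prob (\<Inter>i\<in>K. F i) = (\<Prod>i\<in>K. R.prob (F i))"
      by (simp add: prod.reindex)
  qed (use A(1) in auto)
  show "distr (poisson_process t P) (count_space UNIV) (num_points (A i)) =
           measure_pmf (poisson0_pmf (t * measure P (A i)))" if "i \<in> I"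
    using marg[of "Some i"] that by (simp add: J_def B_def)
qed


section \<open>The random loop model\<close>

type_synonym 'v sample = "'v set \<Rightarrow> nat \<times> (nat \<Rightarrow> real \<times> mark)"

definition mark_law :: "'v set set \<Rightarrow> real \<Rightarrow> real \<Rightarrow> 'v sample measure" where
  "mark_law E t u = (\<Pi>\<^sub>M e\<in>E. poisson_process t (circle \<Otimes>\<^sub>M measure_pmf (mark_pmf u)))"

type_synonym 'v config = "('v set \<times> real \<times> mark) set"

definition config :: "'v set set \<Rightarrow> 'v sample \<Rightarrow> 'v config" where
  "config E \<omega> = {(e, s, m). e \<in> E \<and> (s, m) \<in> points (\<omega> e)}"

definition marked :: "'v config \<Rightarrow> 'v \<Rightarrow> real \<Rightarrow> bool" where
  "marked X x s \<longleftrightarrow> (\<exists>e m. (e, s, m) \<in> X \<and> x \<in> e)"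

text \<open>The state \<open>(x, s, d)\<close> is that of a particle arriving at \<open>(x, s)\<close> in direction \<open>d = \<plusminus>1\<close>;
  \<open>jump\<close> gives the state in which it leaves time \<open>s\<close>. It is a function of the arrival state as
  soon as no two marks at \<open>x\<close> occur at the same time, which is almost surely the case.\<close>

type_synonym 'v state = "'v \<times> real \<times> real"

inductive jump :: "'v config \<Rightarrow> 'v state \<Rightarrow> 'v state \<Rightarrow> bool" for X where
  cross: "({x, y}, s, Cross) \<in> X \<Longrightarrow> jump X (x, s, d) (y, s, d)"
| bar: "({x, y}, s, Bar) \<in> X \<Longrightarrow> jump X (x, s, d) (y, s, - d)"
| unmarked: "\<not> marked X x s \<Longrightarrow> jump X (x, s, d) (x, s, d)"

text \<open>A step leads from an arrival state through a possible jump and a vertical motion of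
  duration \<open>r\<close> that meets no mark strictly in between to a later arrival state.\<close>

inductive step :: "'v config \<Rightarrow> 'v state \<Rightarrow> 'v state \<Rightarrow> bool" for X where
  "jump X \<sigma> (x, s, d) \<Longrightarrow> 0 < r \<Longrightarrow> (\<And>q. 0 < q \<Longrightarrow> q < r \<Longrightarrow> \<not> marked X x (frac (s + d * q)))
     \<Longrightarrow> step X \<sigma> (x, frac (s + d * r), d)"

definition trajectory :: "'v config \<Rightarrow> 'v state \<Rightarrow> ('v \<times> real) set" where
  "trajectory X \<sigma> =
     {(x, s). \<exists>d \<tau>. (step X)\<^sup>*\<^sup>* \<sigma> \<tau> \<and> (\<tau> = (x, s, d) \<or> jump X \<tau> (x, s, d))}"

definition loops :: "'v set \<Rightarrow> 'v config \<Rightarrow> ('v \<times> real) set set" where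
  "loops V X = trajectory X ` (V \<times> {0..<1} \<times> {-1, 1})"

definition num_loops :: "'v set \<Rightarrow> 'v set set \<Rightarrow> 'v sample \<Rightarrow> nat" where
  "num_loops V E \<omega> = card (loops V (config E \<omega>))"

definition vertex_support :: "('v \<times> real) set \<Rightarrow> 'v set" where
  "vertex_support \<gamma> = {x. \<exists>s. (x, s) \<in> \<gamma>}"

definition partition_function :: "'v set \<Rightarrow> 'v set set \<Rightarrow> real \<Rightarrow> real \<Rightarrow> real \<Rightarrow> real" where
  "partition_function V E \<theta> t u = (\<integral>\<omega>. \<theta> ^ num_loops V E \<omega> \<partial>mark_law E t u)"

definition loop_measure ::
  "'v set \<Rightarrow> 'v set set \<Rightarrow> real \<Rightarrow> real \<Rightarrow> real \<Rightarrow> 'v sample measure" where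
  "loop_measure V E \<theta> t u =
     density (mark_law E t u)
       (\<lambda>\<omega>. ennreal (\<theta> ^ num_loops V E \<omega> / partition_function V E \<theta> t u))"

definition has_long_loop :: "'v set \<Rightarrow> 'v set set \<Rightarrow> real \<Rightarrow> 'v sample \<Rightarrow> bool" where
  "has_long_loop V E \<eta> \<omega> \<longleftrightarrow>
     (\<exists>\<gamma>\<in>loops V (config E \<omega>). real (card (vertex_support \<gamma>)) > \<eta> * real (card V))"

end

theory Submission
  imports Defs
begin

text \<open>
  The proof compares two bounds on the logarithmic derivative in \<open>t\<close> of the partition function
  \<open>Z(t)\<close> of a fixed graph with \<open>n\<close> vertices and edge set \<open>E\<close>.

  Only the order of the marks in time matters for the loops, so a sample can be replaced by the word
  of its marks (edge and type) in order of time. The number of marks is Poisson with mean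
  \<open>t |E|\<close> and, given their number, the marks are independent and uniform over \<open>E\<close>; hence
  \<open>Z(t) exp (t |E|) = f(t)\<close> with \<open>f(t) = (\<Sum>k. a k t^k / k!)\<close>, where \<open>a k\<close> is the sum over the words
  \<open>w\<close> of length \<open>k\<close> of \<open>\<theta>^\<lambda>(w)\<close> times the probabilities \<open>u\<close> and \<open>1 - u\<close> of the types of its marks
  (\<open>word_law\<close>).

  Lower bound. Since \<open>\<theta>\<close> is an integer, \<open>\<theta>^\<lambda>(w)\<close> counts the colourings with \<open>\<theta>\<close> colours that
  are constant along the loops. Reading such a colouring level by level shows that \<open>a k\<close> is the
  trace of \<open>A^k\<close> for a symmetric nonnegative matrix \<open>A\<close> of size \<open>\<theta>^n\<close> (\<open>trace_words\<close>). Therefore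
  \<open>ln f\<close> is convex, by the Cauchy-Schwarz inequality, and
  \<open>t f'(t) / f(t) \<ge> ln f(t) - ln f(0) \<ge> t |E| - n ln \<theta>\<close> (\<open>trace_tangent_bound\<close>).

  Upper bound. The coefficient \<open>a (k + 1)\<close> is obtained by adding one mark, at time \<open>0\<close>, to words of
  length \<open>k\<close>. A mark between two different loops merges them and contributes a factor
  \<open>1 / \<theta>\<close>. If both endpoints lie on the same loop, then at most one of the two types of mark splits
  it, and the factor, averaged over the type, is at most \<open>1 + (\<theta> - 1) max u (1 - u)\<close>
  (\<open>closing_weight\<close>). If no loop
  visits more than \<open>\<eta> n\<close> vertices, the vertices are partitioned by the loops passing through time
  \<open>0\<close> into small sets, and by sparsity at most \<open>(1 + \<epsilon>) n\<close> edges have both endpoints in the same set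
  (\<open>card_inner_edges\<close>). So \<open>f'(t) / f(t)\<close> is at most
  \<open>|E| / \<theta> + \<kappa> (1 + \<epsilon>) n + \<kappa> |E| P\<close>, where \<open>P\<close> is the probability of a long loop and
  \<open>\<kappa> = (1 - 1 / \<theta>) (1 + \<theta> max u (1 - u))\<close>.

  Together this gives \<open>(1 - 1 / \<theta>) |E| - n ln \<theta> / t - \<kappa> (1 + \<epsilon>) n \<le> \<kappa> |E| P\<close>
  (\<open>long_loop_bound\<close>). For \<open>|E|\<close> close to \<open>\<alpha> n\<close> and \<open>t\<close> above the threshold the left-hand side is
  at least a constant times \<open>n\<close>, and \<open>P\<close> is bounded away from \<open>0\<close>.

  The remaining work connects words with the continuous model. The loops do not change under an
  increasing change of time (\<open>trajectory_retime\<close>); this reduces a generic sample to equally spaced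
  marks, where the moving particle becomes a permutation of finitely many pieces of trajectory
  (\<open>trajectory_canonical\<close>). The same invariance shows that the events in question are measurable,
  including on the null set of samples with simultaneous marks, because they depend only on
  the pattern of finitely many order relations.
\<close>

section \<open>Equivalence classes generated by a gluing relation\<close>

definition glued :: "('p \<times> 'p) set \<Rightarrow> ('p \<times> 'p) set" where
  "glued R = (R \<union> R\<inverse>)\<^sup>*"

lemma glued_refl [simp]: "(p, p) \<in> glued R"
  by (simp add: glued_def)

lemma glued_sym: "(p, q) \<in> glued R \<Longrightarrow> (q, p) \<in> glued R"
  unfolding glued_def by (meson sym_Un_converse sym_rtrancl symD)

lemma glued_trans: "(p, q) \<in> glued R \<Longrightarrow> (q, r) \<in> glued R \<Longrightarrow> (p, r) \<in> glued R"
  unfolding glued_def by (rule rtrancl_trans)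

lemma glued_base: "(p, q) \<in> R \<Longrightarrow> (p, q) \<in> glued R"
  unfolding glued_def by blast

lemma glued_mono: "R \<subseteq> R' \<Longrightarrow> glued R \<subseteq> glued R'"
  unfolding glued_def by (intro rtrancl_mono) auto

lemma glued_respects:
  assumes "(p, q) \<in> glued R" "\<And>a b. (a, b) \<in> R \<Longrightarrow> c a = c b"
  shows "c p = c q"
  using assms(1) unfolding glued_def
  by (induction rule: rtrancl_induct) (auto dest: assms(2))

lemma glued_in:
  assumes "R \<subseteq> S \<times> S" "(p, q) \<in> glued R" "p \<in> S"
  shows "q \<in> S"
  using assms(2) unfolding glued_def
  by (induction rule: rtrancl_induct) (use assms in auto)

lemma glued_insert:
  "(p, q) \<in> glued (insert (a, b) R) \<longleftrightarrow> (p, q) \<in> glued R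
     \<or> (p, a) \<in> glued R \<and> (b, q) \<in> glued R \<or> (p, b) \<in> glued R \<and> (a, q) \<in> glued R" (is "?L \<longleftrightarrow> ?R q")
proof
  assume ?L
  then show "?R q"
    unfolding glued_def[of "insert (a, b) R"]
  proof (induction rule: rtrancl_induct)
    case (step y z)
    from step(2) consider "(y, z) = (a, b)" | "(y, z) = (b, a)" | "(y, z) \<in> glued R"
      by (auto intro: glued_base glued_sym)
    then show ?case
      using step(3) by cases (blast intro: glued_trans glued_sym glued_refl)+
  qed simp
next
  have *: "x \<in> glued R \<Longrightarrow> x \<in> glued (insert (a, b) R)" for x
    using glued_mono[of R "insert (a, b) R"] by blast
  have "(a, b) \<in> glued (insert (a, b) R)" by (simp add: glued_base)
  then show "?R q \<Longrightarrow> ?L" by (blast intro: glued_trans glued_sym *)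
qed

abbreviation classes :: "'p set \<Rightarrow> ('p \<times> 'p) set \<Rightarrow> 'p set set" where
  "classes S R \<equiv> S // glued R"

lemma class_eq_iff: "glued R `` {p} = glued R `` {q} \<longleftrightarrow> (p, q) \<in> glued R"
  by (auto intro: glued_trans glued_sym)

lemma classes_image: "classes S R = (\<lambda>p. glued R `` {p}) ` S"
  by (auto simp: quotient_def)

text \<open>Gluing two points either joins two classes or changes nothing; all changes in the number of
  loops are counted by this.\<close>

lemma card_classes_insert:
  assumes "finite S" "a \<in> S" "b \<in> S"
  shows "card (classes S R) =
    card (classes S (insert (a, b) R)) + (if (a, b) \<in> glued R then 0 else 1)"
proof (cases "(a, b) \<in> glued R")
  case True
  then have "glued (insert (a, b) R) = glued R"
    by (auto simp: glued_insert) (blast intro: glued_trans glued_sym)+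
  then show ?thesis using True by simp
next
  case False
  let ?A = "glued R `` {a}" and ?B = "glued R `` {b}"
  let ?h = "\<lambda>C. if C = ?A then ?A \<union> ?B else C"
  have ne: "?A \<noteq> ?B" using False by (simp add: class_eq_iff)
  have cl: "glued (insert (a, b) R) `` {p} =
      (if glued R `` {p} = ?A \<or> glued R `` {p} = ?B then ?A \<union> ?B else glued R `` {p})" for p
    unfolding class_eq_iff
    by (auto simp: glued_insert) (blast intro: glued_trans glued_sym)+
  have inA: "C \<in> classes S R \<Longrightarrow> C \<inter> ?A \<noteq> {} \<Longrightarrow> C = ?A" for C
    by (auto simp: classes_image) (blast intro: glued_trans glued_sym)+
  have A: "?A \<in> classes S R" "?B \<in> classes S R" using assms by (auto simp: classes_image)
  have "classes S (insert (a, b) R) = ?h ` (classes S R - {?B})"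
  proof -
    have "classes S (insert (a, b) R) = (\<lambda>C. if C = ?A \<or> C = ?B then ?A \<union> ?B else C) ` classes S R"
      unfolding classes_image image_image cl ..
    also have "\<dots> = ?h ` (classes S R - {?B})"
      using A ne by (auto simp: image_iff)
    finally show ?thesis .
  qed
  moreover have "inj_on ?h (classes S R - {?B})"
  proof (rule inj_onI)
    fix C D assume C: "C \<in> classes S R - {?B}" and D: "D \<in> classes S R - {?B}" and eq: "?h C = ?h D"
    have "a \<in> ?A" by simp
    then show "C = D" using eq inA[of C] inA[of D] C D by (auto split: if_splits)
  qed
  ultimately have "card (classes S (insert (a, b) R)) = card (classes S R - {?B})"
    by (simp only: card_image)
  then have "card (classes S (insert (a, b) R)) = card (classes S R) - 1"
    using A by simp
  moreover have "card (classes S R) > 0"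
    using A assms(1) by (auto simp: card_gt_0_iff classes_image)
  ultimately show ?thesis using False by simp
qed

text \<open>A function that respects \<open>R\<close> is a free choice of a colour for each class. This is how powers
  of the integer \<open>q\<close> turn into counting problems.\<close>

lemma card_respecting_colourings:
  fixes q :: nat
  assumes S: "finite S" and R: "R \<subseteq> S \<times> S"
  shows "card {c \<in> S \<rightarrow>\<^sub>E {..<q}. \<forall>(a, b)\<in>R. c a = c b} = q ^ card (classes S R)"
proof -
  let ?cl = "\<lambda>p. glued R `` {p}"
  let ?L = "{c \<in> S \<rightarrow>\<^sub>E {..<q}. \<forall>(a, b)\<in>R. c a = c b}"
  have fin: "finite (classes S R)" using S by (simp add: classes_image)
  have "bij_betw (\<lambda>f. \<lambda>p\<in>S. f (?cl p)) (classes S R \<rightarrow>\<^sub>E {..<q}) ?L"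
  proof (rule bij_betwI')
    fix f g assume f: "f \<in> classes S R \<rightarrow>\<^sub>E {..<q}" and g: "g \<in> classes S R \<rightarrow>\<^sub>E {..<q}"
    show "(\<lambda>p\<in>S. f (?cl p)) = (\<lambda>p\<in>S. g (?cl p)) \<longleftrightarrow> f = g"
    proof
      assume eq: "(\<lambda>p\<in>S. f (?cl p)) = (\<lambda>p\<in>S. g (?cl p))"
      show "f = g"
      proof (rule PiE_ext[OF f g])
        fix C assume "C \<in> classes S R"
        then obtain p where "p \<in> S" "C = ?cl p" by (auto simp: classes_image)
        then show "f C = g C" using fun_cong[OF eq, of p] by simp
      qed
    qed simp
  next
    fix f assume f: "f \<in> classes S R \<rightarrow>\<^sub>E {..<q}"
    have "f (?cl p) < q" if "p \<in> S" for p
      using f that by (auto simp: classes_image PiE_def Pi_def)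
    moreover have "?cl a = ?cl b" if "(a, b) \<in> R" for a b
      using that by (simp only: class_eq_iff glued_base)
    ultimately show "(\<lambda>p\<in>S. f (?cl p)) \<in> ?L" using R by auto
  next
    fix c assume c: "c \<in> ?L"
    define f where "f = (\<lambda>C\<in>classes S R. c (SOME p. p \<in> C))"
    have *: "c (SOME x. x \<in> ?cl p) = c p" for p
    proof -
      have "p \<in> ?cl p" by simp
      then have "(SOME x. x \<in> ?cl p) \<in> ?cl p" by (rule someI)
      then have "c p = c (SOME x. x \<in> ?cl p)"
        using c by (intro glued_respects[of p _ R c]) auto
      then show ?thesis by simp
    qed
    have "f \<in> classes S R \<rightarrow>\<^sub>E {..<q}"
      unfolding f_def using c * by (auto simp: classes_image PiE_def Pi_def)
    moreover have "c = (\<lambda>p\<in>S. f (?cl p))"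
      using c * by (intro ext) (auto simp: f_def classes_image PiE_def extensional_def)
    ultimately show "\<exists>f\<in>classes S R \<rightarrow>\<^sub>E {..<q}. c = (\<lambda>p\<in>S. f (?cl p))" by blast
  qed
  then have "card ?L = card (classes S R \<rightarrow>\<^sub>E {..<q})" by (simp add: bij_betw_same_card)
  also have "\<dots> = q ^ card (classes S R)" using fin by (simp add: card_PiE)
  finally show ?thesis .
qed

section \<open>Words of marks, their loops and their colourings\<close>

type_synonym 'v letter = "'v set \<times> mark"

text \<open>A word of length \<open>k\<close> has levels \<open>0, \<dots>, k\<close>, the site \<open>(i, x)\<close> standing for the vertex \<open>x\<close>
  between the marks \<open>i - 1\<close> and \<open>i\<close>. The letter \<open>l\<close> between the levels \<open>i\<close> and \<open>j\<close> glues the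
  sites that a loop connects: straight through away from the edge, crosswise for a cross, and on
  the same side for a bar. Loops carry no orientation here; they are classes of sites.\<close>

definition glue :: "'v set \<Rightarrow> 'v letter \<Rightarrow> nat \<Rightarrow> nat \<Rightarrow> ((nat \<times> 'v) \<times> (nat \<times> 'v)) set" where
  "glue V l i j = {((i, x), (j, x)) | x. x \<in> V - fst l} \<union>
     (case snd l of
        Cross \<Rightarrow> {((i, x), (j, y)) | x y. fst l = {x, y}}
      | Bar \<Rightarrow> {((i, x), (i, y)) | x y. fst l = {x, y}} \<union> {((j, x), (j, y)) | x y. fst l = {x, y}})"

definition strands :: "'v set \<Rightarrow> 'v letter list \<Rightarrow> ((nat \<times> 'v) \<times> (nat \<times> 'v)) set" where
  "strands V w = (\<Union>i<length w. glue V (w ! i) i (Suc i))"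

text \<open>The last level is glued to level \<open>0\<close> through one more letter \<open>l\<close>. The circle itself corresponds
  to the letter with the empty edge, which glues every vertex straight through; other letters
  describe the effect of an additional mark at time \<open>0\<close>.\<close>

definition closing :: "'v set \<Rightarrow> 'v letter list \<Rightarrow> 'v letter \<Rightarrow> ((nat \<times> 'v) \<times> (nat \<times> 'v)) set" where
  "closing V w l = strands V w \<union> glue V l (length w) 0"

abbreviation no_mark :: "'v letter" where "no_mark \<equiv> ({}, Cross)"

abbreviation sites :: "'v set \<Rightarrow> 'v letter list \<Rightarrow> (nat \<times> 'v) set" where
  "sites V w \<equiv> {..length w} \<times> V"

definition word_loops :: "'v set \<Rightarrow> 'v letter list \<Rightarrow> nat" where
  "word_loops V w = card (classes (sites V w) (closing V w no_mark))"

text \<open>The condition that a letter imposes on the colours at its two sides: the matrix element of the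
  operator of a mark.\<close>

definition fits :: "'v set \<Rightarrow> 'v letter \<Rightarrow> ('v \<Rightarrow> nat) \<Rightarrow> ('v \<Rightarrow> nat) \<Rightarrow> bool" where
  "fits V l \<sigma> \<tau> \<longleftrightarrow> (\<forall>x\<in>V - fst l. \<sigma> x = \<tau> x) \<and>
     (\<forall>x y. fst l = {x, y} \<longrightarrow>
        (case snd l of Cross \<Rightarrow> \<sigma> x = \<tau> y | Bar \<Rightarrow> \<sigma> x = \<sigma> y \<and> \<tau> x = \<tau> y))"

lemma fits_sym: "fits V l \<sigma> \<tau> \<longleftrightarrow> fits V l \<tau> \<sigma>"
proof -
  have "fits V l \<tau> \<sigma>" if "fits V l \<sigma> \<tau>" for \<sigma> \<tau>
    using that unfolding fits_def by (auto split: mark.splits) (metis insert_commute)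
  then show ?thesis by blast
qed

lemma fits_cong:
  assumes l: "fst l \<subseteq> V" and eq: "\<forall>x\<in>V. \<sigma> x = \<sigma>' x \<and> \<tau> x = \<tau>' x"
  shows "fits V l \<sigma> \<tau> \<longleftrightarrow> fits V l \<sigma>' \<tau>'"
proof -
  have "fits V l \<sigma>' \<tau>'" if f: "fits V l \<sigma> \<tau>" and eq: "\<forall>x\<in>V. \<sigma> x = \<sigma>' x \<and> \<tau> x = \<tau>' x" for \<sigma> \<sigma>' \<tau> \<tau>'
    unfolding fits_def
  proof (intro conjI ballI allI impI)
    fix x y assume e: "fst l = {x, y}"
    then have "x \<in> V" "y \<in> V" using l by auto
    moreover from f e have "case snd l of Cross \<Rightarrow> \<sigma> x = \<tau> y | Bar \<Rightarrow> \<sigma> x = \<sigma> y \<and> \<tau> x = \<tau> y"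
      unfolding fits_def by blast
    ultimately show "case snd l of Cross \<Rightarrow> \<sigma>' x = \<tau>' y | Bar \<Rightarrow> \<sigma>' x = \<sigma>' y \<and> \<tau>' x = \<tau>' y"
      using eq by (auto split: mark.splits)
  qed (use f eq in \<open>auto simp: fits_def\<close>)
  from this[of \<sigma> \<tau> \<sigma>' \<tau>'] this[of \<sigma>' \<tau>' \<sigma> \<tau>] eq show ?thesis by auto
qed

lemma respects_glue:
  "(\<forall>(p, q)\<in>glue V l i j. c p = c q) \<longleftrightarrow> fits V l (\<lambda>x. c (i, x)) (\<lambda>x. c (j, x))"
proof -
  have 1: "(\<forall>(p, q)\<in>{((i', x), (j', x)) | x. x \<in> A}. c p = c q) \<longleftrightarrow> (\<forall>x\<in>A. c (i', x) = c (j', x))"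
    for i' j' A by blast
  have 2: "(\<forall>(p, q)\<in>{((i', x), (j', y)) | x y. fst l = {x, y}}. c p = c q) \<longleftrightarrow>
      (\<forall>x y. fst l = {x, y} \<longrightarrow> c (i', x) = c (j', y))" for i' j' by blast
  show ?thesis
    by (cases "snd l") (simp_all only: glue_def fits_def ball_Un 1 2 mark.case, blast+)
qed

lemma glue_subset:
  assumes "fst l \<subseteq> V"
  shows "glue V l i j \<subseteq> ({i, j} \<times> V) \<times> ({i, j} \<times> V)"
proof -
  have "x \<in> V \<and> y \<in> V" if "fst l = {x, y}" for x y using that assms by simp
  then show ?thesis using assms
    by (cases "snd l") (simp_all only: glue_def mark.case, blast+)
qed

lemma strands_subset:
  assumes "\<forall>l\<in>set w. fst l \<subseteq> V" shows "strands V w \<subseteq> sites V w \<times> sites V w"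
  unfolding strands_def
proof (rule UN_least)
  fix i assume i: "i \<in> {..<length w}"
  have "glue V (w ! i) i (Suc i) \<subseteq> ({i, Suc i} \<times> V) \<times> ({i, Suc i} \<times> V)"
    using i assms by (intro glue_subset) simp
  also have "\<dots> \<subseteq> sites V w \<times> sites V w" using i by (intro Sigma_mono) auto
  finally show "glue V (w ! i) i (Suc i) \<subseteq> sites V w \<times> sites V w" .
qed

lemma closing_subset:
  assumes "\<forall>l\<in>set w. fst l \<subseteq> V" "fst l \<subseteq> V"
  shows "closing V w l \<subseteq> sites V w \<times> sites V w"
proof -
  have "glue V l (length w) 0 \<subseteq> ({length w, 0} \<times> V) \<times> ({length w, 0} \<times> V)"
    by (rule glue_subset[OF assms(2)])
  also have "\<dots> \<subseteq> sites V w \<times> sites V w" by (intro Sigma_mono) auto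
  finally show ?thesis using strands_subset[OF assms(1)] by (simp add: closing_def)
qed

lemma strands_snoc:
  "strands V (w @ [l]) = strands V w \<union> glue V l (length w) (Suc (length w))"
  by (simp add: strands_def lessThan_Suc nth_append Un_commute)

text \<open>Matrix elements of the product of the operators of the letters, written as the number of
  colourings of all levels with prescribed first and last level.\<close>

definition kern :: "'v set \<Rightarrow> nat \<Rightarrow> 'v letter list \<Rightarrow> ('v \<Rightarrow> nat) \<Rightarrow> ('v \<Rightarrow> nat) \<Rightarrow> nat" where
  "kern V q w \<sigma> \<tau> = card {c \<in> sites V w \<rightarrow>\<^sub>E {..<q}. (\<forall>(a, b)\<in>strands V w. c a = c b) \<and>
      (\<forall>x\<in>V. c (0, x) = \<sigma> x \<and> c (length w, x) = \<tau> x)}"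

lemma kern_Nil:
  assumes "\<sigma> \<in> V \<rightarrow>\<^sub>E {..<q}" "\<tau> \<in> V \<rightarrow>\<^sub>E {..<q}"
  shows "kern V q [] \<sigma> \<tau> = of_bool (\<sigma> = \<tau>)"
proof -
  have "{c \<in> sites V ([]::'a letter list) \<rightarrow>\<^sub>E {..<q}. \<forall>x\<in>V. c (0, x) = \<sigma> x \<and> c (0, x) = \<tau> x} =
      (if \<sigma> = \<tau> then {\<lambda>(i, x)\<in>{0} \<times> V. \<sigma> x} else {})" (is "?L = _")
  proof (cases "\<sigma> = \<tau>")
    case True
    let ?c = "\<lambda>(i, x)\<in>{0::nat} \<times> V. \<sigma> x"
    have "?c \<in> ({0} \<times> V) \<rightarrow>\<^sub>E {..<q}"
      using PiE_mem[OF assms(1)] by (intro PiE_I) auto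
    then have "?c \<in> ?L" using True by simp
    moreover have "c = ?c" if "c \<in> ({0} \<times> V) \<rightarrow>\<^sub>E {..<q}" "\<forall>x\<in>V. c (0, x) = \<sigma> x" for c
      using that PiE_arb[OF that(1)] by (auto simp: fun_eq_iff)
    then have "c = ?c" if "c \<in> ?L" for c using that by simp
    ultimately have "?L = {?c}" by blast
    then show ?thesis using True by simp
  next
    case False
    then obtain x where "x \<in> V" "\<sigma> x \<noteq> \<tau> x" using assms by (metis PiE_ext)
    then have "?L = {}" by auto
    then show ?thesis using False by simp
  qed
  then show ?thesis by (auto simp: kern_def strands_def)
qed

text \<open>Taking the trace against the operator of a closing letter sums over all colourings of the closed
  word, each class of sites being coloured freely.\<close>

lemma sum_kern_closing:
  assumes V: "finite V" and w: "\<forall>l\<in>set w. fst l \<subseteq> V" and l: "fst l \<subseteq> V"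
  shows "(\<Sum>\<sigma>\<in>V \<rightarrow>\<^sub>E {..<q}. \<Sum>\<tau>\<in>V \<rightarrow>\<^sub>E {..<q}. kern V q w \<sigma> \<tau> * of_bool (fits V l \<tau> \<sigma>)) =
    q ^ card (classes (sites V w) (closing V w l))"
proof -
  let ?\<Sigma> = "V \<rightarrow>\<^sub>E {..<q}"
  let ?C = "{c \<in> sites V w \<rightarrow>\<^sub>E {..<q}. \<forall>(a, b)\<in>closing V w l. c a = c b}"
  let ?h = "\<lambda>c. (\<lambda>x\<in>V. c (0, x), \<lambda>x\<in>V. c (length w, x))"
  have "finite (sites V w \<rightarrow>\<^sub>E {..<q})" using V by (auto intro!: finite_PiE)
  then have fin: "finite ?C" "finite (?\<Sigma> \<times> ?\<Sigma>)"
    using V by (auto intro!: finite_PiE elim: rev_finite_subset)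
  have h: "?h ` ?C \<subseteq> ?\<Sigma> \<times> ?\<Sigma>" by (auto simp: PiE_def Pi_def)
  have fib: "card {c \<in> ?C. ?h c = (\<sigma>, \<tau>)} = kern V q w \<sigma> \<tau> * of_bool (fits V l \<tau> \<sigma>)"
    if st: "\<sigma> \<in> ?\<Sigma>" "\<tau> \<in> ?\<Sigma>" for \<sigma> \<tau>
  proof -
    have eqv: "?h c = (\<sigma>, \<tau>) \<longleftrightarrow> (\<forall>x\<in>V. c (0, x) = \<sigma> x \<and> c (length w, x) = \<tau> x)" for c
      using st by (auto simp: fun_eq_iff PiE_def extensional_def)
    have comp: "fits V l (\<lambda>x. c (length w, x)) (\<lambda>x. c (0, x)) \<longleftrightarrow> fits V l \<tau> \<sigma>"
      if "\<forall>x\<in>V. c (0, x) = \<sigma> x \<and> c (length w, x) = \<tau> x" for c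
      using that by (intro fits_cong[OF l]) auto
    have cl: "(\<forall>(a, b)\<in>closing V w l. c a = c b) \<longleftrightarrow> (\<forall>(a, b)\<in>strands V w. c a = c b) \<and>
        fits V l (\<lambda>x. c (length w, x)) (\<lambda>x. c (0, x))" for c :: "nat \<times> 'a \<Rightarrow> nat"
      unfolding closing_def ball_Un respects_glue ..
    have "{c \<in> ?C. ?h c = (\<sigma>, \<tau>)} = (if fits V l \<tau> \<sigma> then
      {c \<in> sites V w \<rightarrow>\<^sub>E {..<q}. (\<forall>(a, b)\<in>strands V w. c a = c b) \<and>
      (\<forall>x\<in>V. c (0, x) = \<sigma> x \<and> c (length w, x) = \<tau> x)} else {})"
      unfolding eqv cl using comp by auto
    then show ?thesis by (simp add: kern_def)
  qed
  have "(\<Sum>\<sigma>\<in>?\<Sigma>. \<Sum>\<tau>\<in>?\<Sigma>. kern V q w \<sigma> \<tau> * of_bool (fits V l \<tau> \<sigma>)) =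
      (\<Sum>p\<in>?\<Sigma> \<times> ?\<Sigma>. card {c \<in> ?C. ?h c = p})"
    unfolding sum.cartesian_product
  proof (intro sum.cong refl)
    fix p assume p: "p \<in> ?\<Sigma> \<times> ?\<Sigma>"
    obtain \<sigma> \<tau> where st: "p = (\<sigma>, \<tau>)" by fastforce
    show "(case p of (\<sigma>, \<tau>) \<Rightarrow> kern V q w \<sigma> \<tau> * of_bool (fits V l \<tau> \<sigma>)) = card {c \<in> ?C. ?h c = p}"
      unfolding st prod.case using p unfolding st by (intro fib[symmetric]) blast+
  qed
  also have "\<dots> = card ?C"
    using sum_fun_comp[OF fin h, of "\<lambda>_. 1 :: nat"] by simp
  also have "\<dots> = q ^ card (classes (sites V w) (closing V w l))"
    using V closing_subset[OF w l] by (intro card_respecting_colourings) auto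
  finally show ?thesis .
qed

text \<open>Multiplication by one more operator: the colouring of the penultimate level is summed over.\<close>

lemma kern_snoc:
  assumes V: "finite V" and w: "\<forall>l\<in>set w. fst l \<subseteq> V" and l: "fst l \<subseteq> V"
    and \<tau>: "\<tau> \<in> V \<rightarrow>\<^sub>E {..<q}"
  shows "kern V q (w @ [l]) \<sigma> \<tau> = (\<Sum>\<rho>\<in>V \<rightarrow>\<^sub>E {..<q}. kern V q w \<sigma> \<rho> * of_bool (fits V l \<rho> \<tau>))"
proof -
  let ?\<Sigma> = "V \<rightarrow>\<^sub>E {..<q}"
  let ?k = "length w"
  let ?D = "\<lambda>\<rho>. {c \<in> sites V w \<rightarrow>\<^sub>E {..<q}. (\<forall>(a, b)\<in>strands V w. c a = c b) \<and>
      (\<forall>x\<in>V. c (0, x) = \<sigma> x \<and> c (?k, x) = \<rho> x)}"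
  let ?C = "{c \<in> sites V (w @ [l]) \<rightarrow>\<^sub>E {..<q}. (\<forall>(a, b)\<in>strands V (w @ [l]). c a = c b) \<and>
      (\<forall>x\<in>V. c (0, x) = \<sigma> x \<and> c (Suc ?k, x) = \<tau> x)}"
  let ?ext = "\<lambda>c (i, x). if i = Suc ?k \<and> x \<in> V then \<tau> x else c (i, x)"
  let ?P = "{\<rho> \<in> ?\<Sigma>. fits V l \<rho> \<tau>}"
  have "finite (sites V w \<rightarrow>\<^sub>E {..<q})" using V by (auto intro!: finite_PiE)
  then have finD: "finite (?D \<rho>)" for \<rho> by (rule rev_finite_subset) auto
  have fin: "finite ?\<Sigma>" using V by (auto intro!: finite_PiE)
  have sub: "strands V w \<subseteq> sites V w \<times> sites V w" by (rule strands_subset[OF w])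
  have "bij_betw (\<lambda>c. restrict c (sites V w)) ?C (\<Union>\<rho>\<in>?P. ?D \<rho>)"
  proof (rule bij_betw_byWitness[where f' = ?ext])
    show "\<forall>c\<in>?C. ?ext (restrict c (sites V w)) = c"
    proof (intro ballI ext)
      fix c p assume c: "c \<in> ?C"
      then have cP: "c \<in> sites V (w @ [l]) \<rightarrow>\<^sub>E {..<q}" and end': "\<forall>x\<in>V. c (Suc ?k, x) = \<tau> x" by auto
      show "?ext (restrict c (sites V w)) p = c p"
        using end' PiE_arb[OF cP, of p] by (cases p) (auto simp: le_Suc_eq)
    qed
    show "\<forall>c\<in>(\<Union>\<rho>\<in>?P. ?D \<rho>). restrict (?ext c) (sites V w) = c"
    proof (intro ballI ext)
      fix c p assume "c \<in> (\<Union>\<rho>\<in>?P. ?D \<rho>)"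
      then have cP: "c \<in> sites V w \<rightarrow>\<^sub>E {..<q}" by blast
      show "restrict (?ext c) (sites V w) p = c p"
        using PiE_arb[OF cP, of p] by (cases p) auto
    qed
    show "(\<lambda>c. restrict c (sites V w)) ` ?C \<subseteq> (\<Union>\<rho>\<in>?P. ?D \<rho>)"
    proof (rule image_subsetI)
      fix c assume c: "c \<in> ?C"
      let ?\<rho> = "\<lambda>x\<in>V. c (?k, x)"
      have 1: "\<forall>(a, b)\<in>strands V w. c a = c b" and "fits V l (\<lambda>x. c (?k, x)) (\<lambda>x. c (Suc ?k, x))"
        using c unfolding strands_snoc ball_Un respects_glue[symmetric] by auto
      then have "fits V l ?\<rho> \<tau>" using c by (subst (asm) fits_cong[OF l, of _ ?\<rho> _ \<tau>]) auto
      moreover have "?\<rho> \<in> ?\<Sigma>" using c by (auto simp: PiE_def Pi_def)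
      moreover have "restrict c (sites V w) \<in> ?D ?\<rho>"
      proof (intro CollectI conjI)
        have "c p < q" if "p \<in> sites V w" for p using c that by (auto simp: PiE_def Pi_def)
        then show "restrict c (sites V w) \<in> sites V w \<rightarrow>\<^sub>E {..<q}" by (simp add: restrict_PiE_iff)
        show "\<forall>x\<in>V. restrict c (sites V w) (0, x) = \<sigma> x \<and> restrict c (sites V w) (?k, x) = ?\<rho> x"
          using c by simp
        show "\<forall>(a, b)\<in>strands V w. restrict c (sites V w) a = restrict c (sites V w) b"
        proof safe
          fix a b assume ab: "(a, b) \<in> strands V w"
          then have "a \<in> sites V w" "b \<in> sites V w" "c a = c b" using sub 1 by auto
          then show "restrict c (sites V w) a = restrict c (sites V w) b" by simp
        qed
      qed
      ultimately show "restrict c (sites V w) \<in> (\<Union>\<rho>\<in>?P. ?D \<rho>)" by blast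
    qed
    show "?ext ` (\<Union>\<rho>\<in>?P. ?D \<rho>) \<subseteq> ?C"
    proof (rule image_subsetI)
      fix c assume "c \<in> (\<Union>\<rho>\<in>?P. ?D \<rho>)"
      then obtain \<rho> where \<rho>: "\<rho> \<in> ?\<Sigma>" "fits V l \<rho> \<tau>" and c: "c \<in> ?D \<rho>" by blast
      have cP: "c \<in> sites V w \<rightarrow>\<^sub>E {..<q}" using c by blast
      have eq: "?ext c p = c p" if "p \<in> sites V w" for p using that by auto
      have 1: "\<forall>(a, b)\<in>strands V w. ?ext c a = ?ext c b"
      proof
        fix p assume p: "p \<in> strands V w"
        obtain a b where ab: "p = (a, b)" by (cases p)
        then have "a \<in> sites V w" "b \<in> sites V w" "c a = c b" using sub c p by auto
        then show "case p of (a, b) \<Rightarrow> ?ext c a = ?ext c b" unfolding ab prod.case by (simp only: eq)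
      qed
      have 2: "fits V l (\<lambda>x. ?ext c (?k, x)) (\<lambda>x. ?ext c (Suc ?k, x))"
        using \<rho>(2) c by (subst fits_cong[OF l, of _ \<rho> _ \<tau>]) auto
      show "?ext c \<in> ?C"
      proof (intro CollectI conjI)
        show "\<forall>(a, b)\<in>strands V (w @ [l]). ?ext c a = ?ext c b"
          unfolding strands_snoc ball_Un respects_glue using 1 2 by blast
        show "\<forall>x\<in>V. ?ext c (0, x) = \<sigma> x \<and> ?ext c (Suc ?k, x) = \<tau> x"
          using c by simp
        have "?ext c p < q" if pin: "p \<in> sites V (w @ [l])" for p
        proof (cases "p \<in> sites V w")
          case True
          then show ?thesis using PiE_mem[OF cP True] unfolding eq[OF True] by simp
        next
          case False
          then obtain x where "p = (Suc ?k, x)" "x \<in> V" using pin by (cases p) auto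
          then show ?thesis using PiE_mem[OF \<tau>] by simp
        qed
        moreover have "?ext c p = undefined" if "p \<notin> sites V (w @ [l])" for p
          using PiE_arb[OF cP, of p] that by (cases p) auto
        ultimately show "?ext c \<in> sites V (w @ [l]) \<rightarrow>\<^sub>E {..<q}"
          by (intro PiE_I) (simp_all only: lessThan_iff)
      qed
    qed
  qed
  then have "card ?C = card (\<Union>\<rho>\<in>?P. ?D \<rho>)" by (rule bij_betw_same_card)
  also have "\<dots> = (\<Sum>\<rho>\<in>?P. card (?D \<rho>))"
  proof (rule card_UN_disjoint)
    show "\<forall>\<rho>\<in>?P. \<forall>\<rho>'\<in>?P. \<rho> \<noteq> \<rho>' \<longrightarrow> ?D \<rho> \<inter> ?D \<rho>' = {}"
    proof (intro ballI impI)
      fix \<rho> \<rho>' assume *: "\<rho> \<in> ?P" "\<rho>' \<in> ?P" "\<rho> \<noteq> \<rho>'"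
      then obtain x where "x \<in> V" "\<rho> x \<noteq> \<rho>' x" by (metis (no_types, lifting) PiE_ext mem_Collect_eq)
      then show "?D \<rho> \<inter> ?D \<rho>' = {}" unfolding disjoint_iff mem_Collect_eq by metis
    qed
  qed (use fin finD in auto)
  also have "\<dots> = (\<Sum>\<rho>\<in>?\<Sigma>. kern V q w \<sigma> \<rho> * of_bool (fits V l \<rho> \<tau>))"
    unfolding kern_def using fin by (intro sum.mono_neutral_cong_left) auto
  finally show ?thesis by (simp add: kern_def)
qed

section \<open>Closing a word by one more mark\<close>

definition edge_letters :: "'v set \<Rightarrow> 'v letter set" where
  "edge_letters V = {l. fst l \<subseteq> V \<and> card (fst l) = 2}"

text \<open>Straight and crossed strands carry the sites of \<open>C\<close> across the letter one to one, and a bar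
  connects sites of the same level in pairs.\<close>

lemma glue_parity:
  assumes V: "finite V" and l: "l \<in> edge_letters V"
    and C: "\<forall>(p, q)\<in>glue V l i j. p \<in> C \<longleftrightarrow> q \<in> C"
  shows "even (card {x\<in>V. (i, x) \<in> C} + card {x\<in>V. (j, x) \<in> C})"
proof -
  obtain a b where e: "fst l = {a, b}" and ab: "a \<noteq> b"
    using l by (auto simp: edge_letters_def card_2_iff)
  then have V': "a \<in> V" "b \<in> V" using l by (auto simp: edge_letters_def)
  have split: "card {x\<in>V. (h, x) \<in> C} =
      card {x\<in>V - {a, b}. (h, x) \<in> C} + (of_bool ((h, a) \<in> C) + of_bool ((h, b) \<in> C))" for h
  proof -
    have "{x\<in>V. (h, x) \<in> C} = {x\<in>V - {a, b}. (h, x) \<in> C} \<union> {x\<in>{a, b}. (h, x) \<in> C}"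
      using V' by auto
    then have "card {x\<in>V. (h, x) \<in> C} = card {x\<in>V - {a, b}. (h, x) \<in> C} + card {x\<in>{a, b}. (h, x) \<in> C}"
      using V by (simp add: card_Un_disjoint disjoint_iff)
    moreover have "{x\<in>{a, b}. (h, x) \<in> C} =
        (if (h, a) \<in> C then {a} else {}) \<union> (if (h, b) \<in> C then {b} else {})" by auto
    ultimately show ?thesis using ab by simp
  qed
  have "((i, x), (j, x)) \<in> glue V l i j" if "x \<in> V - {a, b}" for x
    using that e by (auto simp: glue_def)
  then have rest: "{x\<in>V - {a, b}. (i, x) \<in> C} = {x\<in>V - {a, b}. (j, x) \<in> C}"
    using C by blast
  show ?thesis
  proof (cases "snd l")
    case Cross
    then have "((i, a), (j, b)) \<in> glue V l i j" "((i, b), (j, a)) \<in> glue V l i j"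
      using e by (auto simp: glue_def)
    then have "(i, a) \<in> C \<longleftrightarrow> (j, b) \<in> C" "(i, b) \<in> C \<longleftrightarrow> (j, a) \<in> C" using C by blast+
    then show ?thesis unfolding split rest by auto
  next
    case Bar
    then have "((i, a), (i, b)) \<in> glue V l i j" "((j, a), (j, b)) \<in> glue V l i j"
      using e by (auto simp: glue_def)
    then have "(i, a) \<in> C \<longleftrightarrow> (i, b) \<in> C" "(j, a) \<in> C \<longleftrightarrow> (j, b) \<in> C" using C by blast+
    then show ?thesis unfolding split rest by auto
  qed
qed

lemma strands_parity:
  assumes V: "finite V" and w: "set w \<subseteq> edge_letters V"
    and C: "\<forall>(p, q)\<in>strands V w. p \<in> C \<longleftrightarrow> q \<in> C"
  shows "even (card {x\<in>V. (0, x) \<in> C} + card {x\<in>V. (length w, x) \<in> C})"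
  using w C
proof (induction w rule: rev_induct)
  case (snoc l w)
  have "even (card {x\<in>V. (0, x) \<in> C} + card {x\<in>V. (length w, x) \<in> C})"
    using snoc.prems by (intro snoc.IH) (auto simp: strands_snoc)
  moreover have "even (card {x\<in>V. (length w, x) \<in> C} + card {x\<in>V. (Suc (length w), x) \<in> C})"
    using snoc.prems V by (intro glue_parity[of V l]) (auto simp: strands_snoc)
  ultimately show ?case by simp
qed simp

text \<open>Let \<open>a, b\<close> be the ends at the levels \<open>0\<close> and \<open>k\<close> of a vertex \<open>x\<close>, and \<open>c, d\<close> those of a
  vertex \<open>y\<close>. By parity every end is connected to another one, so the ends are paired in one of three
  ways or all connected. Closing straight through, by a cross or by a bar joins these ends in three
  different ways, and comparing the numbers of classes is then a finite check.\<close>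

lemma pairing_reconnection:
  fixes P :: "('p \<times> 'p) set"
  defines "r \<equiv> \<lambda>p q. (p, q) \<in> glued P"
  assumes S: "finite S" "a \<in> S" "b \<in> S" "c \<in> S" "d \<in> S"
    and parity: "\<And>p. p \<in> {a, b, c, d} \<Longrightarrow>
      even (of_bool (r p a) + of_bool (r p b) + of_bool (r p c) + of_bool (r p d) :: nat)"
  shows "(a, c) \<notin> glued (insert (b, a) (insert (d, c) P)) \<Longrightarrow>
      card (classes S (insert (b, c) (insert (d, a) P))) + 1 = card (classes S (insert (b, a) (insert (d, c) P))) \<and>
      card (classes S (insert (b, d) (insert (a, c) P))) + 1 = card (classes S (insert (b, a) (insert (d, c) P)))"
    and "(a, c) \<in> glued (insert (b, a) (insert (d, c) P)) \<Longrightarrow>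
      card (classes S (insert (b, c) (insert (d, a) P))) \<le> card (classes S (insert (b, a) (insert (d, c) P))) + 1 \<and>
      card (classes S (insert (b, d) (insert (a, c) P))) \<le> card (classes S (insert (b, a) (insert (d, c) P))) + 1 \<and>
      (card (classes S (insert (b, c) (insert (d, a) P))) \<le> card (classes S (insert (b, a) (insert (d, c) P))) \<or>
       card (classes S (insert (b, d) (insert (a, c) P))) \<le> card (classes S (insert (b, a) (insert (d, c) P))))"
proof -
  have sym: "r p q \<longleftrightarrow> r q p" for p q unfolding r_def by (blast intro: glued_sym)
  have refl: "r p p" for p unfolding r_def by simp
  have trans: "r p q \<Longrightarrow> r q s \<Longrightarrow> r p s" for p q s unfolding r_def by (blast intro: glued_trans)
  let ?N = "\<lambda>R. card (classes S R)"
  have two: "?N P = ?N (insert (p, q) (insert (s, t) P)) + of_bool (\<not> r s t) +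
      of_bool (\<not> (r p q \<or> r p s \<and> r t q \<or> r p t \<and> r s q))"
    if "p \<in> S" "q \<in> S" "s \<in> S" "t \<in> S" for p q s t
    using card_classes_insert[of S s t P] card_classes_insert[of S p q "insert (s, t) P"] S(1) that
    by (simp add: glued_insert r_def)
  note N = two[of b a d c] two[of b c d a] two[of b d a c]
  have g: "(a, c) \<in> glued (insert (b, a) (insert (d, c) P)) \<longleftrightarrow> r a c \<or> r a d \<or> r b c \<or> r b d"
  proof -
    have "(p, c) \<in> glued (insert (d, c) P) \<longleftrightarrow> r p c \<or> r p d" for p
      by (auto simp: glued_insert r_def)
    then show ?thesis by (subst glued_insert) auto
  qed
  note par = parity[of a] parity[of b] parity[of c] parity[of d]
  \<comment> \<open>The three pairings of the four ends, and the case that all of them are connected.\<close>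
  consider (M1) "r a b" "r c d" "\<not> r a c" "\<not> r a d" "\<not> r b c" "\<not> r b d"
    | (M2) "r a c" "r b d" "\<not> r a b" "\<not> r a d" "\<not> r c b" "\<not> r c d"
    | (M3) "r a d" "r b c" "\<not> r a b" "\<not> r a c" "\<not> r d b" "\<not> r d c"
    | (All) "r a b" "r a c" "r a d" "r b c" "r b d" "r c d"
  proof -
    have a: "r a b \<and> \<not> r a c \<and> \<not> r a d \<or> \<not> r a b \<and> r a c \<and> \<not> r a d \<or>
        \<not> r a b \<and> \<not> r a c \<and> r a d \<or> r a b \<and> r a c \<and> r a d"
      using par(1) refl by (cases "r a b"; cases "r a c"; cases "r a d") simp_all
    have c: "r c a \<or> r c b \<or> r c d" using par(3) refl
      by (cases "r c a"; cases "r c b"; cases "r c d") simp_all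
    have b: "r b a \<or> r b c \<or> r b d" using par(2) refl
      by (cases "r b a"; cases "r b c"; cases "r b d") simp_all
    from a show thesis
    proof (elim disjE conjE)
      assume *: "r a b" "\<not> r a c" "\<not> r a d"
      show thesis by (rule M1) (use * c in \<open>metis sym trans\<close>)+
    next
      assume *: "\<not> r a b" "r a c" "\<not> r a d"
      show thesis by (rule M2) (use * b in \<open>metis sym trans\<close>)+
    next
      assume *: "\<not> r a b" "\<not> r a c" "r a d"
      show thesis by (rule M3) (use * b in \<open>metis sym trans\<close>)+
    next
      assume *: "r a b" "r a c" "r a d"
      show thesis by (rule All) (use * in \<open>metis sym trans\<close>)+
    qed
  qed
  note cases = this
  have s: "r b a = r a b" "r c a = r a c" "r d a = r a d" "r c b = r b c" "r d b = r b d" "r d c = r c d"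
    using sym by blast+
  show "(a, c) \<notin> glued (insert (b, a) (insert (d, c) P)) \<Longrightarrow>
      ?N (insert (b, c) (insert (d, a) P)) + 1 = ?N (insert (b, a) (insert (d, c) P)) \<and>
      ?N (insert (b, d) (insert (a, c) P)) + 1 = ?N (insert (b, a) (insert (d, c) P))"
    using N S unfolding g by (cases rule: cases) (simp_all add: s refl)
  show "(a, c) \<in> glued (insert (b, a) (insert (d, c) P)) \<Longrightarrow>
      ?N (insert (b, c) (insert (d, a) P)) \<le> ?N (insert (b, a) (insert (d, c) P)) + 1 \<and>
      ?N (insert (b, d) (insert (a, c) P)) \<le> ?N (insert (b, a) (insert (d, c) P)) + 1 \<and>
      (?N (insert (b, c) (insert (d, a) P)) \<le> ?N (insert (b, a) (insert (d, c) P)) \<or>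
       ?N (insert (b, d) (insert (a, c) P)) \<le> ?N (insert (b, a) (insert (d, c) P)))"
    using N S unfolding g by (cases rule: cases) (simp_all add: s refl)
qed

text \<open>The effect of a mark at time \<open>0\<close> on the loops: two different loops merge, and within one loop
  the pairing of the ends decides which of the two types of mark splits it.\<close>

lemma closing_cases:
  fixes w :: "'v letter list"
  assumes V: "finite V" and w: "set w \<subseteq> edge_letters V" and xy: "x \<in> V" "y \<in> V" "x \<noteq> y"
  defines "N \<equiv> \<lambda>l. card (classes (sites V w) (closing V w l))"
  shows "((0, x), (0, y)) \<notin> glued (closing V w no_mark) \<Longrightarrow>
      N ({x, y}, Cross) + 1 = N no_mark \<and> N ({x, y}, Bar) + 1 = N no_mark"
    and "((0, x), (0, y)) \<in> glued (closing V w no_mark) \<Longrightarrow>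
      N ({x, y}, Cross) \<le> N no_mark + 1 \<and> N ({x, y}, Bar) \<le> N no_mark + 1 \<and>
      (N ({x, y}, Cross) \<le> N no_mark \<or> N ({x, y}, Bar) \<le> N no_mark)"
proof -
  let ?k = "length w"
  let ?a = "(0 :: nat, x)" and ?b = "(?k, x)" and ?c = "(0 :: nat, y)" and ?d = "(?k, y)"
  \<comment> \<open>The last level is glued to the first one except at \<open>x\<close> and \<open>y\<close>, where the word is left open.\<close>
  define P where "P = strands V w \<union> {((?k, z), (0, z)) | z. z \<in> V - {x, y}}"
  have id: "closing V w no_mark = insert (?b, ?a) (insert (?d, ?c) P)"
    using xy by (auto simp: closing_def glue_def P_def)
  have cross: "closing V w ({x, y}, Cross) = insert (?b, ?c) (insert (?d, ?a) P)"
    using xy by (auto simp: closing_def glue_def P_def doubleton_eq_iff)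
  have rev: "glued (insert (q, p) (insert (p, q) R)) = glued (insert (p, q) R)" for p q :: "nat \<times> 'v" and R
    by (auto simp: glued_def Un_commute intro!: arg_cong[where f = rtrancl])
  have "closing V w ({x, y}, Bar) = insert (?d, ?b) (insert (?b, ?d) (insert (?c, ?a) (insert (?a, ?c) P)))"
    using xy by (auto simp: closing_def glue_def P_def doubleton_eq_iff)
  then have bar: "glued (closing V w ({x, y}, Bar)) = glued (insert (?b, ?d) (insert (?a, ?c) P))"
  proof -
    assume eq: "closing V w ({x, y}, Bar) = insert (?d, ?b) (insert (?b, ?d) (insert (?c, ?a) (insert (?a, ?c) P)))"
    have "glued (insert (?d, ?b) (insert (?b, ?d) (insert (?c, ?a) (insert (?a, ?c) P)))) =
        glued (insert (?b, ?d) (insert (?c, ?a) (insert (?a, ?c) P)))" by (rule rev)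
    also have "\<dots> = glued (insert (?c, ?a) (insert (?a, ?c) (insert (?b, ?d) P)))"
      by (simp only: insert_commute)
    also have "\<dots> = glued (insert (?a, ?c) (insert (?b, ?d) P))" by (rule rev)
    finally show ?thesis unfolding eq by (simp only: insert_commute)
  qed
  have parity: "even (of_bool ((p, ?a) \<in> glued P) + of_bool ((p, ?b) \<in> glued P) +
      of_bool ((p, ?c) \<in> glued P) + of_bool ((p, ?d) \<in> glued P) :: nat)" for p
  proof -
    let ?C = "glued P `` {p}"
    have resp: "q \<in> ?C \<longleftrightarrow> q' \<in> ?C" if "(q, q') \<in> P" for q q'
      using glued_base[OF that] by (blast intro: glued_trans glued_sym)
    have ev: "even (card {z\<in>V. (0, z) \<in> ?C} + card {z\<in>V. (?k, z) \<in> ?C})"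
      using resp by (intro strands_parity[OF V w]) (auto simp: P_def)
    have split: "card {z\<in>V. (h, z) \<in> ?C} = card {z\<in>V - {x, y}. (h, z) \<in> ?C} +
        (of_bool ((h, x) \<in> ?C) + of_bool ((h, y) \<in> ?C))" for h
    proof -
      have "{z\<in>V. (h, z) \<in> ?C} = {z\<in>V - {x, y}. (h, z) \<in> ?C} \<union> {z\<in>{x, y}. (h, z) \<in> ?C}"
        using xy by auto
      then have "card {z\<in>V. (h, z) \<in> ?C} = card {z\<in>V - {x, y}. (h, z) \<in> ?C} + card {z\<in>{x, y}. (h, z) \<in> ?C}"
        using V by (simp add: card_Un_disjoint disjoint_iff)
      moreover have "{z\<in>{x, y}. (h, z) \<in> ?C} =
          (if (h, x) \<in> ?C then {x} else {}) \<union> (if (h, y) \<in> ?C then {y} else {})" by auto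
      ultimately show ?thesis using xy by simp
    qed
    have "(0, z) \<in> ?C \<longleftrightarrow> (?k, z) \<in> ?C" if "z \<in> V - {x, y}" for z
    proof -
      have "((?k, z), (0, z)) \<in> P" using that by (auto simp: P_def)
      from resp[OF this] show ?thesis by blast
    qed
    then have rest: "{z\<in>V - {x, y}. (0, z) \<in> ?C} = {z\<in>V - {x, y}. (?k, z) \<in> ?C}" by blast
    show ?thesis
      using ev[unfolded split rest] unfolding even_add Image_singleton_iff by blast
  qed
  have S: "finite (sites V w)" "?a \<in> sites V w" "?b \<in> sites V w" "?c \<in> sites V w" "?d \<in> sites V w"
    using V xy by auto
  show "((0, x), (0, y)) \<notin> glued (closing V w no_mark) \<Longrightarrow>
      N ({x, y}, Cross) + 1 = N no_mark \<and> N ({x, y}, Bar) + 1 = N no_mark"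
    unfolding N_def bar unfolding id cross
    by (rule pairing_reconnection(1)[OF S parity])
  show "((0, x), (0, y)) \<in> glued (closing V w no_mark) \<Longrightarrow>
      N ({x, y}, Cross) \<le> N no_mark + 1 \<and> N ({x, y}, Bar) \<le> N no_mark + 1 \<and>
      (N ({x, y}, Cross) \<le> N no_mark \<or> N ({x, y}, Bar) \<le> N no_mark)"
    unfolding N_def bar unfolding id cross
    by (rule pairing_reconnection(2)[OF S parity])
qed

lemma closing_weight:
  fixes q u :: real
  assumes V: "finite V" and w: "set w \<subseteq> edge_letters V" and xy: "x \<in> V" "y \<in> V" "x \<noteq> y"
    and q: "1 \<le> q" and u: "0 \<le> u" "u \<le> 1"
  defines "N \<equiv> \<lambda>l. card (classes (sites V w) (closing V w l))"
  shows "u * q ^ N ({x, y}, Cross) + (1 - u) * q ^ N ({x, y}, Bar) \<le> q ^ N no_mark *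
    (if ((0, x), (0, y)) \<in> glued (closing V w no_mark) then 1 + (q - 1) * max u (1 - u) else 1 / q)"
proof (cases "((0, x), (0, y)) \<in> glued (closing V w no_mark)")
  case False
  have "N ({x, y}, Cross) + 1 = N no_mark \<and> N ({x, y}, Bar) + 1 = N no_mark"
    unfolding N_def by (rule closing_cases(1)[OF V w xy False])
  then have "N no_mark = Suc (N ({x, y}, Cross))" "N ({x, y}, Bar) = N ({x, y}, Cross)" by auto
  then show ?thesis using False q by (simp add: field_simps)
next
  case True
  let ?n = "N no_mark"
  have *: "N ({x, y}, Cross) \<le> ?n + 1 \<and> N ({x, y}, Bar) \<le> ?n + 1 \<and>
      (N ({x, y}, Cross) \<le> ?n \<or> N ({x, y}, Bar) \<le> ?n)"
    unfolding N_def by (rule closing_cases(2)[OF V w xy True])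
  have mono: "q ^ i \<le> q ^ j" if "i \<le> j" for i j using q that by (rule power_increasing[rotated])
  have "u * q ^ N ({x, y}, Cross) + (1 - u) * q ^ N ({x, y}, Bar) \<le>
      q ^ ?n * (1 + (q - 1) * u) \<or>
    u * q ^ N ({x, y}, Cross) + (1 - u) * q ^ N ({x, y}, Bar) \<le> q ^ ?n * (1 + (q - 1) * (1 - u))"
  proof (cases "N ({x, y}, Bar) \<le> ?n")
    case True
    have "u * q ^ N ({x, y}, Cross) + (1 - u) * q ^ N ({x, y}, Bar) \<le> u * q ^ (?n + 1) + (1 - u) * q ^ ?n"
      using * True u by (intro add_mono mult_left_mono mono) auto
    then show ?thesis by (simp add: algebra_simps)
  next
    case False
    then have "u * q ^ N ({x, y}, Cross) + (1 - u) * q ^ N ({x, y}, Bar) \<le> u * q ^ ?n + (1 - u) * q ^ (?n + 1)"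
      using * u by (intro add_mono mult_left_mono mono) auto
    then show ?thesis by (simp add: algebra_simps)
  qed
  moreover have "q ^ ?n * (1 + (q - 1) * u) \<le> q ^ ?n * (1 + (q - 1) * max u (1 - u))"
    "q ^ ?n * (1 + (q - 1) * (1 - u)) \<le> q ^ ?n * (1 + (q - 1) * max u (1 - u))"
    using q by (auto intro!: mult_left_mono)
  ultimately show ?thesis using True by auto
qed

section \<open>Log-convexity of traces of matrix exponentials\<close>

text \<open>Powers of a matrix whose rows and columns are indexed by a finite set.\<close>

primrec mpow :: "'s set \<Rightarrow> ('s \<Rightarrow> 's \<Rightarrow> real) \<Rightarrow> nat \<Rightarrow> 's \<Rightarrow> 's \<Rightarrow> real" where
  "mpow S A 0 = (\<lambda>\<sigma> \<tau>. of_bool (\<sigma> = \<tau>))"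
| "mpow S A (Suc k) = (\<lambda>\<sigma> \<tau>. \<Sum>\<rho>\<in>S. mpow S A k \<sigma> \<rho> * A \<rho> \<tau>)"

definition mtrace :: "'s set \<Rightarrow> ('s \<Rightarrow> 's \<Rightarrow> real) \<Rightarrow> nat \<Rightarrow> real" where
  "mtrace S A k = (\<Sum>\<sigma>\<in>S. mpow S A k \<sigma> \<sigma>)"

lemma mpow_add:
  assumes S: "finite S" and "\<tau> \<in> S"
  shows "mpow S A (j + k) \<sigma> \<tau> = (\<Sum>\<rho>\<in>S. mpow S A j \<sigma> \<rho> * mpow S A k \<rho> \<tau>)"
  using assms(2)
proof (induction k arbitrary: \<tau>)
  case (Suc k)
  have "mpow S A (j + Suc k) \<sigma> \<tau> = (\<Sum>\<pi>\<in>S. (\<Sum>\<rho>\<in>S. mpow S A j \<sigma> \<rho> * mpow S A k \<rho> \<pi>) * A \<pi> \<tau>)"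
    using Suc.IH by simp
  also have "\<dots> = (\<Sum>\<rho>\<in>S. \<Sum>\<pi>\<in>S. mpow S A j \<sigma> \<rho> * mpow S A k \<rho> \<pi> * A \<pi> \<tau>)"
    unfolding sum_distrib_right by (rule sum.swap)
  also have "\<dots> = (\<Sum>\<rho>\<in>S. mpow S A j \<sigma> \<rho> * mpow S A (Suc k) \<rho> \<tau>)"
    by (simp add: sum_distrib_left mult.assoc)
  finally show ?case .
qed (use S in simp)

lemma mpow_sym:
  assumes S: "finite S" and A: "\<And>\<sigma> \<tau>. A \<sigma> \<tau> = A \<tau> \<sigma>" and "\<sigma> \<in> S" "\<tau> \<in> S"
  shows "mpow S A k \<sigma> \<tau> = mpow S A k \<tau> \<sigma>"
  using assms(3,4)
proof (induction k arbitrary: \<sigma> \<tau>)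
  case (Suc k)
  have one: "mpow S A 1 \<rho> \<pi> = A \<rho> \<pi>" if "\<rho> \<in> S" for \<rho> \<pi>
    using S that by simp
  have "mpow S A (Suc k) \<sigma> \<tau> = (\<Sum>\<rho>\<in>S. mpow S A 1 \<tau> \<rho> * mpow S A k \<rho> \<sigma>)"
    using Suc one A by (simp add: mult.commute)
  also have "\<dots> = mpow S A (1 + k) \<tau> \<sigma>" using mpow_add[OF S Suc.prems(1), of A 1 k \<tau>] by (simp del: mpow.simps)
  finally show ?case by simp
qed auto

lemma mpow_bound:
  assumes S: "finite S" and A: "\<And>\<sigma> \<tau>. \<sigma> \<in> S \<Longrightarrow> \<tau> \<in> S \<Longrightarrow> \<bar>A \<sigma> \<tau>\<bar> \<le> B"
    and "\<sigma> \<in> S" "\<tau> \<in> S"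
  shows "\<bar>mpow S A k \<sigma> \<tau>\<bar> \<le> (real (card S) * B) ^ k"
  using assms(4)
proof (induction k arbitrary: \<tau>)
  case (Suc k)
  have B: "0 \<le> B" using A[OF assms(3,3)] by linarith
  have "\<bar>mpow S A (Suc k) \<sigma> \<tau>\<bar> \<le> (\<Sum>\<rho>\<in>S. \<bar>mpow S A k \<sigma> \<rho> * A \<rho> \<tau>\<bar>)"
    by simp
  also have "\<dots> \<le> (\<Sum>\<rho>\<in>S. (real (card S) * B) ^ k * B)"
    unfolding abs_mult using Suc A B by (intro sum_mono mult_mono) auto
  also have "\<dots> = (real (card S) * B) ^ Suc k" by (simp add: algebra_simps)
  finally show ?case .
qed auto

definition exp_series :: "(nat \<Rightarrow> real) \<Rightarrow> real \<Rightarrow> real" where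
  "exp_series a s = (\<Sum>k. a k / fact k * s ^ k)"

text \<open>Growth that makes the exponential generating function entire.\<close>

definition geom_bounded :: "(nat \<Rightarrow> real) \<Rightarrow> bool" where
  "geom_bounded a \<longleftrightarrow> (\<exists>C B. \<forall>k. \<bar>a k\<bar> \<le> C * B ^ k)"

lemma geom_bounded_shift:
  assumes "geom_bounded a" shows "geom_bounded (\<lambda>k. a (Suc k))"
proof -
  obtain C B where "\<And>k. \<bar>a k\<bar> \<le> C * B ^ k" using assms by (auto simp: geom_bounded_def)
  then have "\<bar>a (Suc k)\<bar> \<le> C * B * B ^ k" for k by (metis mult.assoc power_Suc)
  then show ?thesis unfolding geom_bounded_def by blast
qed

lemma abs_summable_exp_series:
  assumes "geom_bounded a"
  shows "summable (\<lambda>k. \<bar>a k / fact k * s ^ k\<bar>)"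
proof -
  obtain C B where ab: "\<And>k. \<bar>a k\<bar> \<le> C * B ^ k" using assms by (auto simp: geom_bounded_def)
  have "summable (\<lambda>k. C * ((B * \<bar>s\<bar>) ^ k /\<^sub>R fact k))"
    by (intro summable_mult summable_exp_generic)
  then show ?thesis
  proof (rule summable_comparison_test'[where N = 0])
    fix k
    have "\<bar>a k\<bar> * \<bar>s\<bar> ^ k / fact k \<le> C * B ^ k * \<bar>s\<bar> ^ k / fact k"
      using ab by (intro divide_right_mono mult_right_mono) auto
    then show "norm \<bar>a k / fact k * s ^ k\<bar> \<le> C * ((B * \<bar>s\<bar>) ^ k /\<^sub>R fact k)"
      by (simp add: abs_mult power_abs power_mult_distrib divide_inverse mult_ac)
  qed
qed

lemma summable_exp_series:
  "geom_bounded a \<Longrightarrow> summable (\<lambda>k. a k / fact k * s ^ k)"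
  using abs_summable_exp_series[of a s] by (rule summable_rabs_cancel)

lemma DERIV_exp_series:
  assumes "geom_bounded a"
  shows "(exp_series a has_real_derivative exp_series (\<lambda>k. a (Suc k)) s) (at s)"
proof -
  have "((\<lambda>x. \<Sum>k. a k / fact k * x ^ k) has_real_derivative (\<Sum>k. diffs (\<lambda>k. a k / fact k) k * s ^ k)) (at s)"
    by (rule termdiffs_strong_converges_everywhere) (rule summable_exp_series[OF assms])
  moreover have "diffs (\<lambda>k. a k / fact k) = (\<lambda>k. a (Suc k) / fact k)"
    by (simp add: diffs_def fun_eq_iff del: of_nat_Suc)
  ultimately show ?thesis by (simp add: exp_series_def[abs_def])
qed

lemma exp_series_mult:
  assumes "geom_bounded a" "geom_bounded b"
  shows "exp_series a s * exp_series b s =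
    exp_series (\<lambda>n. \<Sum>i\<le>n. real (n choose i) * (a i * b (n - i))) s"
proof -
  have "exp_series a s * exp_series b s =
      (\<Sum>k. \<Sum>i\<le>k. (a i / fact i * s ^ i) * (b (k - i) / fact (k - i) * s ^ (k - i)))"
    unfolding exp_series_def
    by (rule Cauchy_product) (use abs_summable_exp_series assms in auto)
  also have "\<dots> = exp_series (\<lambda>n. \<Sum>i\<le>n. real (n choose i) * (a i * b (n - i))) s"
    unfolding exp_series_def
  proof (intro suminf_cong)
    fix k
    have "(a i / fact i * s ^ i) * (b (k - i) / fact (k - i) * s ^ (k - i)) =
        real (k choose i) * (a i * b (k - i)) / fact k * s ^ k" if "i \<le> k" for i
    proof -
      have "s ^ i * s ^ (k - i) = s ^ k" using that by (simp flip: power_add)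
      moreover have "real (k choose i) = fact k / (fact i * fact (k - i))"
        using that by (rule binomial_fact)
      ultimately show ?thesis by (simp add: field_simps)
    qed
    then show "(\<Sum>i\<le>k. (a i / fact i * s ^ i) * (b (k - i) / fact (k - i) * s ^ (k - i))) =
        (\<Sum>i\<le>k. real (k choose i) * (a i * b (k - i))) / fact k * s ^ k"
      by (simp add: sum_divide_distrib sum_distrib_right)
  qed
  finally show ?thesis .
qed

lemma exp_series_sum:
  assumes "finite I" "\<And>i. i \<in> I \<Longrightarrow> geom_bounded (a i)"
  shows "(\<Sum>i\<in>I. exp_series (a i) s) = exp_series (\<lambda>k. \<Sum>i\<in>I. a i k) s"
  unfolding exp_series_def
  by (subst suminf_sum[symmetric]) (use assms summable_exp_series in \<open>auto simp: sum_divide_distrib sum_distrib_right\<close>)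

lemma geom_bounded_mpow:
  assumes S: "finite S" "\<sigma> \<in> S" "\<tau> \<in> S"
  shows "geom_bounded (\<lambda>k. mpow S A k \<sigma> \<tau>)"
proof -
  have "\<bar>A \<rho> \<pi>\<bar> \<le> (\<Sum>p\<in>S \<times> S. \<bar>A (fst p) (snd p)\<bar>)" if "\<rho> \<in> S" "\<pi> \<in> S" for \<rho> \<pi>
    using that S by (intro member_le_sum[of "(\<rho>, \<pi>)" "S \<times> S" "\<lambda>p. \<bar>A (fst p) (snd p)\<bar>", simplified]) auto
  then show ?thesis
    unfolding geom_bounded_def using mpow_bound[OF S(1) _ S(2,3)] by (metis mult_1)
qed

lemma geom_bounded_binomial:
  assumes "geom_bounded a" "geom_bounded b"
  shows "geom_bounded (\<lambda>n. \<Sum>i\<le>n. real (n choose i) * (a i * b (n - i)))"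
proof -
  obtain C B where a: "\<And>k. \<bar>a k\<bar> \<le> C * B ^ k" using assms by (auto simp: geom_bounded_def)
  obtain D E where b: "\<And>k. \<bar>b k\<bar> \<le> D * E ^ k" using assms by (auto simp: geom_bounded_def)
  have "\<bar>\<Sum>i\<le>n. real (n choose i) * (a i * b (n - i))\<bar> \<le> C * D * (B + E) ^ n" for n
  proof -
    have "\<bar>\<Sum>i\<le>n. real (n choose i) * (a i * b (n - i))\<bar> \<le>
        (\<Sum>i\<le>n. real (n choose i) * ((C * B ^ i) * (D * E ^ (n - i))))"
      by (rule order_trans[OF sum_abs]) (auto simp: abs_mult intro!: sum_mono mult_left_mono mult_mono a b order_trans[OF abs_ge_zero a])
    also have "\<dots> = C * D * (B + E) ^ n"
      unfolding binomial_ring by (simp add: sum_distrib_left mult_ac)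
    finally show ?thesis .
  qed
  then show ?thesis unfolding geom_bounded_def by blast
qed

text \<open>With \<open>M i\<close> the matrix \<open>A^i exp (s A / 2)\<close>, the Hilbert-Schmidt product of \<open>M i\<close> and \<open>M j\<close>
  is the trace of \<open>A^(i + j) exp (s A)\<close>, because \<open>A\<close> is symmetric. Expanding both exponentials, the
  binomial coefficients that arise from the Cauchy product sum to \<open>2^n\<close>.\<close>

lemma exp_inner:
  assumes S: "finite S" and A: "\<And>\<sigma> \<tau>. A \<sigma> \<tau> = A \<tau> \<sigma>"
  defines "M \<equiv> \<lambda>i s \<sigma> \<tau>. exp_series (\<lambda>k. mpow S A (k + i) \<sigma> \<tau>) s"
  shows "(\<Sum>\<sigma>\<in>S. \<Sum>\<tau>\<in>S. M i (s / 2) \<sigma> \<tau> * M j (s / 2) \<sigma> \<tau>) = exp_series (\<lambda>k. mtrace S A (k + i + j)) s"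
proof -
  have gb: "geom_bounded (\<lambda>k. mpow S A (k + i) \<sigma> \<tau>)" if "\<sigma> \<in> S" "\<tau> \<in> S" for i \<sigma> \<tau>
    using geom_bounded_mpow[OF S that, of A]
    by (induction i) (auto dest: geom_bounded_shift simp del: mpow.simps)
  let ?g = "\<lambda>\<sigma> \<tau> n. \<Sum>l\<le>n. real (n choose l) * (mpow S A (l + i) \<sigma> \<tau> * mpow S A (n - l + j) \<sigma> \<tau>)"
  have g: "geom_bounded (?g \<sigma> \<tau>)" if "\<sigma> \<in> S" "\<tau> \<in> S" for \<sigma> \<tau>
    by (rule geom_bounded_binomial[OF gb[OF that] gb[OF that]])
  have "(\<Sum>\<sigma>\<in>S. \<Sum>\<tau>\<in>S. M i (s / 2) \<sigma> \<tau> * M j (s / 2) \<sigma> \<tau>) = (\<Sum>p\<in>S \<times> S. exp_series (?g (fst p) (snd p)) (s / 2))"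
    unfolding sum.cartesian_product M_def
    by (intro sum.cong refl) (auto simp: exp_series_mult gb simp del: mpow.simps)
  also have "\<dots> = exp_series (\<lambda>n. \<Sum>p\<in>S \<times> S. ?g (fst p) (snd p) n) (s / 2)"
    using S g by (intro exp_series_sum) auto
  also have "\<dots> = exp_series (\<lambda>k. mtrace S A (k + i + j)) s"
    unfolding exp_series_def
  proof (intro suminf_cong)
    fix n
    have "(\<Sum>p\<in>S \<times> S. ?g (fst p) (snd p) n) =
        (\<Sum>l\<le>n. real (n choose l) * (\<Sum>p\<in>S \<times> S. mpow S A (l + i) (fst p) (snd p) * mpow S A (n - l + j) (fst p) (snd p)))"
      unfolding sum_distrib_left by (rule sum.swap)
    also have "\<dots> = (\<Sum>l\<le>n. real (n choose l) * mtrace S A (n + i + j))"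
    proof (intro sum.cong refl arg_cong2[where f = "(*)"])
      fix l assume l: "l \<in> {..n}"
      have "(\<Sum>p\<in>S \<times> S. mpow S A (l + i) (fst p) (snd p) * mpow S A (n - l + j) (fst p) (snd p)) =
          (\<Sum>\<sigma>\<in>S. \<Sum>\<tau>\<in>S. mpow S A (l + i) \<sigma> \<tau> * mpow S A (n - l + j) \<tau> \<sigma>)"
        unfolding sum.cartesian_product using mpow_sym[OF S A]
        by (intro sum.cong refl) (auto simp del: mpow.simps)
      also have "\<dots> = (\<Sum>\<sigma>\<in>S. mpow S A ((l + i) + (n - l + j)) \<sigma> \<sigma>)"
        using S by (intro sum.cong refl mpow_add[symmetric])
      also have "(l + i) + (n - l + j) = n + i + j" using l by simp
      finally show "(\<Sum>p\<in>S \<times> S. mpow S A (l + i) (fst p) (snd p) * mpow S A (n - l + j) (fst p) (snd p)) =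
          mtrace S A (n + i + j)" by (simp add: mtrace_def)
    qed
    also have "\<dots> = 2 ^ n * mtrace S A (n + i + j)"
      by (simp add: sum_distrib_right[symmetric] choose_row_sum flip: of_nat_sum)
    finally show "(\<Sum>p\<in>S \<times> S. ?g (fst p) (snd p) n) / fact n * (s / 2) ^ n = mtrace S A (n + i + j) / fact n * s ^ n"
      by (simp add: power_divide)
  qed
  finally show ?thesis .
qed

lemma geom_bounded_mtrace:
  assumes S: "finite S" shows "geom_bounded (mtrace S A)"
proof -
  let ?B = "real (card S) * (\<Sum>p\<in>S \<times> S. \<bar>A (fst p) (snd p)\<bar>)"
  have A: "\<bar>A \<rho> \<pi>\<bar> \<le> (\<Sum>p\<in>S \<times> S. \<bar>A (fst p) (snd p)\<bar>)" if "\<rho> \<in> S" "\<pi> \<in> S" for \<rho> \<pi>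
    using that S by (intro member_le_sum[of "(\<rho>, \<pi>)" "S \<times> S" "\<lambda>p. \<bar>A (fst p) (snd p)\<bar>", simplified]) auto
  have "\<bar>mtrace S A k\<bar> \<le> real (card S) * ?B ^ k" for k
  proof -
    have "\<bar>mtrace S A k\<bar> \<le> (\<Sum>\<sigma>\<in>S. ?B ^ k)"
      unfolding mtrace_def using mpow_bound[OF S A]
      by (intro order_trans[OF sum_abs] sum_mono) auto
    then show ?thesis by simp
  qed
  then show ?thesis unfolding geom_bounded_def by blast
qed

text \<open>Here \<open>f(s)\<close> is the trace of \<open>exp (s A)\<close>. The Cauchy-Schwarz inequality for \<open>M 0\<close> and \<open>M 1\<close> of
  \<open>exp_inner\<close> reads \<open>f'^2 \<le> f f''\<close>, so \<open>ln f\<close> is convex and lies above its tangent line at \<open>t\<close>;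
  the bound compares the two at \<open>0\<close>.\<close>

lemma trace_tangent_bound:
  assumes S: "finite S" "S \<noteq> {}" and sym: "\<And>\<sigma> \<tau>. A \<sigma> \<tau> = A \<tau> \<sigma>"
    and pos: "\<And>\<sigma> \<tau>. 0 \<le> A \<sigma> \<tau>" and t: "0 < t"
  defines "f \<equiv> exp_series (mtrace S A)" and "f' \<equiv> exp_series (\<lambda>k. mtrace S A (Suc k))"
  shows "ln (f t) - ln (real (card S)) \<le> t * (f' t / f t)"
proof -
  define f'' where "f'' = exp_series (\<lambda>k. mtrace S A (Suc (Suc k)))"
  note gb = geom_bounded_mtrace[OF S(1), of A]
  have d: "(f has_real_derivative f' s) (at s)" "(f' has_real_derivative f'' s) (at s)" for s
    unfolding f_def f'_def f''_def
    by (rule DERIV_exp_series gb geom_bounded_shift)+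
  have "0 \<le> mpow S A k \<sigma> \<tau>" for k \<sigma> \<tau>
    using pos by (induction k arbitrary: \<tau>) (auto intro!: sum_nonneg)
  then have nonneg: "0 \<le> mtrace S A k" for k unfolding mtrace_def by (intro sum_nonneg)
  have f0: "f 0 = real (card S)"
    unfolding f_def exp_series_def
    by (subst suminf_finite[of "{0}"]) (auto simp: mtrace_def)
  have fpos: "0 < f s" if "0 \<le> s" for s
  proof -
    have "(\<Sum>k\<in>{0}. mtrace S A k / fact k * s ^ k) \<le> f s"
      unfolding f_def exp_series_def using nonneg that
      by (intro sum_le_suminf summable_exp_series gb) auto
    moreover have "0 < real (card S)" using S by (simp add: card_gt_0_iff)
    ultimately show ?thesis by (simp add: mtrace_def)
  qed
  have cs: "(f' s)\<^sup>2 \<le> f s * f'' s" for s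
  proof -
    let ?M = "\<lambda>i p. exp_series (\<lambda>k. mpow S A (k + i) (fst p) (snd p)) (s / 2)"
    have e: "(\<Sum>p\<in>S \<times> S. ?M i p * ?M j p) = exp_series (\<lambda>k. mtrace S A (k + i + j)) s" for i j
      using exp_inner[OF S(1) sym, where i = i and s = s and j = j] by (simp add: sum.cartesian_product case_prod_beta)
    have "(\<Sum>p\<in>S \<times> S. ?M 0 p * ?M 1 p)\<^sup>2 \<le> (\<Sum>p\<in>S \<times> S. (?M 0 p)\<^sup>2) * (\<Sum>p\<in>S \<times> S. (?M 1 p)\<^sup>2)"
      by (rule Cauchy_Schwarz_ineq_sum)
    then show ?thesis
      using e[of 0 0] e[of 0 1] e[of 1 1] by (simp add: power2_eq_square f_def f'_def f''_def del: mpow.simps)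
  qed
  \<comment> \<open>The value at \<open>0\<close> of the tangent line to \<open>ln f\<close> at \<open>s\<close> decreases in \<open>s\<close>.\<close>
  define h where "h = (\<lambda>s. ln (f s) - s * (f' s / f s))"
  have "h t \<le> h 0"
  proof (rule DERIV_nonpos_imp_nonincreasing[where f = h and a = 0 and b = t])
    fix s assume s: "0 \<le> s" "s \<le> t"
    have "f s \<noteq> 0" using fpos[OF s(1)] by simp
    then have "(h has_real_derivative (- s * ((f s * f'' s - (f' s)\<^sup>2) / (f s)\<^sup>2))) (at s)"
      unfolding h_def using fpos[OF s(1)]
      by (auto intro!: derivative_eq_intros d simp: field_simps power2_eq_square)
    moreover have "- s * ((f s * f'' s - (f' s)\<^sup>2) / (f s)\<^sup>2) \<le> 0"
      using s cs[of s] by (simp add: mult_nonneg_nonneg divide_nonneg_nonneg)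
    ultimately show "\<exists>y. (h has_real_derivative y) (at s) \<and> y \<le> 0" by blast
  qed (use t in simp)
  then show ?thesis by (simp add: h_def f0)
qed

section \<open>The energy inequality for words\<close>

definition mark_weight :: "real \<Rightarrow> mark \<Rightarrow> real" where
  "mark_weight u m = (case m of Cross \<Rightarrow> u | Bar \<Rightarrow> 1 - u)"

definition word_weight :: "real \<Rightarrow> 'v letter list \<Rightarrow> real" where
  "word_weight u w = (\<Prod>l\<leftarrow>w. mark_weight u (snd l))"

definition words :: "'v set set \<Rightarrow> nat \<Rightarrow> 'v letter list set" where
  "words E k = {w. set w \<subseteq> E \<times> UNIV \<and> length w = k}"

lemma UNIV_mark: "UNIV = {Cross, Bar}"
  using mark.exhaust by blast

lemma finite_words: "finite E \<Longrightarrow> finite (words E k)"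
  unfolding words_def by (rule finite_lists_length_eq) (simp add: UNIV_mark)

lemma sum_letters:
  fixes f :: "'v letter \<Rightarrow> 'b :: comm_monoid_add"
  shows "(\<Sum>l\<in>E \<times> UNIV. f l) = (\<Sum>e\<in>E. f (e, Cross) + f (e, Bar))"
  by (simp add: sum.cartesian_product' UNIV_mark)

lemma sum_words_Suc:
  fixes f :: "'v letter list \<Rightarrow> 'b :: comm_monoid_add"
  shows "(\<Sum>w\<in>words E (Suc k). f w) = (\<Sum>w\<in>words E k. \<Sum>l\<in>E \<times> UNIV. f (w @ [l]))"
proof -
  have "words E (Suc k) = (\<lambda>p. fst p @ [snd p]) ` (words E k \<times> (E \<times> UNIV))"
  proof (intro equalityI subsetI)
    fix w assume w: "w \<in> words E (Suc k)"
    then have "w \<noteq> []" by (auto simp: words_def)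
    then have "w = butlast w @ [last w]" by simp
    moreover from w have "butlast w \<in> words E k" "last w \<in> E \<times> UNIV"
      by (auto simp: words_def dest: in_set_butlastD) (metis SigmaD1 last_in_set length_0_conv nat.distinct(1) prod.collapse subsetD)
    ultimately show "w \<in> (\<lambda>p. fst p @ [snd p]) ` (words E k \<times> (E \<times> UNIV))" by force
  qed (auto simp: words_def)
  moreover have "inj_on (\<lambda>p. fst p @ [snd p]) (words E k \<times> (E \<times> UNIV))"
    by (auto simp: inj_on_def prod_eq_iff)
  ultimately show ?thesis
    by (simp add: sum.reindex sum.cartesian_product case_prod_beta o_def)
qed

lemma word_weight_snoc: "word_weight u (w @ [l]) = word_weight u w * mark_weight u (snd l)"
  by (simp add: word_weight_def)

lemma word_weight_nonneg: "0 \<le> u \<Longrightarrow> u \<le> 1 \<Longrightarrow> 0 \<le> word_weight u w"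
  by (induction w) (auto simp: word_weight_def mark_weight_def split: mark.split)

lemma sum_word_weight: "(\<Sum>w\<in>words E k. word_weight u w) = real (card E) ^ k"
proof (induction k)
  case 0
  have "words E 0 = {[]}" by (auto simp: words_def)
  then show ?case by (simp add: word_weight_def)
next
  case (Suc k)
  have "(\<Sum>l\<in>E \<times> UNIV. mark_weight u (snd l)) = real (card E)"
    unfolding sum_letters by (simp add: mark_weight_def)
  then show ?case
    by (simp add: sum_words_Suc word_weight_snoc sum_distrib_left[symmetric] sum_distrib_right[symmetric] Suc)
qed

text \<open>The operator whose powers generate all words: the sum of the operators of all letters, weighted by
  the probabilities of the types of marks.\<close>

definition transfer :: "'v set \<Rightarrow> 'v set set \<Rightarrow> real \<Rightarrow> ('v \<Rightarrow> nat) \<Rightarrow> ('v \<Rightarrow> nat) \<Rightarrow> real" where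
  "transfer V E u \<sigma> \<tau> = (\<Sum>l\<in>E \<times> UNIV. mark_weight u (snd l) * of_bool (fits V l \<sigma> \<tau>))"

locale loop_graph =
  fixes V :: "'v set" and E :: "'v set set" and q :: nat and u :: real
  assumes graph: "simple_graph V E" and q: "2 \<le> q" and u: "0 \<le> u" "u \<le> 1"
begin

abbreviation colourings :: "('v \<Rightarrow> nat) set" where "colourings \<equiv> V \<rightarrow>\<^sub>E {..<q}"

abbreviation tr :: "nat \<Rightarrow> real" where "tr \<equiv> mtrace colourings (transfer V E u)"

lemma finite_V: "finite V" and finite_E: "finite E"
  and edge: "e \<in> E \<Longrightarrow> e \<subseteq> V \<and> card e = 2"
proof -
  show "finite V" "e \<in> E \<Longrightarrow> e \<subseteq> V \<and> card e = 2" for e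
    using graph by (auto simp: simple_graph_def)
  then show "finite E" by (meson PowI finite_Pow_iff finite_subset subsetI)
qed

lemma words_edge_letters: "w \<in> words E k \<Longrightarrow> set w \<subseteq> edge_letters V"
  using edge by (fastforce simp: words_def edge_letters_def)

lemma words_subset: "w \<in> words E k \<Longrightarrow> \<forall>l\<in>set w. fst l \<subseteq> V"
  using words_edge_letters by (fastforce simp: edge_letters_def)

lemma letter_subset: "l \<in> E \<times> UNIV \<Longrightarrow> fst l \<subseteq> V"
  using edge[of "fst l"] by (auto simp: mem_Times_iff)

lemma finite_colourings: "finite colourings"
  using finite_V by (auto intro!: finite_PiE)

lemma mpow_words:
  assumes "\<sigma> \<in> colourings" "\<tau> \<in> colourings"
  shows "mpow colourings (transfer V E u) k \<sigma> \<tau> = (\<Sum>w\<in>words E k. word_weight u w * real (kern V q w \<sigma> \<tau>))"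
  using assms(2)
proof (induction k arbitrary: \<tau>)
  case 0
  have "words E 0 = {[]}" by (auto simp: words_def)
  then show ?case using assms(1) 0 by (simp add: kern_Nil word_weight_def)
next
  case (Suc k)
  have "(\<Sum>w\<in>words E (Suc k). word_weight u w * real (kern V q w \<sigma> \<tau>)) =
    (\<Sum>w\<in>words E k. \<Sum>l\<in>E \<times> UNIV. \<Sum>\<rho>\<in>colourings. word_weight u w * mark_weight u (snd l) *
       (real (kern V q w \<sigma> \<rho>) * of_bool (fits V l \<rho> \<tau>)))"
    unfolding sum_words_Suc
  proof (intro sum.cong refl)
    fix w l assume w: "w \<in> words E k" and l: "l \<in> E \<times> (UNIV :: mark set)"
    have "fst l \<subseteq> V" using letter_subset[OF l] .
    from kern_snoc[OF finite_V words_subset[OF w] this Suc.prems, of \<sigma>]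
    show "word_weight u (w @ [l]) * real (kern V q (w @ [l]) \<sigma> \<tau>) = (\<Sum>\<rho>\<in>colourings.
        word_weight u w * mark_weight u (snd l) * (real (kern V q w \<sigma> \<rho>) * of_bool (fits V l \<rho> \<tau>)))"
      by (simp add: word_weight_snoc sum_distrib_left)
  qed
  also have "\<dots> = (\<Sum>w\<in>words E k. \<Sum>\<rho>\<in>colourings. \<Sum>l\<in>E \<times> UNIV. word_weight u w * mark_weight u (snd l) *
       (real (kern V q w \<sigma> \<rho>) * of_bool (fits V l \<rho> \<tau>)))"
    by (intro sum.cong refl sum.swap)
  also have "\<dots> = (\<Sum>\<rho>\<in>colourings. \<Sum>w\<in>words E k. \<Sum>l\<in>E \<times> UNIV. word_weight u w * mark_weight u (snd l) *
       (real (kern V q w \<sigma> \<rho>) * of_bool (fits V l \<rho> \<tau>)))"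
    by (rule sum.swap)
  also have "\<dots> = (\<Sum>\<rho>\<in>colourings. mpow colourings (transfer V E u) k \<sigma> \<rho> * transfer V E u \<rho> \<tau>)"
    by (intro sum.cong refl) (simp add: Suc.IH transfer_def sum_product mult_ac)
  finally show ?case by simp
qed

lemma trace_closing:
  assumes w: "w \<in> words E k" and l: "fst l \<subseteq> V"
  shows "(\<Sum>\<sigma>\<in>colourings. \<Sum>\<tau>\<in>colourings. real (kern V q w \<sigma> \<tau>) * of_bool (fits V l \<tau> \<sigma>)) =
    real q ^ card (classes (sites V w) (closing V w l))"
  using arg_cong[OF sum_kern_closing[OF finite_V words_subset[OF w] l, of q], of real] by simp

text \<open>The partition function restricted to words of length \<open>k\<close> is the trace of a matrix power; this
  is where the weight per loop has to be an integer.\<close>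

lemma trace_words:
  "tr k = (\<Sum>w\<in>words E k. word_weight u w * real q ^ word_loops V w)"
proof -
  have "tr k = (\<Sum>\<sigma>\<in>colourings. \<Sum>w\<in>words E k. word_weight u w * real (kern V q w \<sigma> \<sigma>))"
    unfolding mtrace_def by (intro sum.cong refl mpow_words)
  also have "\<dots> = (\<Sum>w\<in>words E k. word_weight u w * (\<Sum>\<sigma>\<in>colourings. real (kern V q w \<sigma> \<sigma>)))"
    unfolding sum_distrib_left by (rule sum.swap)
  also have "\<dots> = (\<Sum>w\<in>words E k. word_weight u w * real q ^ word_loops V w)"
  proof (intro sum.cong refl arg_cong2[where f = "(*)"])
    fix w assume w: "w \<in> words E k"
    have fits: "fits V no_mark \<tau> \<sigma> \<longleftrightarrow> \<tau> = \<sigma>" if "\<sigma> \<in> colourings" "\<tau> \<in> colourings" for \<sigma> \<tau>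
      using PiE_ext[OF that(2,1)] by (auto simp: fits_def)
    have "(\<Sum>\<sigma>\<in>colourings. real (kern V q w \<sigma> \<sigma>)) =
        (\<Sum>\<sigma>\<in>colourings. \<Sum>\<tau>\<in>colourings. real (kern V q w \<sigma> \<tau>) * of_bool (fits V no_mark \<tau> \<sigma>))"
    proof (intro sum.cong refl)
      fix \<sigma> assume \<sigma>: "\<sigma> \<in> colourings"
      have "(\<Sum>\<tau>\<in>colourings. real (kern V q w \<sigma> \<tau>) * of_bool (fits V no_mark \<tau> \<sigma>)) =
          (\<Sum>\<tau>\<in>{\<sigma>}. real (kern V q w \<sigma> \<tau>))"
        using \<sigma> finite_colourings fits by (intro sum.mono_neutral_cong_right) auto
      then show "real (kern V q w \<sigma> \<sigma>) = (\<Sum>\<tau>\<in>colourings. real (kern V q w \<sigma> \<tau>) * of_bool (fits V no_mark \<tau> \<sigma>))"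
        by simp
    qed
    also have "\<dots> = real q ^ word_loops V w"
      unfolding word_loops_def by (rule trace_closing[OF w]) simp
    finally show "(\<Sum>\<sigma>\<in>colourings. real (kern V q w \<sigma> \<sigma>)) = real q ^ word_loops V w" .
  qed
  finally show ?thesis .
qed

text \<open>Singling out the last letter of a word of length \<open>k + 1\<close> as the letter that closes the
  first \<open>k\<close>.\<close>

lemma trace_Suc:
  "tr (Suc k) = (\<Sum>w\<in>words E k. word_weight u w *
    (\<Sum>l\<in>E \<times> UNIV. mark_weight u (snd l) * real q ^ card (classes (sites V w) (closing V w l))))"
proof -
  have "tr (Suc k) = (\<Sum>\<sigma>\<in>colourings. \<Sum>\<tau>\<in>colourings.
      (\<Sum>w\<in>words E k. word_weight u w * real (kern V q w \<sigma> \<tau>)) * transfer V E u \<tau> \<sigma>)"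
    unfolding mtrace_def mpow.simps by (intro sum.cong refl) (simp add: mpow_words)
  also have "\<dots> = (\<Sum>\<sigma>\<in>colourings. \<Sum>\<tau>\<in>colourings. \<Sum>w\<in>words E k. \<Sum>l\<in>E \<times> UNIV.
      word_weight u w * (mark_weight u (snd l) * (real (kern V q w \<sigma> \<tau>) * of_bool (fits V l \<tau> \<sigma>))))"
    unfolding transfer_def sum_product by (simp add: mult_ac)
  also have "\<dots> = (\<Sum>w\<in>words E k. \<Sum>l\<in>E \<times> UNIV. \<Sum>\<sigma>\<in>colourings. \<Sum>\<tau>\<in>colourings.
      word_weight u w * (mark_weight u (snd l) * (real (kern V q w \<sigma> \<tau>) * of_bool (fits V l \<tau> \<sigma>))))"
    (is "(\<Sum>\<sigma>\<in>_. \<Sum>\<tau>\<in>_. \<Sum>w\<in>_. \<Sum>l\<in>_. ?F \<sigma> \<tau> w l) = _")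
  proof -
    have "(\<Sum>\<sigma>\<in>colourings. \<Sum>\<tau>\<in>colourings. \<Sum>w\<in>words E k. \<Sum>l\<in>E \<times> UNIV. ?F \<sigma> \<tau> w l) =
       (\<Sum>p\<in>colourings \<times> colourings. \<Sum>r\<in>words E k \<times> (E \<times> UNIV). ?F (fst p) (snd p) (fst r) (snd r))"
      by (simp add: sum.cartesian_product')
    also have "\<dots> = (\<Sum>r\<in>words E k \<times> (E \<times> UNIV). \<Sum>p\<in>colourings \<times> colourings. ?F (fst p) (snd p) (fst r) (snd r))"
      by (rule sum.swap)
    also have "\<dots> = (\<Sum>w\<in>words E k. \<Sum>l\<in>E \<times> UNIV. \<Sum>\<sigma>\<in>colourings. \<Sum>\<tau>\<in>colourings. ?F \<sigma> \<tau> w l)"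
      by (simp add: sum.cartesian_product')
    finally show ?thesis .
  qed
  also have "\<dots> = (\<Sum>w\<in>words E k. word_weight u w *
    (\<Sum>l\<in>E \<times> UNIV. mark_weight u (snd l) * real q ^ card (classes (sites V w) (closing V w l))))"
    unfolding sum_distrib_left
  proof (intro sum.cong refl)
    fix w l assume w: "w \<in> words E k" and l: "l \<in> E \<times> (UNIV :: mark set)"
    have "fst l \<subseteq> V" using letter_subset[OF l] .
    from trace_closing[OF w this]
    show "(\<Sum>\<sigma>\<in>colourings. \<Sum>\<tau>\<in>colourings. ?F \<sigma> \<tau> w l) =
       word_weight u w * (mark_weight u (snd l) * real q ^ card (classes (sites V w) (closing V w l)))"
      by (simp add: sum_distrib_left[symmetric])
  qed
  finally show ?thesis .
qed

text \<open>The vertices on the loop that passes through \<open>x\<close> at time \<open>0\<close>.\<close>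

definition cluster :: "'v letter list \<Rightarrow> 'v \<Rightarrow> 'v set" where
  "cluster w x = {y\<in>V. ((0, x), (0, y)) \<in> glued (closing V w no_mark)}"

definition long_word :: "real \<Rightarrow> 'v letter list \<Rightarrow> bool" where
  "long_word L w \<longleftrightarrow> (\<exists>x\<in>V. L < real (card (cluster w x)))"

definition inner_edges :: "'v letter list \<Rightarrow> 'v set set" where
  "inner_edges w = {e\<in>E. \<exists>x\<in>V. e \<subseteq> cluster w x}"

text \<open>The difference between the largest factor for a mark within a loop and the factor \<open>1 / q\<close> for a
  mark between two loops.\<close>

definition merge_gain :: real where
  "merge_gain = 1 + (real q - 1) * max u (1 - u) - 1 / real q"

lemma merge_gain_nonneg: "0 \<le> merge_gain"
proof -
  have "1 / real q \<le> 1" using q by simp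
  moreover have "0 \<le> (real q - 1) * max u (1 - u)" using q u by (intro mult_nonneg_nonneg) auto
  ultimately show ?thesis by (simp add: merge_gain_def)
qed

lemma added_mark_bound:
  assumes w: "w \<in> words E k"
  shows "(\<Sum>l\<in>E \<times> UNIV. mark_weight u (snd l) * real q ^ card (classes (sites V w) (closing V w l))) \<le>
    real q ^ word_loops V w * (real (card E) / real q + merge_gain * real (card (inner_edges w)))"
proof -
  let ?N = "\<lambda>l. card (classes (sites V w) (closing V w l))"
  have "(\<Sum>l\<in>E \<times> UNIV. mark_weight u (snd l) * real q ^ ?N l) =
      (\<Sum>e\<in>E. u * real q ^ ?N (e, Cross) + (1 - u) * real q ^ ?N (e, Bar))"
    unfolding sum_letters by (simp add: mark_weight_def)
  also have "\<dots> \<le> (\<Sum>e\<in>E. real q ^ word_loops V w * (1 / real q + merge_gain * of_bool (e \<in> inner_edges w)))"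
  proof (rule sum_mono)
    fix e assume e: "e \<in> E"
    then obtain x y where xy: "e = {x, y}" "x \<noteq> y" "x \<in> V" "y \<in> V"
      using edge[OF e] by (auto simp: card_2_iff)
    have inner: "e \<in> inner_edges w \<longleftrightarrow> ((0, x), (0, y)) \<in> glued (closing V w no_mark)"
    proof
      assume "e \<in> inner_edges w"
      then show "((0, x), (0, y)) \<in> glued (closing V w no_mark)"
        using xy by (auto simp: inner_edges_def cluster_def) (blast intro: glued_trans glued_sym)
    next
      assume "((0, x), (0, y)) \<in> glued (closing V w no_mark)"
      then have "e \<subseteq> cluster w x" using xy by (auto simp: cluster_def)
      then show "e \<in> inner_edges w" using e xy by (auto simp: inner_edges_def)
    qed
    have "u * real q ^ ?N (e, Cross) + (1 - u) * real q ^ ?N (e, Bar) \<le> real q ^ ?N no_mark *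
        (if ((0, x), (0, y)) \<in> glued (closing V w no_mark) then 1 + (real q - 1) * max u (1 - u) else 1 / real q)"
      unfolding xy(1) using q u
      by (intro closing_weight finite_V words_edge_letters[OF w] xy) auto
    then show "u * real q ^ ?N (e, Cross) + (1 - u) * real q ^ ?N (e, Bar) \<le>
        real q ^ word_loops V w * (1 / real q + merge_gain * of_bool (e \<in> inner_edges w))"
      unfolding inner word_loops_def merge_gain_def by (simp split: if_splits)
  qed
  also have "\<dots> = real q ^ word_loops V w * (real (card E) / real q + merge_gain * real (card (inner_edges w)))"
  proof -
    have "(\<Sum>e\<in>E. of_bool (e \<in> inner_edges w)) = real (card (inner_edges w))"
    proof -
      have "E \<inter> inner_edges w = inner_edges w" by (auto simp: inner_edges_def)
      then show ?thesis using finite_E by simp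
    qed
    then show ?thesis
      by (simp add: sum_distrib_left[symmetric] sum.distrib)
  qed
  finally show ?thesis .
qed

text \<open>The clusters partition the vertices. When all of them are small, sparsity applies to each of
  them, and the bounds add up.\<close>

lemma card_inner_edges:
  assumes short: "\<not> long_word L w" and eps: "0 \<le> \<epsilon>"
    and sparse: "\<And>S. S \<subseteq> V \<Longrightarrow> real (card S) \<le> L \<Longrightarrow> real (edges_within E S) \<le> (1 + \<epsilon>) * real (card S)"
  shows "real (card (inner_edges w)) \<le> (1 + \<epsilon>) * real (card V)"
proof -
  let ?K = "cluster w ` V"
  have self: "x \<in> cluster w x" if "x \<in> V" for x using that by (simp add: cluster_def)
  have eq: "cluster w x = cluster w y" if "z \<in> cluster w x" "z \<in> cluster w y" for x y z
    using that by (auto simp: cluster_def) (blast intro: glued_trans glued_sym)+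
  have fin: "finite S" "S \<subseteq> V" if "S \<in> ?K" for S
    using that finite_V by (auto simp: cluster_def)
  have "(\<Sum>S\<in>?K. card S) = card (\<Union>?K)"
  proof (rule card_Union_disjoint[symmetric])
    show "disjoint ?K" unfolding pairwise_def disjnt_def using eq by blast
  qed (rule fin)
  also have "\<Union>?K = V" using self fin(2) by blast
  finally have part: "(\<Sum>S\<in>?K. card S) = card V" .
  have "inner_edges w \<subseteq> (\<Union>S\<in>?K. {e\<in>E. e \<subseteq> S})"
    by (auto simp: inner_edges_def)
  then have "card (inner_edges w) \<le> card (\<Union>S\<in>?K. {e\<in>E. e \<subseteq> S})"
    using finite_E finite_V by (intro card_mono) auto
  also have "\<dots> \<le> (\<Sum>S\<in>?K. edges_within E S)"
    unfolding edges_within_def using finite_V by (intro card_UN_le) auto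
  finally have "real (card (inner_edges w)) \<le> (\<Sum>S\<in>?K. real (edges_within E S))"
    by (simp flip: of_nat_sum)
  also have "\<dots> \<le> (\<Sum>S\<in>?K. (1 + \<epsilon>) * real (card S))"
  proof (rule sum_mono)
    fix S assume S: "S \<in> ?K"
    then have "real (card S) \<le> L" using short by (auto simp: long_word_def not_less)
    then show "real (edges_within E S) \<le> (1 + \<epsilon>) * real (card S)" using sparse fin(2)[OF S] by simp
  qed
  also have "\<dots> = (1 + \<epsilon>) * real (card V)"
    by (simp add: sum_distrib_left[symmetric] part flip: of_nat_sum)
  finally show ?thesis .
qed

definition long_trace :: "real \<Rightarrow> nat \<Rightarrow> real" where
  "long_trace L k = (\<Sum>w\<in>words E k. word_weight u w * real q ^ word_loops V w * of_bool (long_word L w))"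

text \<open>On words without a long cluster the number of inner edges is controlled by sparsity; on the other
  words the trivial bound by the number of all edges is used.\<close>

lemma trace_Suc_le:
  assumes eps: "0 \<le> \<epsilon>"
    and sparse: "\<And>S. S \<subseteq> V \<Longrightarrow> real (card S) \<le> L \<Longrightarrow> real (edges_within E S) \<le> (1 + \<epsilon>) * real (card S)"
  shows "tr (Suc k) \<le> (real (card E) / real q + merge_gain * ((1 + \<epsilon>) * real (card V))) * tr k +
    merge_gain * real (card E) * long_trace L k"
proof -
  have "tr (Suc k) \<le> (\<Sum>w\<in>words E k. word_weight u w * (real q ^ word_loops V w *
      (real (card E) / real q + merge_gain * ((1 + \<epsilon>) * real (card V)) + merge_gain * real (card E) * of_bool (long_word L w))))"
    unfolding trace_Suc
  proof (intro sum_mono mult_left_mono word_weight_nonneg u)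
    fix w assume w: "w \<in> words E k"
    have "card (inner_edges w) \<le> card E"
      using finite_E by (intro card_mono) (auto simp: inner_edges_def)
    then have "real (card (inner_edges w)) \<le> (1 + \<epsilon>) * real (card V) + real (card E) * of_bool (long_word L w)"
      using card_inner_edges[OF _ eps sparse, of L w] eps by (cases "long_word L w") (auto intro: add_increasing)
    then have "merge_gain * real (card (inner_edges w)) \<le>
        merge_gain * ((1 + \<epsilon>) * real (card V) + real (card E) * of_bool (long_word L w))"
      by (intro mult_left_mono merge_gain_nonneg)
    then have "real q ^ word_loops V w * (real (card E) / real q + merge_gain * real (card (inner_edges w))) \<le>
       real q ^ word_loops V w * (real (card E) / real q + merge_gain * ((1 + \<epsilon>) * real (card V)) + merge_gain * real (card E) * of_bool (long_word L w))"
      by (intro mult_left_mono) (auto simp: algebra_simps)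
    with added_mark_bound[OF w]
    show "(\<Sum>l\<in>E \<times> UNIV. mark_weight u (snd l) * real q ^ card (classes (sites V w) (closing V w l))) \<le>
      real q ^ word_loops V w * (real (card E) / real q + merge_gain * ((1 + \<epsilon>) * real (card V)) + merge_gain * real (card E) * of_bool (long_word L w))"
      by linarith
  qed
  also have "\<dots> = (real (card E) / real q + merge_gain * ((1 + \<epsilon>) * real (card V))) * tr k +
    merge_gain * real (card E) * long_trace L k"
    unfolding trace_words long_trace_def sum_distrib_left sum.distrib[symmetric]
    by (intro sum.cong refl) (simp add: algebra_simps)
  finally show ?thesis .
qed

lemma long_trace_bounds: "0 \<le> long_trace L k" "long_trace L k \<le> tr k"
  unfolding long_trace_def trace_words
  by (auto intro!: sum_nonneg sum_mono mult_nonneg_nonneg word_weight_nonneg u)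

lemma geom_bounded_tr: "geom_bounded tr"
  by (rule geom_bounded_mtrace[OF finite_colourings])

lemma geom_bounded_long_trace: "geom_bounded (long_trace L)"
proof -
  obtain C B where "\<And>k. \<bar>tr k\<bar> \<le> C * B ^ k" using geom_bounded_tr unfolding geom_bounded_def by blast
  moreover have "\<bar>long_trace L k\<bar> \<le> \<bar>tr k\<bar>" for k using long_trace_bounds[of L k] by simp
  ultimately show ?thesis unfolding geom_bounded_def by (meson order_trans)
qed

text \<open>The loop weight of a word is at least \<open>1\<close>, and without the loop weights the series is an
  exponential.\<close>

lemma exp_le_trace_series:
  assumes "0 \<le> t" shows "exp (t * real (card E)) \<le> exp_series tr t"
proof -
  have "real (card E) ^ k \<le> tr k" for k
  proof -
    have "(\<Sum>w\<in>words E k. word_weight u w) \<le> tr k"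
      unfolding trace_words
    proof (rule sum_mono)
      fix w
      have "word_weight u w * 1 \<le> word_weight u w * real q ^ word_loops V w"
        using q by (intro mult_left_mono word_weight_nonneg u) simp
      then show "word_weight u w \<le> word_weight u w * real q ^ word_loops V w" by simp
    qed
    then show ?thesis by (simp add: sum_word_weight)
  qed
  then have le: "(t * real (card E)) ^ k /\<^sub>R fact k \<le> tr k / fact k * t ^ k" for k
    using assms by (auto simp: power_mult_distrib divide_inverse mult.commute mult.left_commute intro!: mult_left_mono)
  show ?thesis
    unfolding exp_def exp_series_def
    by (intro suminf_le le summable_exp_generic summable_exp_series geom_bounded_tr)
qed

text \<open>The tangent bound from below and \<open>trace_Suc_le\<close> from above, combined. The quotient of the two
  series is the probability of a long cluster under the weighted measure.\<close>

lemma long_fraction_bound: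
  assumes t: "0 < t" and eps: "0 \<le> \<epsilon>"
    and sparse: "\<And>S. S \<subseteq> V \<Longrightarrow> real (card S) \<le> L \<Longrightarrow> real (edges_within E S) \<le> (1 + \<epsilon>) * real (card S)"
  shows "real (card E) * (1 - 1 / real q) - real (card V) * ln (real q) / t - merge_gain * ((1 + \<epsilon>) * real (card V)) \<le>
    merge_gain * real (card E) * (exp_series (long_trace L) t / exp_series tr t)"
proof -
  let ?f = "exp_series tr t" and ?f' = "exp_series (\<lambda>k. tr (Suc k)) t" and ?B = "exp_series (long_trace L) t"
  let ?c = "real (card E) / real q + merge_gain * ((1 + \<epsilon>) * real (card V))"
  let ?d = "merge_gain * real (card E)"
  have f: "exp (t * real (card E)) \<le> ?f" using t by (intro exp_le_trace_series) simp
  then have fpos: "0 < ?f" using exp_gt_zero less_le_trans by blast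
  then have "t * real (card E) \<le> ln ?f" using f by (simp add: ln_ge_iff)
  moreover have "ln ?f - ln (real (card colourings)) \<le> t * (?f' / ?f)"
  proof (rule trace_tangent_bound[OF finite_colourings _ _ _ t])
    show "colourings \<noteq> {}" using q by (auto simp: PiE_eq_empty_iff lessThan_eq_iff simp flip: lessThan_0)
    show "transfer V E u \<sigma> \<tau> = transfer V E u \<tau> \<sigma>" for \<sigma> \<tau>
      unfolding transfer_def by (simp only: fits_sym[of V _ \<sigma> \<tau>])
    show "0 \<le> transfer V E u \<sigma> \<tau>" for \<sigma> \<tau>
      unfolding transfer_def mark_weight_def using u by (auto intro!: sum_nonneg split: mark.split)
  qed
  moreover have "card colourings = q ^ card V" using finite_V by (simp add: card_PiE)
  then have "ln (real (card colourings)) = real (card V) * ln (real q)"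
    using q by (simp add: ln_realpow)
  ultimately have "t * real (card E) - real (card V) * ln (real q) \<le> t * (?f' / ?f)" by simp
  then have 1: "real (card E) - real (card V) * ln (real q) / t \<le> ?f' / ?f"
    using t by (simp add: field_simps)
  have "?f' \<le> ?c * ?f + ?d * ?B"
  proof -
    have "(\<lambda>k. tr k / fact k * t ^ k) sums ?f" "(\<lambda>k. long_trace L k / fact k * t ^ k) sums ?B"
      unfolding exp_series_def
      by (intro summable_sums summable_exp_series geom_bounded_tr geom_bounded_long_trace)+
    then have "(\<lambda>k. ?c * (tr k / fact k * t ^ k) + ?d * (long_trace L k / fact k * t ^ k)) sums (?c * ?f + ?d * ?B)"
      by (intro sums_add sums_mult)
    then have "?c * ?f + ?d * ?B = (\<Sum>k. ?c * (tr k / fact k * t ^ k) + ?d * (long_trace L k / fact k * t ^ k))"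
      by (rule sums_unique)
    moreover have "?f' \<le> \<dots>"
      unfolding exp_series_def
    proof (intro suminf_le summable_add summable_mult summable_exp_series geom_bounded_tr geom_bounded_long_trace geom_bounded_shift)
      fix k
      have "tr (Suc k) * (t ^ k / fact k) \<le> (?c * tr k + ?d * long_trace L k) * (t ^ k / fact k)"
        using t by (intro mult_right_mono trace_Suc_le eps sparse) auto
      then show "tr (Suc k) / fact k * t ^ k \<le> ?c * (tr k / fact k * t ^ k) + ?d * (long_trace L k / fact k * t ^ k)"
        by (simp add: algebra_simps add_divide_distrib)
    qed
    ultimately show ?thesis by simp
  qed
  then have "?f' / ?f \<le> ?c + ?d * (?B / ?f)"
    using fpos by (simp add: divide_le_eq algebra_simps)
  with 1 show ?thesis by (simp add: algebra_simps)
qed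

end

section \<open>The particle on a word as a periodic permutation\<close>

text \<open>The marks of the word at the equally spaced times \<open>1 / (k + 1), \<dots>, k / (k + 1)\<close>. The circle is
  thereby cut into \<open>k + 1\<close> intervals of equal length, one for each level; no mark lies at time
  \<open>0\<close>.\<close>

definition canonical :: "'v letter list \<Rightarrow> 'v config" where
  "canonical w = {(fst (w ! i), real (Suc i) / real (Suc (length w)), snd (w ! i)) | i. i < length w}"

text \<open>The point reached after the fraction \<open>v\<close> of the interval \<open>j\<close> when it is traversed in the direction
  \<open>d\<close>.\<close>

definition pos :: "nat \<Rightarrow> nat \<Rightarrow> real \<Rightarrow> real \<Rightarrow> real" where
  "pos k j d v = frac ((if d = 1 then real j + v else real (Suc j) - v) / real (Suc k))"

definition nbr :: "nat \<Rightarrow> nat \<Rightarrow> real \<Rightarrow> nat" where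
  "nbr k j d = (if d = 1 then (if j < k then Suc j else 0) else (if j = 0 then k else j - 1))"

text \<open>The letter at the end of the interval \<open>j\<close> in the direction \<open>d\<close>; none at time \<open>0\<close>.\<close>

definition exit_letter :: "'v letter list \<Rightarrow> nat \<Rightarrow> real \<Rightarrow> 'v letter" where
  "exit_letter w j d = (if d = 1 then (if j < length w then w ! j else no_mark)
     else (if 0 < j then w ! (j - 1) else no_mark))"

text \<open>A leg is the passage of the particle through one interval at one vertex in one direction, and
  \<open>hop\<close> yields the next leg.\<close>

type_synonym 'v leg = "nat \<times> 'v \<times> real"

definition hop :: "'v letter list \<Rightarrow> 'v leg \<Rightarrow> 'v leg" where
  "hop w = (\<lambda>(j, x, d). let l = exit_letter w j d in
     if x \<notin> fst l then (nbr (length w) j d, x, d)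
     else let y = THE y. fst l = {x, y} \<and> y \<noteq> x in
       case snd l of Cross \<Rightarrow> (nbr (length w) j d, y, d) | Bar \<Rightarrow> (j, y, - d))"

abbreviation legs :: "'v set \<Rightarrow> 'v letter list \<Rightarrow> 'v leg set" where
  "legs V w \<equiv> {..length w} \<times> V \<times> {-1, 1}"

definition reverse_leg :: "'v leg \<Rightarrow> 'v leg" where
  "reverse_leg = (\<lambda>(j, x, d). (j, x, - d))"

definition leg_site :: "'v leg \<Rightarrow> nat \<times> 'v" where
  "leg_site = (\<lambda>(j, x, d). (j, x))"

lemma nbr_le: "j \<le> k \<Longrightarrow> nbr k j d \<le> k"
  by (auto simp: nbr_def)

lemma nbr_nbr: "j \<le> k \<Longrightarrow> d \<in> {-1, 1} \<Longrightarrow> nbr k (nbr k j d) (- d) = j"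
  by (auto simp: nbr_def)

lemma exit_letter_nbr:
  "j \<le> length w \<Longrightarrow> d \<in> {-1, 1} \<Longrightarrow> exit_letter w (nbr (length w) j d) (- d) = exit_letter w j d"
  by (auto simp: nbr_def exit_letter_def)

lemma hop_straight: "x \<notin> fst (exit_letter w j d) \<Longrightarrow> hop w (j, x, d) = (nbr (length w) j d, x, d)"
  by (simp add: hop_def Let_def)

lemma hop_jump:
  assumes "exit_letter w j d = ({x, y}, m)" "x \<noteq> y"
  shows "hop w (j, x, d) = (case m of Cross \<Rightarrow> (nbr (length w) j d, y, d) | Bar \<Rightarrow> (j, y, - d))"
proof -
  have "(THE z. {x, y} = {x, z} \<and> z \<noteq> x) = y"
    using assms(2) by (intro the_equality) (auto simp: doubleton_eq_iff)
  then show ?thesis using assms(1) by (simp add: hop_def)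
qed

lemma closing_eq_exit:
  "closing V w no_mark = (\<Union>i\<le>length w. glue V (exit_letter w i 1) i (nbr (length w) i 1))"
proof -
  have "{..length w} = insert (length w) {..<length w}" by auto
  then have "(\<Union>i\<le>length w. glue V (exit_letter w i 1) i (nbr (length w) i 1)) =
      glue V no_mark (length w) 0 \<union> (\<Union>i<length w. glue V (exit_letter w i 1) i (nbr (length w) i 1))"
    by (simp add: exit_letter_def nbr_def)
  also have "(\<Union>i<length w. glue V (exit_letter w i 1) i (nbr (length w) i 1)) = strands V w"
    unfolding strands_def by (intro SUP_cong refl) (simp add: exit_letter_def nbr_def)
  finally show ?thesis by (auto simp: closing_def)
qed

locale loop_word =
  fixes V :: "'v set" and w :: "'v letter list"
  assumes finite_V: "finite V" and letters: "set w \<subseteq> edge_letters V"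
begin

abbreviation "k \<equiv> length w"
abbreviation "X \<equiv> canonical w"
abbreviation "R \<equiv> closing V w no_mark"

lemma exit_letter_cases:
  assumes "j \<le> k" "d \<in> {-1, 1}"
  obtains "exit_letter w j d = no_mark"
  | x y m where "exit_letter w j d = ({x, y}, m)" "x \<noteq> y" "x \<in> V" "y \<in> V"
proof -
  have "exit_letter w j d = no_mark \<or> exit_letter w j d \<in> set w"
    using assms by (auto simp: exit_letter_def)
  then show thesis
  proof
    assume "exit_letter w j d \<in> set w"
    then have "exit_letter w j d \<in> edge_letters V" using letters by blast
    then show thesis using that(2)
      by (cases "exit_letter w j d") (auto simp: edge_letters_def card_2_iff)
  qed (rule that(1))
qed

lemma hop_cases:
  assumes "(j, x, d) \<in> legs V w"
  obtains (straight) "x \<notin> fst (exit_letter w j d)" "hop w (j, x, d) = (nbr k j d, x, d)"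
  | (cross) y where "exit_letter w j d = ({x, y}, Cross)" "x \<noteq> y" "y \<in> V" "hop w (j, x, d) = (nbr k j d, y, d)"
  | (bar) y where "exit_letter w j d = ({x, y}, Bar)" "x \<noteq> y" "y \<in> V" "hop w (j, x, d) = (j, y, - d)"
proof (cases "x \<in> fst (exit_letter w j d)")
  case False
  show thesis by (rule straight[OF False hop_straight[OF False]])
next
  case True
  have jd: "j \<le> k" "d \<in> {-1, 1}" using assms by auto
  show thesis
  proof (rule exit_letter_cases[OF jd])
    fix a b m assume ab: "exit_letter w j d = ({a, b}, m)" "a \<noteq> b" "a \<in> V" "b \<in> V"
    obtain y where y: "{a, b} = {x, y}" "x \<noteq> y" "y \<in> V" using True ab by auto
    then have e: "exit_letter w j d = ({x, y}, m)" using ab by simp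
    show thesis
      using hop_jump[OF e y(2)] e y cross bar by (cases m) auto
  qed (use True in auto)
qed

lemma hop_leg: assumes s: "s \<in> legs V w" shows "hop w s \<in> legs V w"
proof -
  obtain j x d where sj: "s = (j, x, d)" by (cases s)
  then have leg: "(j, x, d) \<in> legs V w" using s by simp
  then show ?thesis unfolding sj by (cases rule: hop_cases) (use leg in \<open>auto simp: nbr_le\<close>)
qed

text \<open>Time reversal. It makes \<open>hop\<close> injective, and lets a neighbouring site be reached from either
  direction.\<close>

lemma hop_reverse:
  assumes s: "s \<in> legs V w" shows "hop w (reverse_leg (hop w s)) = reverse_leg s"
proof -
  obtain j x d where sj: "s = (j, x, d)" by (cases s)
  then have jd: "j \<le> k" "d \<in> {-1, 1}" and leg: "(j, x, d) \<in> legs V w" using s by auto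
  note e = exit_letter_nbr[OF jd] and n = nbr_nbr[OF jd]
  from leg show ?thesis
  proof (cases rule: hop_cases)
    case straight
    then show ?thesis unfolding sj reverse_leg_def using hop_straight[of x w "nbr k j d" "- d"] e n by simp
  next
    case (cross y)
    have "hop w (nbr k j d, y, - d) = (nbr k (nbr k j d) (- d), x, - d)"
      using hop_jump[of w "nbr k j d" "- d" y x Cross] cross e by (simp add: insert_commute)
    then show ?thesis unfolding sj reverse_leg_def using cross n by simp
  next
    case (bar y)
    have "hop w (j, y, d) = (j, x, - d)"
      using hop_jump[of w j d y x Bar] bar by (simp add: insert_commute)
    then show ?thesis unfolding sj reverse_leg_def using bar by simp
  qed
qed

lemma reverse_reverse [simp]: "reverse_leg (reverse_leg s) = s"
  by (cases s) (simp add: reverse_leg_def)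

lemma inj_on_hop: "inj_on (hop w) (legs V w)"
proof (rule inj_onI)
  fix s t assume "s \<in> legs V w" "t \<in> legs V w" "hop w s = hop w t"
  then have "reverse_leg s = reverse_leg t"
    using hop_reverse[of s] hop_reverse[of t] by (simp only:)
  then have "reverse_leg (reverse_leg s) = reverse_leg (reverse_leg t)" by (rule arg_cong)
  then show "s = t" by (simp only: reverse_reverse)
qed

text \<open>An injective map of a finite set into itself is a permutation. This is why all trajectories are
  closed.\<close>

lemma hop_periodic:
  assumes s: "s \<in> legs V w" obtains n where "0 < n" "(hop w ^^ n) s = s"
proof -
  define p where "p = (\<lambda>s. if s \<in> legs V w then hop w s else s)"
  have pow: "(p ^^ n) s = (hop w ^^ n) s \<and> (hop w ^^ n) s \<in> legs V w" for n
  proof (induction n)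
    case (Suc n)
    then show ?case using hop_leg by (simp add: p_def)
  qed (use s in simp)
  have "inj p"
  proof (rule injI)
    fix a b assume eq: "p a = p b"
    have leg: "p c \<in> legs V w \<longleftrightarrow> c \<in> legs V w" for c
      unfolding p_def using hop_leg[of c] by (cases "c \<in> legs V w") (simp_all only: if_True if_False)
    show "a = b"
    proof (cases "a \<in> legs V w")
      case True
      then have b: "b \<in> legs V w" using leg[of a] leg[of b] eq by (simp only:)
      have "hop w a = hop w b" using eq True b unfolding p_def by (simp only: if_True)
      then show ?thesis using inj_onD[OF inj_on_hop _ True b] by blast
    next
      case False
      then have "b \<notin> legs V w" using leg[of a] leg[of b] eq by (simp only:) blast
      then show ?thesis using eq False unfolding p_def by (simp only: if_False)
    qed
  qed
  moreover have "finite {y. \<exists>n. y = (p ^^ n) s}"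
  proof (rule finite_subset)
    have "(p ^^ n) s \<in> legs V w" for n using pow[of n] by metis
    then show "{y. \<exists>n. y = (p ^^ n) s} \<subseteq> legs V w" by blast
  qed (use finite_V in simp)
  ultimately obtain n where "0 < n" "(p ^^ n) s = s" by (rule funpow_inj_finite)
  then show thesis using pow that by metis
qed

definition orbit :: "'v leg \<Rightarrow> 'v leg set" where
  "orbit s = range (\<lambda>n. (hop w ^^ n) s)"

lemma orbit_self: "s \<in> orbit s"
  unfolding orbit_def by (rule range_eqI[of _ _ 0]) simp

lemma orbit_hop: "t \<in> orbit s \<Longrightarrow> hop w t \<in> orbit s"
proof -
  assume "t \<in> orbit s"
  then obtain n where "t = (hop w ^^ n) s" by (auto simp: orbit_def)
  then have "hop w t = (hop w ^^ Suc n) s" by simp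
  then show ?thesis unfolding orbit_def by (rule range_eqI)
qed

lemma orbit_legs: "s \<in> legs V w \<Longrightarrow> t \<in> orbit s \<Longrightarrow> t \<in> legs V w"
proof -
  assume s: "s \<in> legs V w" and "t \<in> orbit s"
  then obtain n where t: "t = (hop w ^^ n) s" by (auto simp: orbit_def)
  show "t \<in> legs V w" unfolding t by (induction n) (use s hop_leg in auto)
qed

lemma orbit_pred:
  assumes s: "s \<in> legs V w" and t: "t \<in> orbit s"
  obtains t' where "t' \<in> orbit s" "hop w t' = t"
proof -
  obtain n where n: "t = (hop w ^^ n) s" using t by (auto simp: orbit_def)
  obtain p where p: "0 < p" "(hop w ^^ p) s = s" using hop_periodic[OF s] .
  then have "t = (hop w ^^ (n + p)) s" by (simp add: n funpow_add)
  then have "hop w ((hop w ^^ (n + p - 1)) s) = t" using p(1) by (cases "n + p") auto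
  moreover have "(hop w ^^ (n + p - 1)) s \<in> orbit s" by (simp add: orbit_def)
  ultimately show thesis by (intro that)
qed

lemma hop_glued:
  assumes "(j, x, d) \<in> legs V w" "hop w (j, x, d) = (i, y, d')"
  shows "((j, x), (i, y)) \<in> R \<union> R\<inverse>"
proof -
  have jd: "j \<le> k" "d \<in> {-1, 1}" "x \<in> V" using assms by auto
  have up: "((j, x), (i, y)) \<in> glue V (exit_letter w j 1) j (nbr k j 1)" if "d = 1"
    using assms(1) by (cases rule: hop_cases) (use that assms(2) jd in \<open>auto simp: glue_def\<close>)
  have dn: "((j, x), (i, y)) \<in> (glue V l i0 j) \<union> (glue V l i0 j)\<inverse>"
    if "d = -1" "l = exit_letter w j (-1)" "i0 = nbr k j (-1)" for l i0
    using assms(1) by (cases rule: hop_cases) (use that assms(2) jd in \<open>auto simp: glue_def insert_commute\<close>)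
  show ?thesis
  proof (cases "d = 1")
    case True
    then show ?thesis using up jd unfolding closing_eq_exit by blast
  next
    case False
    let ?i = "nbr k j (-1)"
    have "exit_letter w ?i 1 = exit_letter w j (-1)" "nbr k ?i 1 = j" "?i \<le> k"
      using exit_letter_nbr[of j w "-1"] nbr_nbr[of j k "-1"] nbr_le jd by auto
    then have "glue V (exit_letter w j (-1)) ?i j \<subseteq> R"
      unfolding closing_eq_exit by fastforce
    then show ?thesis using dn[OF _ refl refl] False jd(2) by blast
  qed
qed

lemma glued_hop:
  assumes "((j, x), (i, y)) \<in> R"
  obtains d d' where "d \<in> {-1, 1}" "hop w (j, x, d) = (i, y, d')"
proof -
  obtain h where h: "h \<le> k" and g: "((j, x), (i, y)) \<in> glue V (exit_letter w h 1) h (nbr k h 1)"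
    using assms unfolding closing_eq_exit by blast
  let ?l = "exit_letter w h 1" and ?h' = "nbr k h 1"
  have down: "exit_letter w ?h' (-1) = ?l" "nbr k ?h' (-1) = h"
    using exit_letter_nbr[OF h, of 1] nbr_nbr[OF h, of 1] by auto
  have ne: "a \<noteq> b" if "fst ?l = {a, b}" for a b
    using exit_letter_cases[OF h, of 1] that by (metis doubleton_eq_iff fst_conv insert_absorb2 insert_not_empty insertCI)
  from g consider (straight) "x \<notin> fst ?l" "j = h" "i = ?h'" "x = y"
    | (cross) "?l = ({x, y}, Cross)" "j = h" "i = ?h'"
    | (low) "?l = ({x, y}, Bar)" "j = h" "i = h"
    | (high) "?l = ({x, y}, Bar)" "j = ?h'" "i = ?h'"
    by (cases ?l; cases "snd ?l") (auto simp: glue_def)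
  then show thesis
  proof cases
    case straight
    then show thesis using that[of 1] hop_straight by fastforce
  next
    case cross
    then show thesis using that[of 1 1] hop_jump[of w h 1 x y Cross] ne[of x y] by simp
  next
    case low
    then show thesis using that[of 1 "-1"] hop_jump[of w h 1 x y Bar] ne[of x y] by simp
  next
    case high
    then show thesis using that[of "-1" 1] hop_jump[of w ?h' "-1" x y Bar] ne[of x y] down by simp
  qed
qed

lemma R_subset: "R \<subseteq> sites V w \<times> sites V w"
  using letters by (intro closing_subset) (auto simp: edge_letters_def)

text \<open>Every gluing between sites is a hop out of one of the two ends of a leg. An orbit is closed under
  hops and, being periodic, under their inverses; so it leaves a site through both ends, and the sites
  of an orbit form a full class whatever the initial direction.\<close>

lemma orbit_sites:
  assumes s: "(j, x, d) \<in> legs V w"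
  shows "leg_site ` orbit (j, x, d) = glued R `` {(j, x)}"
proof (intro equalityI subsetI)
  fix p assume "p \<in> leg_site ` orbit (j, x, d)"
  then obtain n where p: "p = leg_site ((hop w ^^ n) (j, x, d))" by (auto simp: orbit_def)
  have "((j, x), leg_site ((hop w ^^ n) (j, x, d))) \<in> glued R"
  proof (induction n)
    case (Suc n)
    let ?t = "(hop w ^^ n) (j, x, d)"
    obtain j1 x1 d1 j2 x2 d2 where t: "?t = (j1, x1, d1)" "hop w (j1, x1, d1) = (j2, x2, d2)"
      by (metis prod_cases3)
    have "?t \<in> legs V w" using orbit_legs[OF s, of ?t] by (simp add: orbit_def)
    then have "((j1, x1), (j2, x2)) \<in> R \<union> R\<inverse>"
      unfolding t(1) by (rule hop_glued[OF _ t(2)])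
    then have "(leg_site ?t, leg_site (hop w ?t)) \<in> R \<union> R\<inverse>"
      using t by (simp add: leg_site_def)
    then have "(leg_site ?t, leg_site (hop w ?t)) \<in> glued R" unfolding glued_def by blast
    with Suc show ?case by (simp add: glued_trans[of _ "leg_site ?t"])
  qed (simp add: leg_site_def)
  then show "p \<in> glued R `` {(j, x)}" using p by simp
next
  fix p assume "p \<in> glued R `` {(j, x)}"
  then have "((j, x), p) \<in> (R \<union> R\<inverse>)\<^sup>*" by (simp add: glued_def)
  then show "p \<in> leg_site ` orbit (j, x, d)"
  proof (induction rule: rtrancl_induct)
    case base
    show ?case using orbit_self[of "(j, x, d)"] by (force simp: leg_site_def)
  next
    case (step p q)
    obtain i y b where leg: "(i, y, b) \<in> orbit (j, x, d)" and p: "p = (i, y)"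
      using step.IH by (auto simp: leg_site_def)
    obtain i' y' where q: "q = (i', y')" by (cases q)
    have ib: "(i, y, b) \<in> legs V w" using orbit_legs[OF s leg] .
    have q': "(i', y') \<in> sites V w" using step.hyps R_subset unfolding p q by auto
    \<comment> \<open>Both sites are joined by a hop, possibly after exchanging them and reversing time.\<close>
    have "\<exists>d1 d2. d1 \<in> {-1, 1} \<and> d2 \<in> {-1, 1} \<and> hop w (i, y, d1) = (i', y', d2)"
    proof (cases "(p, q) \<in> R")
      case True
      then obtain d1 d2 where "d1 \<in> {-1, 1}" "hop w (i, y, d1) = (i', y', d2)"
        unfolding p q by (rule glued_hop)
      moreover have "(i', y', d2) \<in> legs V w"
        using hop_leg[of "(i, y, d1)"] calculation ib by auto
      ultimately show ?thesis by auto
    next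
      case False
      then have "(q, p) \<in> R" using step.hyps by auto
      then obtain d1 d2 where *: "d1 \<in> {-1, 1}" "hop w (i', y', d1) = (i, y, d2)"
        unfolding p q by (rule glued_hop)
      have l: "(i', y', d1) \<in> legs V w" using * q' by auto
      have "hop w (i, y, - d2) = (i', y', - d1)"
        using hop_reverse[OF l] * by (simp add: reverse_leg_def)
      moreover have "(i, y, d2) \<in> legs V w" using hop_leg[OF l] * by simp
      ultimately show ?thesis using *(1) by (intro exI[of _ "- d2"] exI[of _ "- d1"]) auto
    qed
    then obtain d1 d2 where h: "d1 \<in> {-1, 1}" "d2 \<in> {-1, 1}" "hop w (i, y, d1) = (i', y', d2)" by blast
    show ?case
    proof (cases "d1 = b")
      case True
      then have "(i', y', d2) \<in> orbit (j, x, d)" using orbit_hop[OF leg] h by simp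
      then show ?thesis unfolding q by (force simp: leg_site_def)
    next
      case False
      then have b: "b = - d1" using ib h(1) by auto
      have l: "(i, y, d1) \<in> legs V w" using ib h by auto
      have down: "hop w (i', y', - d2) = (i, y, b)"
        using hop_reverse[OF l] h b by (simp add: reverse_leg_def)
      obtain t where t: "t \<in> orbit (j, x, d)" "hop w t = (i, y, b)" using orbit_pred[OF s leg] .
      have "t = (i', y', - d2)"
      proof (rule inj_onD[OF inj_on_hop])
        show "hop w t = hop w (i', y', - d2)" using t down by simp
        show "t \<in> legs V w" using orbit_legs[OF s t(1)] .
        show "(i', y', - d2) \<in> legs V w" using q' h(2) by auto
      qed
      then show ?thesis using t unfolding q by (force simp: leg_site_def)
    qed
  qed
qed

end

section \<open>Trajectories of equally spaced marks\<close>

lemma frac_add_frac: "frac (frac a + b) = frac (a + b)"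
proof -
  have "frac a + b = (a + b) + of_int (- \<lfloor>a\<rfloor>)" by (simp add: frac_def)
  then show ?thesis by (simp only: frac_add_of_int_right)
qed

lemma pos_shift:
  assumes "d \<in> {-1, 1}"
  shows "frac (pos k j d v + d * r) = pos k j d (v + r * real (Suc k))"
  unfolding pos_def frac_add_frac
  using assms by (auto simp: field_simps simp del: of_nat_Suc intro!: arg_cong[where f = frac])

lemma pos_turn: "d \<in> {-1, 1} \<Longrightarrow> pos k j d 1 = pos k j (- d) 0"
  by (auto simp: pos_def add.commute)

lemma pos_flip: "d \<in> {-1, 1} \<Longrightarrow> pos k j (- d) v = pos k j d (1 - v)"
  by (auto simp: pos_def algebra_simps)

lemma pos_join: "j \<le> k \<Longrightarrow> d \<in> {-1, 1} \<Longrightarrow> pos k j d 1 = pos k (nbr k j d) d 0"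
  by (cases "j = k") (auto simp: pos_def nbr_def add.commute[of "real _" 1])

lemma pos_range: "0 \<le> pos k j d v \<and> pos k j d v < 1"
  by (simp add: pos_def frac_lt_1)

lemma pos_inside:
  assumes "j \<le> k" "d \<in> {-1, 1}" "0 < v" "v < 1"
  shows "pos k j d v = (real j + (if d = 1 then v else 1 - v)) / real (Suc k)"
proof -
  have "pos k j d v = frac ((real j + (if d = 1 then v else 1 - v)) / real (Suc k))"
    using assms by (auto simp: pos_def algebra_simps)
  moreover have "0 \<le> (real j + (if d = 1 then v else 1 - v)) / real (Suc k)"
    using assms by simp
  moreover have "(real j + (if d = 1 then v else 1 - v)) / real (Suc k) < 1"
    using assms by (auto simp: divide_less_eq)
  ultimately show ?thesis by (simp add: frac_eq)
qed

lemma pos_end: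
  assumes "j \<le> k" "d \<in> {-1, 1}"
  shows "pos k j d 1 = (if d = 1 then (if j < k then real (Suc j) / real (Suc k) else 0) else real j / real (Suc k))"
proof -
  have 1: "frac (real i / real (Suc k)) = real i / real (Suc k)" if "i \<le> k" for i
    using that by (subst frac_eq) (auto simp: divide_less_eq)
  show ?thesis
  proof (cases "d = 1")
    case True
    then show ?thesis using assms 1[of "Suc j"] by (cases "j = k") (auto simp: pos_def add.commute)
  next
    case False
    then show ?thesis using assms 1[of j] by (simp add: pos_def)
  qed
qed

lemma pos_cases:
  assumes s: "0 \<le> s" "s < 1" and d: "d \<in> {-1, 1}"
  obtains j v where "j \<le> k" "0 < v" "v \<le> 1" "s = pos k j d v"
proof -
  let ?a = "s * real (Suc k)"
  have fs: "frac s = s" using s by (simp add: frac_eq)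
  have a: "0 \<le> ?a" "?a < real (Suc k)" using s by auto
  have as: "?a / real (Suc k) = s" by simp
  show thesis
  proof (cases "d = 1")
    case False
    define j where "j = nat \<lfloor>?a\<rfloor>"
    have j: "real j \<le> ?a" "?a < real j + 1" using a unfolding j_def by linarith+
    then have "real j < real (Suc k)" using a by linarith
    then have "j \<le> k" by simp
    moreover have "s = pos k j d (real j + 1 - ?a)"
      unfolding pos_def using False as fs by simp
    ultimately show thesis using that[of j "real j + 1 - ?a"] j by simp
  next
    case True
    show thesis
    proof (cases "s = 0")
      case True
      then show thesis using that[of k 1] \<open>d = 1\<close> by (simp add: pos_def add.commute)
    next
      case False
      define j where "j = nat (\<lceil>?a\<rceil> - 1)"
      have "0 < ?a" using s False by simp
      then have j: "real j < ?a" "?a \<le> real j + 1" unfolding j_def by linarith+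
      then have "real j < real (Suc k)" using a by linarith
      then have "j \<le> k" by simp
      moreover have "s = pos k j d (?a - real j)"
        unfolding pos_def using \<open>d = 1\<close> as fs by simp
      ultimately show thesis using that[of j "?a - real j"] j by simp
    qed
  qed
qed

context loop_word begin

lemma canonical_pos_inside:
  assumes "j \<le> k" "d \<in> {-1, 1}" "0 < v" "v < 1"
  shows "(e, pos k j d v, m) \<notin> X"
proof
  assume "(e, pos k j d v, m) \<in> X"
  then obtain i where "pos k j d v = real (Suc i) / real (Suc k)" by (auto simp: canonical_def)
  then have "real j + (if d = 1 then v else 1 - v) = real (Suc i)"
    unfolding pos_inside[OF assms] by (simp del: of_nat_Suc)
  then have "real j < real (Suc i)" "real (Suc i) < real (Suc j)" using assms by (auto split: if_splits)
  then show False by (simp only: of_nat_less_iff)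
qed

lemma canonical_pos_end:
  assumes j: "j \<le> k" and d: "d \<in> {-1, 1}"
  shows "(e, pos k j d 1, m) \<in> X \<longleftrightarrow> exit_letter w j d = (e, m) \<and> e \<noteq> {}"
proof -
  have ne: "fst (w ! i) \<noteq> {}" if "i < k" for i
    using letters nth_mem[OF that] by (auto simp: edge_letters_def)
  have "(e, pos k j d 1, m) \<in> X \<longleftrightarrow> (\<exists>i<k. w ! i = (e, m) \<and> pos k j d 1 = real (Suc i) / real (Suc k))"
    by (auto simp: canonical_def intro: prod_eqI)
  also have "\<dots> \<longleftrightarrow> (\<exists>i<k. w ! i = (e, m) \<and> (if d = 1 then j < k \<and> i = j else j = Suc i))"
    unfolding pos_end[OF j d] by (intro ex_cong1 conj_cong refl) (auto simp del: of_nat_Suc)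
  also have "\<dots> \<longleftrightarrow> exit_letter w j d = (e, m) \<and> e \<noteq> {}"
  proof (cases "d = 1")
    case True
    show ?thesis using ne[of j] True by (cases "j < k") (auto simp: exit_letter_def)
  next
    case False
    show ?thesis
    proof (cases j)
      case 0
      then show ?thesis using False by (auto simp: exit_letter_def)
    next
      case (Suc i)
      then show ?thesis using ne[of i] False j by (auto simp: exit_letter_def)
    qed
  qed
  finally show ?thesis .
qed

lemma marked_inside: "j \<le> k \<Longrightarrow> d \<in> {-1, 1} \<Longrightarrow> 0 < v \<Longrightarrow> v < 1 \<Longrightarrow> \<not> marked X x (pos k j d v)"
  using canonical_pos_inside by (auto simp: marked_def)

lemma marked_end:
  assumes "j \<le> k" "d \<in> {-1, 1}"
  shows "marked X x (pos k j d 1) \<longleftrightarrow> x \<in> fst (exit_letter w j d)"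
  unfolding marked_def canonical_pos_end[OF assms] by (cases "exit_letter w j d") auto

text \<open>A state on a leg that has not yet jumped at its far end: the arrival states of a trajectory.\<close>

definition arrives :: "'v state \<Rightarrow> 'v leg \<Rightarrow> bool" where
  "arrives \<sigma> s \<longleftrightarrow> (\<exists>j x d v. s = (j, x, d) \<and> 0 < v \<and> v \<le> 1 \<and> \<sigma> = (x, pos k j d v, d))"

text \<open>A state on a leg after the possible jump at its near end.\<close>

definition departs :: "'v state \<Rightarrow> 'v leg \<Rightarrow> bool" where
  "departs \<sigma> s \<longleftrightarrow> (\<exists>j x d v. s = (j, x, d) \<and> 0 \<le> v \<and> v < 1 \<and> \<sigma> = (x, pos k j d v, d))"

lemma arrivesI: "0 < v \<Longrightarrow> v \<le> 1 \<Longrightarrow> arrives (x, pos k j d v, d) (j, x, d)"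
  unfolding arrives_def by blast

lemma departsI: "0 \<le> v \<Longrightarrow> v < 1 \<Longrightarrow> departs (x, pos k j d v, d) (j, x, d)"
  unfolding departs_def by blast

lemma jump_inside:
  assumes "j \<le> k" "d \<in> {-1, 1}" "0 < v" "v < 1"
  shows "jump X (x, pos k j d v, d) \<tau> \<longleftrightarrow> \<tau> = (x, pos k j d v, d)"
  using canonical_pos_inside[OF assms] marked_inside[OF assms, of x]
  by (auto elim: jump.cases intro: jump.intros)

lemma jump_end:
  assumes leg: "(j, x, d) \<in> legs V w"
  shows "jump X (x, pos k j d 1, d) \<tau> \<longleftrightarrow>
    (\<exists>i y d'. hop w (j, x, d) = (i, y, d') \<and> \<tau> = (y, pos k j d 1, d'))"
proof -
  have jd: "j \<le> k" "d \<in> {-1, 1}" using leg by auto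
  have L: "jump X (x, pos k j d 1, d) \<tau> \<longleftrightarrow>
     (\<exists>y. exit_letter w j d = ({x, y}, Cross) \<and> \<tau> = (y, pos k j d 1, d)) \<or>
     (\<exists>y. exit_letter w j d = ({x, y}, Bar) \<and> \<tau> = (y, pos k j d 1, - d)) \<or>
     (x \<notin> fst (exit_letter w j d) \<and> \<tau> = (x, pos k j d 1, d))"
    by (subst jump.simps) (auto simp: canonical_pos_end[OF jd] marked_end[OF jd])
  from leg show ?thesis
  proof (cases rule: hop_cases)
    case straight
    then show ?thesis unfolding L by auto
  next
    case (cross y)
    then show ?thesis unfolding L by (auto simp: doubleton_eq_iff)
  next
    case (bar y)
    then show ?thesis unfolding L by (auto simp: doubleton_eq_iff)
  qed
qed

lemma hop_pos:
  assumes leg: "(j, x, d) \<in> legs V w" and "hop w (j, x, d) = (i, y, d')"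
  shows "pos k j d 1 = pos k i d' 0"
proof -
  have jd: "j \<le> k" "d \<in> {-1, 1}" using leg by auto
  from leg show ?thesis
    by (cases rule: hop_cases) (use assms pos_join[OF jd] pos_turn[OF jd(2), of k j] in auto)
qed

lemma jump_departs:
  assumes s: "s \<in> legs V w" and a: "arrives \<sigma> s" and j: "jump X \<sigma> \<tau>"
  shows "departs \<tau> s \<or> departs \<tau> (hop w s)"
proof -
  obtain j x d v where sj: "s = (j, x, d)" and v: "0 < v" "v \<le> 1" and \<sigma>: "\<sigma> = (x, pos k j d v, d)"
    using a by (auto simp: arrives_def)
  have jd: "j \<le> k" "d \<in> {-1, 1}" using s sj by auto
  show ?thesis
  proof (cases "v = 1")
    case True
    then obtain i y d' where h: "hop w (j, x, d) = (i, y, d')" "\<tau> = (y, pos k j d 1, d')"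
      using j jump_end s unfolding sj \<sigma> by auto
    then have "departs \<tau> (hop w s)"
      using hop_pos[of j x d i y d'] s departsI[of 0 y i d'] unfolding sj by simp
    then show ?thesis ..
  next
    case False
    then have "\<tau> = \<sigma>" using j v jump_inside[OF jd] unfolding \<sigma> by simp
    then have "departs \<tau> s" unfolding sj \<sigma> using v False departsI[of v x j d] by simp
    then show ?thesis ..
  qed
qed

text \<open>A single step may pass through many intervals, and even around the circle several times, as long
  as it meets no mark. The induction is on the number of boundaries that are passed, each of which is a
  straight hop.\<close>

lemma motion_arrives:
  assumes "(j, x, d) \<in> legs V w" "0 \<le> v" "v < 1" "0 < r"
    and "\<And>q. 0 < q \<Longrightarrow> q < r \<Longrightarrow> \<not> marked X x (frac (pos k j d v + d * q))"
    and "v + r * real (Suc k) \<le> 1 + real N"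
  shows "\<exists>n. arrives (x, frac (pos k j d v + d * r), d) ((hop w ^^ n) (j, x, d))"
  using assms
proof (induction N arbitrary: j v r)
  case 0
  have d: "d \<in> {-1, 1}" using 0 by auto
  have "0 < r * real (Suc k)" using 0(4) by simp
  then have "arrives (x, frac (pos k j d v + d * r), d) ((hop w ^^ 0) (j, x, d))"
    unfolding pos_shift[OF d] funpow_0 using 0 by (intro arrivesI) linarith+
  then show ?case by blast
next
  case (Suc N)
  have d: "d \<in> {-1, 1}" and j: "j \<le> k" using Suc.prems by auto
  show ?case
  proof (cases "v + r * real (Suc k) \<le> 1")
    case True
    have "0 < r * real (Suc k)" using Suc.prems by simp
    then have "arrives (x, frac (pos k j d v + d * r), d) ((hop w ^^ 0) (j, x, d))"
      unfolding pos_shift[OF d] funpow_0 using Suc.prems True by (intro arrivesI) linarith+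
    then show ?thesis by blast
  next
    case False
    \<comment> \<open>The time until the end of the current interval.\<close>
    define q where "q = (1 - v) / real (Suc k)"
    have qK: "q * real (Suc k) = 1 - v" by (simp add: q_def del: of_nat_Suc)
    have q0: "0 < q" using Suc.prems by (simp add: q_def)
    have "q * real (Suc k) < r * real (Suc k)" using False qK by linarith
    then have qr: "q < r" by (simp del: of_nat_Suc)
    have e: "frac (pos k j d v + d * q) = pos k j d 1" unfolding pos_shift[OF d] qK by simp
    then have "x \<notin> fst (exit_letter w j d)"
      using Suc.prems(5)[OF q0 qr] marked_end[OF j d] by simp
    then have hop: "hop w (j, x, d) = (nbr k j d, x, d)" by (rule hop_straight)
    have leg: "(nbr k j d, x, d) \<in> legs V w" using hop_leg[OF Suc.prems(1)] hop by simp
    have shift: "frac (pos k (nbr k j d) d 0 + d * p) = frac (pos k j d v + d * (q + p))" for p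
      unfolding pos_join[OF j d, symmetric] e[symmetric] frac_add_frac by (simp add: algebra_simps)
    have "\<exists>n. arrives (x, frac (pos k (nbr k j d) d 0 + d * (r - q)), d) ((hop w ^^ n) (nbr k j d, x, d))"
    proof (rule Suc.IH[OF leg])
      show "\<not> marked X x (frac (pos k (nbr k j d) d 0 + d * p))" if "0 < p" "p < r - q" for p
        unfolding shift using that q0 by (intro Suc.prems(5)) auto
      show "0 + (r - q) * real (Suc k) \<le> 1 + real N"
        using Suc.prems(6) qK by (simp add: left_diff_distrib del: of_nat_Suc)
    qed (use qr in auto)
    moreover have "frac (pos k (nbr k j d) d 0 + d * (r - q)) = frac (pos k j d v + d * r)"
      unfolding shift by simp
    ultimately obtain n where n: "arrives (x, frac (pos k j d v + d * r), d) ((hop w ^^ n) (nbr k j d, x, d))"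
      by (simp only:) blast
    have "(hop w ^^ Suc n) (j, x, d) = (hop w ^^ n) (nbr k j d, x, d)"
      unfolding funpow_Suc_right o_apply hop ..
    with n show ?thesis by metis
  qed
qed

lemma departs_motion:
  assumes s: "s \<in> legs V w" and dep: "departs (x, a, d) s" and r: "0 < r"
    and free: "\<And>q. 0 < q \<Longrightarrow> q < r \<Longrightarrow> \<not> marked X x (frac (a + d * q))"
  shows "\<exists>n. arrives (x, frac (a + d * r), d) ((hop w ^^ n) s)"
proof -
  obtain j v where sj: "s = (j, x, d)" "0 \<le> v" "v < 1" "a = pos k j d v"
    using dep by (auto simp: departs_def)
  obtain N :: nat where "v + r * real (Suc k) \<le> real N" by (meson real_arch_simple)
  then have "v + r * real (Suc k) \<le> 1 + real N" by simp
  then show ?thesis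
    unfolding sj(4) using s sj(2,3) r free[unfolded sj(4)] unfolding sj(1) by (intro motion_arrives[where N = N])
qed

lemma step_arrives:
  assumes s: "s \<in> legs V w" and a: "arrives \<sigma> s" and st: "step X \<sigma> \<tau>"
  shows "\<exists>n. arrives \<tau> ((hop w ^^ n) s)"
  using st
proof cases
  case (1 x a' d r)
  from jump_departs[OF s a 1(2)] show ?thesis
  proof
    assume "departs (x, a', d) s"
    then show ?thesis unfolding 1(1) by (rule departs_motion[OF s _ 1(3,4)])
  next
    assume "departs (x, a', d) (hop w s)"
    then have "\<exists>n. arrives \<tau> ((hop w ^^ n) (hop w s))"
      unfolding 1(1) by (rule departs_motion[OF hop_leg[OF s] _ 1(3,4)])
    then show ?thesis by (metis funpow_Suc_right o_apply)
  qed
qed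

lemma steps_arrive:
  assumes s: "s \<in> legs V w" and a: "arrives \<sigma> s" and st: "(step X)\<^sup>*\<^sup>* \<sigma> \<tau>"
  shows "\<exists>t\<in>orbit s. arrives \<tau> t"
  using st
proof (induction rule: rtranclp_induct)
  case base
  then show ?case using a orbit_self by blast
next
  case (step \<tau> \<tau>')
  then obtain n where n: "arrives \<tau> ((hop w ^^ n) s)" by (auto simp: orbit_def)
  have "(hop w ^^ n) s \<in> legs V w" by (rule orbit_legs[OF s]) (simp add: orbit_def)
  from step_arrives[OF this n step.hyps(2)]
  obtain m where "arrives \<tau>' ((hop w ^^ m) ((hop w ^^ n) s))" ..
  then have "arrives \<tau>' ((hop w ^^ (m + n)) s)" by (simp add: funpow_add)
  then show ?case by (auto simp: orbit_def)
qed

lemma step_within: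
  assumes leg: "(j, x, d) \<in> legs V w" and j: "jump X \<sigma> (x, pos k j d v, d)" and v: "0 \<le> v" "v < v'" "v' \<le> 1"
  shows "step X \<sigma> (x, pos k j d v', d)"
proof -
  have jd: "j \<le> k" "d \<in> {-1, 1}" using leg by auto
  define r where "r = (v' - v) / real (Suc k)"
  have rK: "r * real (Suc k) = v' - v" by (simp add: r_def del: of_nat_Suc)
  have r: "0 < r" using v by (simp add: r_def)
  have "step X \<sigma> (x, frac (pos k j d v + d * r), d)"
  proof (rule step.intros[OF j r])
    fix q assume q: "0 < q" "q < r"
    then have "q * real (Suc k) < r * real (Suc k)" "0 < q * real (Suc k)" by (simp_all del: of_nat_Suc)
    then have "0 < v + q * real (Suc k)" "v + q * real (Suc k) < 1" using rK v by linarith+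
    then show "\<not> marked X x (frac (pos k j d v + d * q))"
      unfolding pos_shift[OF jd(2)] by (rule marked_inside[OF jd])
  qed
  then show ?thesis unfolding pos_shift[OF jd(2)] rK by simp
qed

definition leg_end :: "'v leg \<Rightarrow> 'v state" where
  "leg_end = (\<lambda>(j, x, d). (x, pos k j d 1, d))"

lemma reach_end:
  assumes s: "s \<in> legs V w" and a: "arrives \<sigma> s"
  shows "(step X)\<^sup>*\<^sup>* \<sigma> (leg_end s)"
proof -
  obtain j x d v where sj: "s = (j, x, d)" and v: "0 < v" "v \<le> 1" and \<sigma>: "\<sigma> = (x, pos k j d v, d)"
    using a by (auto simp: arrives_def)
  show ?thesis
  proof (cases "v = 1")
    case True
    then show ?thesis by (simp add: sj \<sigma> leg_end_def)
  next
    case False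
    have "jump X \<sigma> (x, pos k j d v, d)"
      unfolding \<sigma> using jump_inside[of j d v x] s v False unfolding sj by simp
    then have "step X \<sigma> (x, pos k j d 1, d)"
      using step_within[of j x d \<sigma> v 1] s v False unfolding sj by simp
    then show ?thesis by (simp add: sj leg_end_def)
  qed
qed

lemma end_jump:
  assumes s: "s \<in> legs V w" and h: "hop w s = (i, y, d')"
  shows "jump X (leg_end s) (y, pos k i d' 0, d')"
  using s h jump_end hop_pos by (cases s) (auto simp: leg_end_def)

lemma end_step:
  assumes s: "s \<in> legs V w" and h: "hop w s = (i, y, d')" and v: "0 < v" "v \<le> 1"
  shows "step X (leg_end s) (y, pos k i d' v, d')"
proof (rule step_within[where v = 0])
  show "(i, y, d') \<in> legs V w" using hop_leg[OF s] h by simp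
qed (use end_jump[OF s h] v in auto)

lemma reach_orbit:
  assumes s: "s \<in> legs V w" and a: "arrives \<sigma> s" and t: "t \<in> orbit s"
  shows "(step X)\<^sup>*\<^sup>* \<sigma> (leg_end t)"
proof -
  obtain n where n: "t = (hop w ^^ n) s" using t by (auto simp: orbit_def)
  show ?thesis unfolding n
  proof (induction n)
    case 0
    show ?case using reach_end[OF s a] by simp
  next
    case (Suc n)
    let ?t = "(hop w ^^ n) s"
    have t: "?t \<in> legs V w" by (rule orbit_legs[OF s]) (simp add: orbit_def)
    obtain i y d' where h: "hop w ?t = (i, y, d')" by (cases "hop w ?t")
    have "step X (leg_end ?t) (leg_end (hop w ?t))"
      unfolding h using end_step[OF t h, of 1] by (simp add: leg_end_def)
    then show ?case using Suc by simp
  qed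
qed

definition segments :: "(nat \<times> 'v) set \<Rightarrow> ('v \<times> real) set" where
  "segments C = {(x, pos k j 1 v) | j x v. (j, x) \<in> C \<and> 0 \<le> v \<and> v \<le> 1}"

text \<open>Reversing the direction runs through the same closed interval backwards.\<close>

lemma segments_legs:
  assumes "\<And>j x d. (j, x, d) \<in> T \<Longrightarrow> d \<in> {-1, 1}"
  shows "segments (leg_site ` T) = {(x, pos k j d v) | j x d v. (j, x, d) \<in> T \<and> 0 \<le> v \<and> v \<le> 1}"
proof (intro equalityI subsetI)
  fix p assume "p \<in> segments (leg_site ` T)"
  then obtain j x d v where *: "(j, x, d) \<in> T" "0 \<le> v" "v \<le> 1" "p = (x, pos k j 1 v)"
    by (auto simp: segments_def leg_site_def)
  show "p \<in> {(x, pos k j d v) | j x d v. (j, x, d) \<in> T \<and> 0 \<le> v \<and> v \<le> 1}"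
  proof (cases "d = 1")
    case True
    then show ?thesis using * by blast
  next
    case False
    then have d: "d = -1" using assms *(1) by auto
    have "pos k j 1 v = pos k j d (1 - v)" using pos_flip[of 1 k j "1 - v"] d by simp
    then show ?thesis using *
      by (intro CollectI exI[of _ j] exI[of _ x] exI[of _ d] exI[of _ "1 - v"]) auto
  qed
next
  fix p assume "p \<in> {(x, pos k j d v) | j x d v. (j, x, d) \<in> T \<and> 0 \<le> v \<and> v \<le> 1}"
  then obtain j x d v where *: "(j, x, d) \<in> T" "0 \<le> v" "v \<le> 1" "p = (x, pos k j d v)" by blast
  then have site: "(j, x) \<in> leg_site ` T" by (force simp: leg_site_def)
  show "p \<in> segments (leg_site ` T)"
  proof (cases "d = 1")
    case True
    then show ?thesis using * site unfolding segments_def by blast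
  next
    case False
    then have d: "d = -1" using assms *(1) by auto
    have "pos k j d v = pos k j 1 (1 - v)" using pos_flip[of 1 k j v] d by simp
    then show ?thesis using * site unfolding segments_def
      by (intro CollectI exI[of _ j] exI[of _ x] exI[of _ "1 - v"]) auto
  qed
qed

text \<open>The trajectory visits exactly the legs of one orbit. The initial leg need not be traversed from
  its beginning, but by periodicity it is met again and then traversed completely.\<close>

lemma trajectory_canonical:
  assumes s: "(j, x, d) \<in> legs V w" and a: "arrives \<sigma> (j, x, d)"
  shows "trajectory X \<sigma> = segments (glued R `` {(j, x)})"
proof -
  let ?s = "(j, x, d)"
  let ?P = "{(x, pos k j d v) | j x d v. (j, x, d) \<in> orbit ?s \<and> 0 \<le> v \<and> v \<le> 1}"
  have inP: "(y, b) \<in> ?P" if t: "t \<in> orbit ?s" and "arrives (y, b, d') t \<or> departs (y, b, d') t" for y b d' t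
    using that unfolding arrives_def departs_def by fastforce
  have "trajectory X \<sigma> = ?P"
  proof (intro equalityI subsetI)
    fix p assume "p \<in> trajectory X \<sigma>"
    moreover obtain y b where p: "p = (y, b)" by (cases p)
    ultimately have "\<exists>d' \<tau>. (step X)\<^sup>*\<^sup>* \<sigma> \<tau> \<and> (\<tau> = (y, b, d') \<or> jump X \<tau> (y, b, d'))"
      by (simp add: trajectory_def)
    then obtain d' \<tau> where st: "(step X)\<^sup>*\<^sup>* \<sigma> \<tau>"
      and \<tau>: "\<tau> = (y, b, d') \<or> jump X \<tau> (y, b, d')" by blast
    obtain t where t: "t \<in> orbit ?s" "arrives \<tau> t" using steps_arrive[OF s a st] by blast
    show "p \<in> ?P"
      using \<tau>
    proof
      assume "\<tau> = (y, b, d')"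
      then show ?thesis unfolding p using inP[OF t(1)] t(2) by blast
    next
      assume "jump X \<tau> (y, b, d')"
      from jump_departs[OF orbit_legs[OF s t(1)] t(2) this]
      show ?thesis unfolding p using inP[OF t(1)] inP[OF orbit_hop[OF t(1)]] by blast
    qed
  next
    fix p assume "p \<in> ?P"
    then obtain i y d' v where p: "p = (y, pos k i d' v)" and o: "(i, y, d') \<in> orbit ?s" and v: "0 \<le> v" "v \<le> 1"
      by blast
    obtain t where t: "t \<in> orbit ?s" "hop w t = (i, y, d')" using orbit_pred[OF s o] .
    note tl = orbit_legs[OF s t(1)]
    note reach = reach_orbit[OF s a t(1)]
    show "p \<in> trajectory X \<sigma>"
    proof (cases "v = 0")
      case True
      then show ?thesis unfolding p trajectory_def using reach end_jump[OF tl t(2)] by blast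
    next
      case False
      then have "step X (leg_end t) (y, pos k i d' v, d')"
        using v by (intro end_step[OF tl t(2)]) auto
      then have "(step X)\<^sup>*\<^sup>* \<sigma> (y, pos k i d' v, d')" using reach by simp
      then show ?thesis unfolding p trajectory_def by blast
    qed
  qed
  also have "?P = segments (leg_site ` orbit ?s)"
    by (rule segments_legs[symmetric]) (use orbit_legs[OF s] in auto)
  also have "\<dots> = segments (glued R `` {(j, x)})" by (simp only: orbit_sites[OF s])
  finally show ?thesis .
qed

lemma loops_canonical: "loops V X = segments ` classes (sites V w) R"
proof (intro equalityI subsetI)
  fix \<gamma> assume "\<gamma> \<in> loops V X"
  then obtain \<sigma> where "\<sigma> \<in> V \<times> {0..<1} \<times> {-1, 1}" "\<gamma> = trajectory X \<sigma>"
    unfolding loops_def by blast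
  moreover obtain x a d where "\<sigma> = (x, a, d)" by (cases \<sigma>)
  ultimately have xad: "x \<in> V" "0 \<le> a" "a < 1" "d \<in> {-1, 1}" and \<gamma>: "\<gamma> = trajectory X (x, a, d)"
    by auto
  obtain j v where j: "j \<le> k" "0 < v" "v \<le> 1" "a = pos k j d v" using pos_cases[OF xad(2,3,4)] .
  have "\<gamma> = segments (glued R `` {(j, x)})"
    unfolding \<gamma> by (rule trajectory_canonical[of j x d]) (use xad j in \<open>auto simp: arrives_def\<close>)
  then show "\<gamma> \<in> segments ` classes (sites V w) R"
    using j xad by (auto simp: classes_image)
next
  fix \<gamma> assume "\<gamma> \<in> segments ` classes (sites V w) R"
  then obtain j x where jx: "j \<le> k" "x \<in> V" and \<gamma>: "\<gamma> = segments (glued R `` {(j, x)})"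
    by (auto simp: classes_image)
  have "trajectory X (x, pos k j 1 1, 1) = \<gamma>"
    unfolding \<gamma> by (rule trajectory_canonical[of j x 1]) (use jx in \<open>auto intro!: arrivesI\<close>)
  then show "\<gamma> \<in> loops V X" using jx pos_range[of k j 1 1] by (auto simp: loops_def)
qed

text \<open>Distinct classes share endpoints of intervals, at the marks; midpoints tell them apart.\<close>

lemma segments_mid:
  assumes C: "C \<subseteq> sites V w" and j: "j \<le> k"
  shows "(x, pos k j 1 (1/2)) \<in> segments C \<longleftrightarrow> (j, x) \<in> C"
proof
  assume "(x, pos k j 1 (1/2)) \<in> segments C"
  then obtain i v where i: "(i, x) \<in> C" "0 \<le> v" "v \<le> 1" and eq: "pos k j 1 (1/2) = pos k i 1 v"
    by (auto simp: segments_def)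
  have ik: "i \<le> k" using i(1) C by auto
  have mid: "pos k j 1 (1/2) = (real j + 1/2) / real (Suc k)" using pos_inside[OF j, of 1 "1/2"] by simp
  have "i = j"
  proof -
    consider "v = 0" | "v = 1" | "0 < v" "v < 1" using i by linarith
    then show ?thesis
    proof cases
      case 1
      have "pos k i 1 0 = real i / real (Suc k)"
        using pos_turn[of "-1" k i] pos_end[OF ik, of "-1"] by simp
      then have "real j + 1/2 = real i" using eq mid 1 by (simp del: of_nat_Suc)
      then have "real (2 * j + 1) = real (2 * i)" by simp
      then have "2 * j + 1 = 2 * i" by (simp only: of_nat_eq_iff)
      then show ?thesis by presburger
    next
      case 2
      show ?thesis
      proof (cases "i < k")
        case True
        then have "real j + 1/2 = real (Suc i)" using eq mid 2 pos_end[OF ik, of 1] by (simp del: of_nat_Suc)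
        then have "real (2 * j + 1) = real (2 * Suc i)" by simp
        then have "2 * j + 1 = 2 * Suc i" by (simp only: of_nat_eq_iff)
        then show ?thesis by presburger
      next
        case False
        then have "(real j + 1/2) / real (Suc k) = 0" using eq mid 2 pos_end[OF ik, of 1] by simp
        then have "real j + 1/2 = 0" by (simp del: of_nat_Suc)
        then show ?thesis by linarith
      qed
    next
      case 3
      then have "real j + 1/2 = real i + v" using eq mid pos_inside[OF ik, of 1 v] by (simp del: of_nat_Suc)
      then have "real i < real (Suc j)" "real j < real (Suc i)" using 3 by simp_all
      then show ?thesis by (simp only: of_nat_less_iff)
    qed
  qed
  then show "(j, x) \<in> C" using i by simp
qed (force simp: segments_def)

lemma class_subset: "C \<in> classes (sites V w) R \<Longrightarrow> C \<subseteq> sites V w"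
  using glued_in[OF R_subset] by (auto simp: classes_image)

lemma card_loops_canonical: "card (loops V X) = word_loops V w"
proof -
  have "inj_on segments (classes (sites V w) R)"
  proof (rule inj_onI)
    fix C D assume *: "C \<in> classes (sites V w) R" "D \<in> classes (sites V w) R" "segments C = segments D"
    have "p \<in> C \<longleftrightarrow> p \<in> D" for p
    proof (cases "fst p \<le> k")
      case True
      then show ?thesis
        using segments_mid[OF class_subset[OF *(1)] True, of "snd p"]
          segments_mid[OF class_subset[OF *(2)] True, of "snd p"] *(3) by simp
    next
      case False
      then have "p \<notin> sites V w" by auto
      then show ?thesis using class_subset[OF *(1)] class_subset[OF *(2)] by blast
    qed
    then show "C = D" by blast
  qed
  then show ?thesis unfolding loops_canonical word_loops_def by (rule card_image)
qed

lemma vertex_support_segments: "vertex_support (segments C) = snd ` C"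
  by (force simp: vertex_support_def segments_def)

lemma loop_through:
  assumes x: "x \<in> V"
  obtains \<gamma> where "\<gamma> \<in> loops V X" "finite (vertex_support \<gamma>)"
    "{y \<in> V. ((0, x), (0, y)) \<in> glued R} \<subseteq> vertex_support \<gamma>"
proof -
  let ?C = "glued R `` {(0, x)}"
  have C: "?C \<in> classes (sites V w) R" using x by (auto simp: classes_image)
  have "finite ?C"
    using finite_V by (intro finite_subset[OF class_subset[OF C]]) auto
  moreover have "{y \<in> V. ((0, x), (0, y)) \<in> glued R} \<subseteq> snd ` ?C" by force
  ultimately show thesis
    using that[of "segments ?C"] C unfolding loops_canonical vertex_support_segments by blast
qed

end

section \<open>Changes of time\<close>

definition retime :: "(real \<Rightarrow> real) \<Rightarrow> 'v config \<Rightarrow> 'v config" where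
  "retime \<phi> X = (\<lambda>(e, s, m). (e, \<phi> s, m)) ` X"

definition timed :: "'v config \<Rightarrow> bool" where
  "timed X \<longleftrightarrow> (\<forall>(e, s, m)\<in>X. 0 \<le> s \<and> s < 1)"

text \<open>Increasing bijections of \<open>[0,1)\<close>: orientation preserving homeomorphisms of the circle that fix
  \<open>0\<close>.\<close>

definition time_change :: "(real \<Rightarrow> real) \<Rightarrow> bool" where
  "time_change \<phi> \<longleftrightarrow> strict_mono_on {0..<1} \<phi> \<and> \<phi> ` {0..<1} = {0..<1}"

lemma time_change_range: "time_change \<phi> \<Longrightarrow> 0 \<le> s \<Longrightarrow> s < 1 \<Longrightarrow> 0 \<le> \<phi> s \<and> \<phi> s < 1"
  unfolding time_change_def by (metis atLeastLessThan_iff imageI)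

lemma time_change_less: "time_change \<phi> \<Longrightarrow> 0 \<le> a \<Longrightarrow> a < b \<Longrightarrow> b < 1 \<Longrightarrow> \<phi> a < \<phi> b"
  by (auto simp: time_change_def strict_mono_on_def)

lemma time_change_inj: "time_change \<phi> \<Longrightarrow> inj_on \<phi> {0..<1}"
  unfolding time_change_def by (blast intro: strict_mono_on_imp_inj_on)

lemma time_change_id: "time_change (\<lambda>s. s)"
  by (simp add: time_change_def strict_mono_on_def)

lemma time_change_comp:
  assumes "time_change \<phi>" "time_change \<psi>" shows "time_change (\<lambda>s. \<psi> (\<phi> s))"
proof -
  have "(\<lambda>s. \<psi> (\<phi> s)) ` {0..<1} = \<psi> ` (\<phi> ` {0..<1})" by (simp add: image_image)
  then show ?thesis
    using assms time_change_range[OF assms(1)] by (auto simp: time_change_def strict_mono_on_def)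
qed

lemma time_change_inverse:
  assumes \<phi>: "time_change \<phi>"
  obtains \<psi> where "time_change \<psi>" "\<And>s. 0 \<le> s \<Longrightarrow> s < 1 \<Longrightarrow> \<psi> (\<phi> s) = s" "\<And>s. 0 \<le> s \<Longrightarrow> s < 1 \<Longrightarrow> \<phi> (\<psi> s) = s"
proof -
  define \<psi> where "\<psi> = inv_into {0..<1} \<phi>"
  have im: "\<phi> ` {0..<1} = {0..<1}" using \<phi> by (simp add: time_change_def)
  have 1: "\<psi> (\<phi> s) = s" if "0 \<le> s" "s < 1" for s
    using that time_change_inj[OF \<phi>] by (simp add: \<psi>_def)
  have 2: "\<phi> (\<psi> s) = s" "0 \<le> \<psi> s" "\<psi> s < 1" if "0 \<le> s" "s < 1" for s
    using that im f_inv_into_f[of s \<phi> "{0..<1}"] inv_into_into[of s \<phi> "{0..<1}"] by (auto simp: \<psi>_def)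
  have "strict_mono_on {0..<1} \<psi>"
  proof (rule strict_mono_onI)
    fix a b :: real assume ab: "a \<in> {0..<1}" "b \<in> {0..<1}" "a < b"
    show "\<psi> a < \<psi> b"
    proof (rule ccontr)
      assume "\<not> \<psi> a < \<psi> b"
      then consider "\<psi> b < \<psi> a" | "\<psi> b = \<psi> a" by linarith
      then have "b \<le> a"
      proof cases
        case 1
        then have "\<phi> (\<psi> b) < \<phi> (\<psi> a)" using ab 2[of a] 2[of b] by (intro time_change_less[OF \<phi>]) auto
        then show ?thesis using ab 2[of a] 2[of b] by simp
      next
        case 2
        then show ?thesis using ab \<open>\<And>s. 0 \<le> s \<Longrightarrow> s < 1 \<Longrightarrow> \<phi> (\<psi> s) = s\<close> by (metis atLeastLessThan_iff order_refl)
      qed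
      then show False using ab by simp
    qed
  qed
  moreover have "\<psi> ` {0..<1} = {0..<1}"
  proof (intro equalityI subsetI)
    fix s assume "s \<in> {0..<1::real}"
    then have "s = \<psi> (\<phi> s)" "\<phi> s \<in> {0..<1}" using 1 time_change_range[OF \<phi>] by auto
    then show "s \<in> \<psi> ` {0..<1}" by blast
  qed (use 2 in auto)
  ultimately show thesis using that[of \<psi>] 1 2(1) by (auto simp: time_change_def)
qed

text \<open>The lift to the real line, which commutes with the translation by \<open>1\<close>. A motion may go around the
  circle several times; on the line its duration is still a difference of end points.\<close>

definition lift :: "(real \<Rightarrow> real) \<Rightarrow> real \<Rightarrow> real" where
  "lift \<phi> z = of_int \<lfloor>z\<rfloor> + \<phi> (frac z)"

lemma lift_floor:
  assumes "time_change \<phi>" shows "\<lfloor>lift \<phi> z\<rfloor> = \<lfloor>z\<rfloor>" and "frac (lift \<phi> z) = \<phi> (frac z)"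
proof -
  have r: "0 \<le> \<phi> (frac z)" "\<phi> (frac z) < 1"
    using time_change_range[OF assms, of "frac z"] by (auto simp: frac_lt_1)
  show fl: "\<lfloor>lift \<phi> z\<rfloor> = \<lfloor>z\<rfloor>" unfolding lift_def using r by (intro floor_unique) auto
  show "frac (lift \<phi> z) = \<phi> (frac z)" unfolding frac_def[of "lift \<phi> z"] fl by (simp add: lift_def)
qed

lemma lift_less:
  assumes \<phi>: "time_change \<phi>" and "a < b" shows "lift \<phi> a < lift \<phi> b"
proof (cases "\<lfloor>a\<rfloor> = \<lfloor>b\<rfloor>")
  case True
  then have "frac a < frac b" using assms by (simp add: frac_def)
  then show ?thesis unfolding lift_def True
    using time_change_less[OF \<phi>, of "frac a" "frac b"] by (simp add: frac_lt_1)
next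
  case False
  then have "\<lfloor>a\<rfloor> + 1 \<le> \<lfloor>b\<rfloor>" using assms floor_mono[of a b] by linarith
  then have "of_int \<lfloor>a\<rfloor> + 1 \<le> (of_int \<lfloor>b\<rfloor> :: real)" by linarith
  moreover have "\<phi> (frac a) < 1" "0 \<le> \<phi> (frac b)"
    using time_change_range[OF \<phi>] by (auto simp: frac_lt_1)
  ultimately show ?thesis unfolding lift_def by linarith
qed

lemma lift_surj:
  assumes \<phi>: "time_change \<phi>" obtains z where "lift \<phi> z = y"
proof -
  have "frac y \<in> \<phi> ` {0..<1}" using \<phi> by (simp add: time_change_def frac_lt_1)
  then obtain s where s: "0 \<le> s" "s < 1" "\<phi> s = frac y" by auto
  have fl: "\<lfloor>of_int \<lfloor>y\<rfloor> + s\<rfloor> = \<lfloor>y\<rfloor>" using s by (intro floor_unique) auto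
  have "frac (of_int \<lfloor>y\<rfloor> + s) = s" unfolding frac_def fl by simp
  then have "lift \<phi> (of_int \<lfloor>y\<rfloor> + s) = y" unfolding lift_def fl using s by (simp add: frac_def)
  then show thesis by (rule that)
qed

lemma lift_unit: "0 \<le> s \<Longrightarrow> s < 1 \<Longrightarrow> lift \<phi> s = \<phi> s"
proof -
  assume s: "0 \<le> s" "s < 1"
  then have "\<lfloor>s\<rfloor> = 0" by (intro floor_unique) auto
  then show ?thesis by (simp add: lift_def frac_def)
qed

lemma retime_mem:
  assumes \<phi>: "time_change \<phi>" and X: "timed X" and s: "0 \<le> s" "s < 1"
  shows "(e, \<phi> s, m) \<in> retime \<phi> X \<longleftrightarrow> (e, s, m) \<in> X"
proof
  assume "(e, \<phi> s, m) \<in> retime \<phi> X"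
  then obtain s' where s': "(e, s', m) \<in> X" "\<phi> s' = \<phi> s" by (auto simp: retime_def)
  then have "s' = s" using inj_onD[OF time_change_inj[OF \<phi>], of s' s] s X by (auto simp: timed_def)
  then show "(e, s, m) \<in> X" using s' by simp
qed (force simp: retime_def)

lemma retime_marked:
  assumes "time_change \<phi>" "timed X" "0 \<le> s" "s < 1"
  shows "marked (retime \<phi> X) x (\<phi> s) \<longleftrightarrow> marked X x s"
  unfolding marked_def retime_mem[OF assms] ..

lemma timed_retime: "time_change \<phi> \<Longrightarrow> timed X \<Longrightarrow> timed (retime \<phi> X)"
  using time_change_range by (force simp: timed_def retime_def)

definition retime_state :: "(real \<Rightarrow> real) \<Rightarrow> 'v state \<Rightarrow> 'v state" where
  "retime_state \<phi> = (\<lambda>(x, s, d). (x, \<phi> s, d))"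

definition proper :: "'v state \<Rightarrow> bool" where
  "proper = (\<lambda>(x, s, d). 0 \<le> s \<and> s < 1 \<and> d \<in> {-1, 1})"

lemma jump_proper: "jump X \<sigma> \<tau> \<Longrightarrow> proper \<sigma> \<Longrightarrow> proper \<tau>"
  by (auto elim!: jump.cases simp: proper_def)

lemma step_proper: "step X \<sigma> \<tau> \<Longrightarrow> proper \<sigma> \<Longrightarrow> proper \<tau>"
  by (erule step.cases) (auto dest!: jump_proper simp: proper_def frac_lt_1)

lemma retime_jump:
  assumes \<phi>: "time_change \<phi>" and X: "timed X" and p: "proper \<sigma>" and j: "jump X \<sigma> \<tau>"
  shows "jump (retime \<phi> X) (retime_state \<phi> \<sigma>) (retime_state \<phi> \<tau>)"
  using j
proof cases
  case (cross x y s d)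
  then have "({x, y}, \<phi> s, Cross) \<in> retime \<phi> X" using retime_mem[OF \<phi> X] p by (simp add: proper_def)
  then show ?thesis unfolding cross retime_state_def by (simp add: jump.cross)
next
  case (bar x y s d)
  then have "({x, y}, \<phi> s, Bar) \<in> retime \<phi> X" using retime_mem[OF \<phi> X] p by (simp add: proper_def)
  then show ?thesis unfolding bar retime_state_def by (simp add: jump.bar)
next
  case (unmarked x s d)
  then have "\<not> marked (retime \<phi> X) x (\<phi> s)" using retime_marked[OF \<phi> X] p by (simp add: proper_def)
  then show ?thesis unfolding unmarked retime_state_def by (simp add: jump.unmarked)
qed

text \<open>The duration of the new step is the distance between the lifted end points.\<close>

lemma retime_step:
  assumes \<phi>: "time_change \<phi>" and X: "timed X" and p: "proper \<sigma>" and st: "step X \<sigma> \<tau>"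
  shows "step (retime \<phi> X) (retime_state \<phi> \<sigma>) (retime_state \<phi> \<tau>)"
  using st
proof cases
  case (1 x s d r)
  have s: "0 \<le> s" "s < 1" and d: "d = -1 \<or> d = 1" using jump_proper[OF 1(2) p] by (auto simp: proper_def)
  define r' where "r' = d * (lift \<phi> (s + d * r) - lift \<phi> s)"
  have r': "0 < r'" unfolding r'_def using d 1(3) lift_less[OF \<phi>, of s "s + r"] lift_less[OF \<phi>, of "s - r" s] by auto
  have dr: "\<phi> s + d * r' = lift \<phi> (s + d * r)" unfolding r'_def using d by (auto simp: lift_unit[OF s])
  have "step (retime \<phi> X) (retime_state \<phi> \<sigma>) (x, frac (\<phi> s + d * r'), d)"
  proof (rule step.intros[OF _ r'])
    show "jump (retime \<phi> X) (retime_state \<phi> \<sigma>) (x, \<phi> s, d)"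
      using retime_jump[OF \<phi> X p 1(2)] by (simp add: retime_state_def)
    fix q' assume q': "0 < q'" "q' < r'"
    obtain z where z: "lift \<phi> z = \<phi> s + d * q'" using lift_surj[OF \<phi>] .
    define q where "q = d * (z - s)"
    have zq: "z = s + d * q" using d by (auto simp: q_def)
    have "0 < q"
    proof (rule ccontr)
      assume n: "\<not> 0 < q"
      have "0 \<le> d * (lift \<phi> s - lift \<phi> z)"
        using n d lift_less[OF \<phi>, of s z] lift_less[OF \<phi>, of z s] unfolding q_def
        by (cases z s rule: linorder_cases) auto
      then show False using q' d by (auto simp: z lift_unit[OF s])
    qed
    moreover have "q < r"
    proof (rule ccontr)
      assume n: "\<not> q < r"
      have "0 \<le> d * (lift \<phi> z - lift \<phi> (s + d * r))"
        using n d lift_less[OF \<phi>, of "s + d * r" z] lift_less[OF \<phi>, of z "s + d * r"] unfolding q_def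
        by (cases z "s + d * r" rule: linorder_cases) auto
      then show False using q' d by (auto simp: z dr[symmetric])
    qed
    ultimately have "\<not> marked X x (frac z)" using 1(4) zq by simp
    then have "\<not> marked (retime \<phi> X) x (\<phi> (frac z))"
      using retime_marked[OF \<phi> X, of "frac z" x] by (simp add: frac_lt_1)
    then show "\<not> marked (retime \<phi> X) x (frac (\<phi> s + d * q'))"
      using lift_floor(2)[OF \<phi>, of z] z by simp
  qed
  then show ?thesis unfolding dr lift_floor(2)[OF \<phi>] 1(1) by (simp add: retime_state_def)
qed

lemma steps_proper: "(step X)\<^sup>*\<^sup>* \<sigma> \<tau> \<Longrightarrow> proper \<sigma> \<Longrightarrow> proper \<tau>"
  by (induction rule: rtranclp_induct) (auto intro: step_proper)

lemma retime_steps: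
  assumes \<phi>: "time_change \<phi>" and X: "timed X" and p: "proper \<sigma>" and st: "(step X)\<^sup>*\<^sup>* \<sigma> \<tau>"
  shows "(step (retime \<phi> X))\<^sup>*\<^sup>* (retime_state \<phi> \<sigma>) (retime_state \<phi> \<tau>)"
  using st
proof (induction rule: rtranclp_induct)
  case (step \<tau> \<tau>')
  then show ?case using retime_step[OF \<phi> X steps_proper[OF step.hyps(1) p]] by (meson rtranclp.rtrancl_into_rtrancl)
qed simp

abbreviation retime_point :: "(real \<Rightarrow> real) \<Rightarrow> 'v \<times> real \<Rightarrow> 'v \<times> real" where
  "retime_point \<phi> \<equiv> (\<lambda>(x, s). (x, \<phi> s))"

lemma trajectory_range:
  assumes p: "proper \<sigma>" and "(x, s) \<in> trajectory X \<sigma>" shows "0 \<le> s \<and> s < 1"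
proof -
  obtain d \<tau> where "(step X)\<^sup>*\<^sup>* \<sigma> \<tau>" "\<tau> = (x, s, d) \<or> jump X \<tau> (x, s, d)"
    using assms by (auto simp: trajectory_def)
  then have "proper (x, s, d)" using steps_proper p jump_proper by metis
  then show ?thesis by (simp add: proper_def)
qed

lemma trajectory_retime_subset:
  assumes \<phi>: "time_change \<phi>" and X: "timed X" and p: "proper \<sigma>"
  shows "retime_point \<phi> ` trajectory X \<sigma> \<subseteq> trajectory (retime \<phi> X) (retime_state \<phi> \<sigma>)"
proof
  fix p' assume "p' \<in> retime_point \<phi> ` trajectory X \<sigma>"
  then obtain x s where p': "p' = (x, \<phi> s)" and "(x, s) \<in> trajectory X \<sigma>" by auto
  then obtain d \<tau> where st: "(step X)\<^sup>*\<^sup>* \<sigma> \<tau>" and \<tau>: "\<tau> = (x, s, d) \<or> jump X \<tau> (x, s, d)"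
    by (auto simp: trajectory_def)
  have "retime_state \<phi> \<tau> = (x, \<phi> s, d) \<or> jump (retime \<phi> X) (retime_state \<phi> \<tau>) (x, \<phi> s, d)"
    using \<tau> retime_jump[OF \<phi> X steps_proper[OF st p], of "(x, s, d)"] by (auto simp: retime_state_def)
  then show "p' \<in> trajectory (retime \<phi> X) (retime_state \<phi> \<sigma>)"
    unfolding p' trajectory_def using retime_steps[OF \<phi> X p st] by blast
qed

text \<open>The inverse time change gives the reverse of \<open>trajectory_retime_subset\<close>.\<close>

lemma trajectory_retime:
  assumes \<phi>: "time_change \<phi>" and X: "timed X" and p: "proper \<sigma>"
  shows "trajectory (retime \<phi> X) (retime_state \<phi> \<sigma>) = retime_point \<phi> ` trajectory X \<sigma>"
proof (rule antisym[OF _ trajectory_retime_subset[OF assms]])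
  obtain \<psi> where \<psi>: "time_change \<psi>" and inv: "\<And>s. 0 \<le> s \<Longrightarrow> s < 1 \<Longrightarrow> \<psi> (\<phi> s) = s"
    "\<And>s. 0 \<le> s \<Longrightarrow> s < 1 \<Longrightarrow> \<phi> (\<psi> s) = s" using time_change_inverse[OF \<phi>] by metis
  have X': "retime \<psi> (retime \<phi> X) = X"
  proof -
    have "(case p of (e, s, m) \<Rightarrow> (e, \<psi> (\<phi> s), m)) = p" if "p \<in> X" for p
      using that X inv(1) by (auto simp: timed_def split: prod.split)
    then have "(\<lambda>p. case p of (e, s, m) \<Rightarrow> (e, \<psi> (\<phi> s), m)) ` X = X" by force
    then show ?thesis unfolding retime_def image_image by (simp add: case_prod_beta)
  qed
  have \<sigma>': "retime_state \<psi> (retime_state \<phi> \<sigma>) = \<sigma>"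
    using p inv(1) by (cases \<sigma>) (simp add: retime_state_def proper_def)
  have p': "proper (retime_state \<phi> \<sigma>)"
    using p time_change_range[OF \<phi>] by (cases \<sigma>) (simp add: retime_state_def proper_def)
  have sub: "retime_point \<psi> ` trajectory (retime \<phi> X) (retime_state \<phi> \<sigma>) \<subseteq> trajectory X \<sigma>"
    using trajectory_retime_subset[OF \<psi> timed_retime[OF \<phi> X] p'] unfolding X' \<sigma>' .
  show "trajectory (retime \<phi> X) (retime_state \<phi> \<sigma>) \<subseteq> retime_point \<phi> ` trajectory X \<sigma>"
  proof
    fix y assume y: "y \<in> trajectory (retime \<phi> X) (retime_state \<phi> \<sigma>)"
    obtain x s where xs: "y = (x, s)" by (cases y)
    have "0 \<le> s" "s < 1" using trajectory_range[OF p'] y unfolding xs by blast+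
    then have "y = retime_point \<phi> (retime_point \<psi> y)" using inv(2) xs by simp
    then show "y \<in> retime_point \<phi> ` trajectory X \<sigma>" using sub y by blast
  qed
qed

lemma loops_retime:
  assumes \<phi>: "time_change \<phi>" and X: "timed X"
  shows "loops V (retime \<phi> X) = (`) (retime_point \<phi>) ` loops V X"
proof -
  let ?S = "V \<times> {0..<1} \<times> {-1, 1::real}"
  have S: "retime_state \<phi> ` ?S = ?S"
  proof -
    have "retime_state \<phi> ` ?S = V \<times> \<phi> ` {0..<1} \<times> {-1, 1}"
    proof (intro equalityI subsetI)
      fix y assume "y \<in> V \<times> \<phi> ` {0..<1} \<times> {-1, 1::real}"
      then obtain x s d where "y = retime_state \<phi> (x, s, d)" "(x, s, d) \<in> ?S"
        by (auto simp: retime_state_def)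
      then show "y \<in> retime_state \<phi> ` ?S" by (rule image_eqI)
    qed (auto simp: retime_state_def)
    then show ?thesis using \<phi> by (simp add: time_change_def)
  qed
  have "loops V (retime \<phi> X) = trajectory (retime \<phi> X) ` retime_state \<phi> ` ?S"
    unfolding S loops_def ..
  also have "\<dots> = (\<lambda>\<sigma>. retime_point \<phi> ` trajectory X \<sigma>) ` ?S"
    unfolding image_image by (intro image_cong refl trajectory_retime[OF \<phi> X]) (auto simp: proper_def)
  also have "\<dots> = (`) (retime_point \<phi>) ` loops V X"
    by (simp add: loops_def image_image)
  finally show ?thesis .
qed

lemma card_loops_retime:
  assumes \<phi>: "time_change \<phi>" and X: "timed X"
  shows "card (loops V (retime \<phi> X)) = card (loops V X)"
proof -
  have "\<Union>(loops V X) \<subseteq> UNIV \<times> {0..<1}"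
  proof
    fix p assume "p \<in> \<Union>(loops V X)"
    then obtain \<sigma> where \<sigma>: "\<sigma> \<in> V \<times> {0..<1} \<times> {-1, 1}" "p \<in> trajectory X \<sigma>"
      unfolding loops_def by blast
    obtain x s where p: "p = (x, s)" by (cases p)
    have "proper \<sigma>" using \<sigma>(1) by (cases \<sigma>) (simp add: proper_def)
    then show "p \<in> UNIV \<times> {0..<1}" using trajectory_range[of \<sigma> x s X] \<sigma>(2) unfolding p by simp
  qed
  moreover have "inj_on (retime_point \<phi>) (UNIV \<times> {0..<1})"
    using time_change_inj[OF \<phi>] by (auto simp: inj_on_def)
  ultimately have "inj_on (retime_point \<phi>) (\<Union>(loops V X))" by (rule inj_on_subset[rotated])
  then have "inj_on ((`) (retime_point \<phi>)) (loops V X)" by (rule inj_on_image)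
  then show ?thesis unfolding loops_retime[OF assms] by (rule card_image)
qed

lemma vertex_support_retime: "vertex_support (retime_point \<phi> ` \<gamma>) = vertex_support \<gamma>"
proof -
  have "(x, \<phi> s) \<in> retime_point \<phi> ` \<gamma>" if "(x, s) \<in> \<gamma>" for x s
    using image_eqI[OF _ that, of "(x, \<phi> s)" "retime_point \<phi>"] by simp
  then show ?thesis by (auto simp: vertex_support_def)
qed

text \<open>The piecewise linear map that fixes \<open>[0, M]\<close> and \<open>1\<close> and takes \<open>p\<close> to \<open>q\<close>.\<close>

definition bend :: "real \<Rightarrow> real \<Rightarrow> real \<Rightarrow> real \<Rightarrow> real" where
  "bend M p q s = (if s \<le> M then s else if s \<le> p then M + (s - M) * ((q - M) / (p - M))
     else q + (s - p) * ((1 - q) / (1 - p)))"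

lemma bend_less:
  assumes M: "M < p" "p < 1" "M < q" "q < 1" and "a < b"
  shows "bend M p q a < bend M p q b"
proof -
  have c: "0 < (q - M) / (p - M)" "0 < (1 - q) / (1 - p)" using M by auto
  have mid: "M + (s - M) * ((q - M) / (p - M)) \<le> q" if "s \<le> p" for s
  proof -
    have "(s - M) * ((q - M) / (p - M)) \<le> (p - M) * ((q - M) / (p - M))"
      using that c by (intro mult_right_mono) auto
    then show ?thesis using M by simp
  qed
  have low: "M < M + (s - M) * ((q - M) / (p - M))" if "M < s" for s
    using that c by (simp del: times_divide_eq_right)
  have high: "q < q + (s - p) * ((1 - q) / (1 - p))" if "p < s" for s
    using that c by (simp del: times_divide_eq_right)
  consider "b \<le> M" | "a \<le> M" "M < b" "b \<le> p" | "a \<le> M" "p < b" | "M < a" "b \<le> p"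
    | "M < a" "a \<le> p" "p < b" | "p < a" using \<open>a < b\<close> by linarith
  then show ?thesis
  proof cases
    case 1 then show ?thesis using \<open>a < b\<close> by (simp add: bend_def)
  next
    case 2 then show ?thesis using low[of b] by (simp add: bend_def del: times_divide_eq_right)
  next
    case 3
    have "q < bend M p q b" using high[of b] 3 M by (simp add: bend_def del: times_divide_eq_right)
    moreover have "bend M p q a = a" using 3 by (simp add: bend_def)
    ultimately show ?thesis using 3 M by linarith
  next
    case 4 then show ?thesis using \<open>a < b\<close> c by (simp add: bend_def mult_strict_right_mono del: times_divide_eq_right)
  next
    case 5
    have "q < bend M p q b" using high[of b] 5 M by (simp add: bend_def del: times_divide_eq_right)
    moreover have "bend M p q a \<le> q" using mid[of a] 5 by (simp add: bend_def del: times_divide_eq_right)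
    ultimately show ?thesis by linarith
  next
    case 6 then show ?thesis using \<open>a < b\<close> M c by (simp add: bend_def mult_strict_right_mono del: times_divide_eq_right)
  qed
qed

lemma bend_bend:
  assumes M: "M < p" "p < 1" "M < q" "q < 1"
  shows "bend M q p (bend M p q s) = s"
proof -
  have b: "bend M p q M = M" "bend M p q p = q" using M by (auto simp: bend_def)
  note less = bend_less[OF M]
  consider "s \<le> M" | "M < s" "s \<le> p" | "p < s" by linarith
  then show ?thesis
  proof cases
    case 1 then show ?thesis by (simp add: bend_def)
  next
    case 2
    have "M < bend M p q s" using less[of M s] b 2 by simp
    moreover have "bend M p q s \<le> q" using less[of s p] b 2 by (cases "s = p") auto
    moreover have "bend M p q s = M + (s - M) * ((q - M) / (p - M))" using 2 by (simp add: bend_def)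
    ultimately show ?thesis using M unfolding bend_def[of M q p] by simp
  next
    case 3
    have "q < bend M p q s" using less[of p s] b 3 by simp
    moreover have "bend M p q s = q + (s - p) * ((1 - q) / (1 - p))" using 3 M by (simp add: bend_def)
    ultimately show ?thesis using M unfolding bend_def[of M q p] by simp
  qed
qed

lemma bend_time_change:
  assumes M: "0 \<le> M" "M < p" "p < 1" "M < q" "q < 1"
  shows "time_change (bend M p q)"
proof -
  have r: "0 \<le> bend M p q s \<and> bend M p q s < 1" if "0 \<le> s" "s < 1" "M < p" "p < 1" "M < q" "q < 1" for s p q
  proof -
    have "bend M p q 0 = 0" "bend M p q 1 = 1" using that M by (auto simp: bend_def)
    then show ?thesis using bend_less[OF that(3-6), of 0 s] bend_less[OF that(3-6), of s 1] that
      by (cases "s = 0") auto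
  qed
  have "bend M p q ` {0..<1} = {0..<1}"
  proof (intro equalityI subsetI)
    fix s assume s: "s \<in> {0..<1::real}"
    have "bend M p q (bend M q p s) = s" using M by (intro bend_bend) auto
    moreover have "bend M q p s \<in> {0..<1}" using r[of s q p] s M by auto
    ultimately show "s \<in> bend M p q ` {0..<1}" by (metis imageI)
  qed (use r M in auto)
  then show ?thesis using bend_less[of M p q] M by (simp add: time_change_def strict_mono_on_def)
qed

text \<open>Points are prescribed from left to right: composing with a \<open>bend\<close> corrects the image of the new,
  largest point and leaves the earlier ones alone.\<close>

lemma time_change_interpolation:
  assumes "finite A" "A \<subseteq> {0..<1}" "strict_mono_on A g" "g ` A \<subseteq> {0..<1}" "\<And>a. a \<in> A \<Longrightarrow> g a = 0 \<longleftrightarrow> a = 0"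
  shows "\<exists>\<phi>. time_change \<phi> \<and> (\<forall>a\<in>A. \<phi> a = g a)"
  using assms
proof (induction A rule: finite_linorder_max_induct)
  case empty
  then show ?case using time_change_id by blast
next
  case (insert b A)
  obtain \<phi> where \<phi>: "time_change \<phi>" "\<And>a. a \<in> A \<Longrightarrow> \<phi> a = g a"
    using insert by (auto simp: strict_mono_on_def)
  have b: "0 \<le> b" "b < 1" "0 \<le> g b" "g b < 1" using insert.prems by auto
  show ?case
  proof (cases "b = 0")
    case True
    then have "A = {}" using insert.hyps(2) insert.prems(1) by (metis atLeastLessThan_iff equals0I insertCI not_less subsetD)
    moreover have "g b = b" using insert.prems(4)[of b] True by simp
    ultimately show ?thesis using time_change_id by auto
  next
    case False
    define M where "M = Max (insert 0 (g ` A))"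
    have fin: "finite (insert 0 (g ` A))" using insert.hyps by simp
    have gA: "g a < g b" if "a \<in> A" for a
      using insert.prems(2) insert.hyps that by (auto simp: strict_mono_on_def)
    have "g b \<noteq> 0" using insert.prems(4)[of b] False by simp
    then have gb: "0 < g b" using b by linarith
    have pa: "g a < \<phi> b" if "a \<in> A" for a
      using time_change_less[OF \<phi>(1), of a b] \<phi>(2) insert that by auto
    have pb: "0 < \<phi> b" "\<phi> b < 1"
      using time_change_less[OF \<phi>(1), of 0 b] time_change_range[OF \<phi>(1), of 0] time_change_range[OF \<phi>(1), of b] b False by auto
    have M: "0 \<le> M" "M < \<phi> b" "M < g b"
      unfolding M_def using fin gb pb gA pa by auto
    have MA: "g a \<le> M" if "a \<in> A" for a unfolding M_def using fin that by simp
    have "time_change (\<lambda>s. bend M (\<phi> b) (g b) (\<phi> s))"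
      using M pb b by (intro time_change_comp[OF \<phi>(1)] bend_time_change) auto
    moreover have "bend M (\<phi> b) (g b) (\<phi> a) = g a" if "a \<in> A" for a
      using MA[OF that] \<phi>(2)[OF that] by (simp add: bend_def)
    moreover have "bend M (\<phi> b) (g b) (\<phi> b) = g b"
      using M by (simp add: bend_def)
    ultimately show ?thesis by auto
  qed
qed

text \<open>Two families of marks whose times are in the same order differ by a change of time.\<close>

lemma retime_families:
  fixes a b :: "'j \<Rightarrow> real"
  assumes J: "finite J" and a: "\<And>j. j \<in> J \<Longrightarrow> 0 \<le> a j \<and> a j < 1" and b: "\<And>j. j \<in> J \<Longrightarrow> 0 \<le> b j \<and> b j < 1"
    and ord: "\<And>i j. i \<in> J \<Longrightarrow> j \<in> J \<Longrightarrow> a i \<le> a j \<longleftrightarrow> b i \<le> b j"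
    and zero: "\<And>j. j \<in> J \<Longrightarrow> a j = 0 \<longleftrightarrow> b j = 0"
  shows "\<exists>\<phi>. time_change \<phi> \<and> (\<lambda>j. (e j, b j, m j)) ` J = retime \<phi> ((\<lambda>j. (e j, a j, m j)) ` J)"
proof -
  define g where "g = (\<lambda>x. b (SOME j. j \<in> J \<and> a j = x))"
  have g: "g (a j) = b j" if "j \<in> J" for j
  proof -
    define i where "i = (SOME i. i \<in> J \<and> a i = a j)"
    have "i \<in> J \<and> a i = a j"
      unfolding i_def by (rule someI[of _ j]) (use that in simp)
    then have "b i = b j" using ord[of i j] ord[of j i] that by simp
    then show ?thesis unfolding g_def i_def .
  qed
  have "\<exists>\<phi>. time_change \<phi> \<and> (\<forall>x\<in>a ` J. \<phi> x = g x)"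
  proof (rule time_change_interpolation)
    show "strict_mono_on (a ` J) g"
      by (rule strict_mono_onI) (use g ord in \<open>auto simp flip: not_le\<close>)
    show "g x = 0 \<longleftrightarrow> x = 0" if "x \<in> a ` J" for x using that g zero by auto
  qed (use J a b g in auto)
  then obtain \<phi> where "time_change \<phi>" "\<And>j. j \<in> J \<Longrightarrow> \<phi> (a j) = b j" using g by auto
  then show ?thesis by (intro exI[of _ \<phi>]) (auto simp: retime_def image_image)
qed

section \<open>Measurability, and words read off a sample\<close>

abbreviation mark_space :: "real \<Rightarrow> (real \<times> mark) measure" where
  "mark_space u \<equiv> circle \<Otimes>\<^sub>M measure_pmf (mark_pmf u)"

lemma space_circle: "space circle = {0..<1}"
  by (simp add: circle_def space_restrict_space)

lemma emeasure_circle: "A \<in> sets borel \<Longrightarrow> A \<subseteq> {0..<1} \<Longrightarrow> emeasure circle A = emeasure lborel A"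
  unfolding circle_def by (intro emeasure_restrict_space) auto

lemma prob_space_circle: "prob_space circle"
  by (rule prob_spaceI) (simp add: space_circle emeasure_circle)

lemma prob_space_mark_space: "prob_space (mark_space u)"
proof -
  interpret C: prob_space circle by (rule prob_space_circle)
  interpret pair_prob_space circle "measure_pmf (mark_pmf u)" ..
  show ?thesis by unfold_locales
qed

lemma circle_borel [measurable]: "(\<lambda>x. x) \<in> circle \<rightarrow>\<^sub>M borel"
  unfolding circle_def by (rule measurable_restrict_space1) simp

definition time_of :: "'v sample \<Rightarrow> 'v set \<times> nat \<Rightarrow> real" where
  "time_of \<omega> j = fst (snd (\<omega> (fst j)) (snd j))"

definition mark_of :: "'v sample \<Rightarrow> 'v set \<times> nat \<Rightarrow> mark" where
  "mark_of \<omega> j = snd (snd (\<omega> (fst j)) (snd j))"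

definition mark_indices :: "'v set set \<Rightarrow> ('v set \<Rightarrow> nat) \<Rightarrow> ('v set \<times> nat) set" where
  "mark_indices E \<nu> = (SIGMA e:E. {..<\<nu> e})"

lemma finite_mark_indices: "finite E \<Longrightarrow> finite (mark_indices E \<nu>)"
  by (simp add: mark_indices_def)

lemma config_image:
  "config E \<omega> = (\<lambda>j. (fst j, time_of \<omega> j, mark_of \<omega> j)) ` mark_indices E (\<lambda>e. fst (\<omega> e))"
proof (intro equalityI subsetI)
  fix p assume "p \<in> config E \<omega>"
  then obtain e s m i where "p = (e, s, m)" "e \<in> E" "i < fst (\<omega> e)" "(s, m) = snd (\<omega> e) i"
    by (auto simp: config_def points_def)
  then have "p = (fst (e, i), time_of \<omega> (e, i), mark_of \<omega> (e, i))" "(e, i) \<in> mark_indices E (\<lambda>e. fst (\<omega> e))"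
    by (auto simp: time_of_def mark_of_def mark_indices_def dest: sym)
  then show "p \<in> (\<lambda>j. (fst j, time_of \<omega> j, mark_of \<omega> j)) ` mark_indices E (\<lambda>e. fst (\<omega> e))"
    by blast
next
  fix p assume "p \<in> (\<lambda>j. (fst j, time_of \<omega> j, mark_of \<omega> j)) ` mark_indices E (\<lambda>e. fst (\<omega> e))"
  then obtain e i where "e \<in> E" "i < fst (\<omega> e)" "p = (e, snd (\<omega> e) i)"
    by (auto simp: mark_indices_def time_of_def mark_of_def)
  moreover obtain s m where sm: "snd (\<omega> e) i = (s, m)" by (cases "snd (\<omega> e) i")
  moreover have "(s, m) \<in> points (\<omega> e)"
    unfolding points_def sm[symmetric] using calculation(2) by simp
  ultimately show "p \<in> config E \<omega>" by (simp add: config_def)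
qed

lemma space_mark_law:
  assumes "\<omega> \<in> space (mark_law E t u)" "e \<in> E"
  shows "0 \<le> time_of \<omega> (e, i) \<and> time_of \<omega> (e, i) < 1"
proof -
  have "\<omega> e \<in> space (poisson_process t (mark_space u))"
    using assms by (auto simp: mark_law_def space_PiM)
  then have "snd (\<omega> e) \<in> UNIV \<rightarrow>\<^sub>E space (mark_space u)"
    by (simp add: poisson_process_def space_pair_measure space_PiM mem_Times_iff)
  then have "snd (\<omega> e) i \<in> space (mark_space u)" by (rule PiE_mem) simp
  then show ?thesis by (auto simp: time_of_def space_pair_measure space_circle)
qed

lemma timed_config: "\<omega> \<in> space (mark_law E t u) \<Longrightarrow> timed (config E \<omega>)"
  unfolding timed_def config_image using space_mark_law by (fastforce simp: mark_indices_def)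

lemma count_measurable:
  assumes "e \<in> E" shows "(\<lambda>\<omega>. fst (\<omega> e)) \<in> mark_law E t u \<rightarrow>\<^sub>M count_space UNIV"
proof -
  have "(\<lambda>\<omega>. \<omega> e) \<in> mark_law E t u \<rightarrow>\<^sub>M poisson_process t (mark_space u)"
    unfolding mark_law_def using assms by (rule measurable_component_singleton)
  moreover have "fst \<in> poisson_process t (mark_space u) \<rightarrow>\<^sub>M count_space UNIV"
    unfolding poisson_process_def by measurable
  ultimately show ?thesis by (rule measurable_compose)
qed

lemma point_measurable:
  assumes "e \<in> E" shows "(\<lambda>\<omega>. snd (\<omega> e) i) \<in> mark_law E t u \<rightarrow>\<^sub>M mark_space u"
proof -
  have 1: "(\<lambda>\<omega>. \<omega> e) \<in> mark_law E t u \<rightarrow>\<^sub>M poisson_process t (mark_space u)"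
    unfolding mark_law_def using assms by (rule measurable_component_singleton)
  have 2: "snd \<in> poisson_process t (mark_space u) \<rightarrow>\<^sub>M (\<Pi>\<^sub>M k\<in>UNIV. mark_space u)"
    unfolding poisson_process_def by (rule measurable_snd)
  have 3: "(\<lambda>x. x i) \<in> (\<Pi>\<^sub>M k\<in>(UNIV :: nat set). mark_space u) \<rightarrow>\<^sub>M mark_space u"
    by (rule measurable_component_singleton) simp
  show ?thesis by (rule measurable_compose[OF measurable_compose[OF 1 2] 3])
qed

lemma time_circle_measurable:
  "e \<in> E \<Longrightarrow> (\<lambda>\<omega>. time_of \<omega> (e, i)) \<in> mark_law E t u \<rightarrow>\<^sub>M circle"
  unfolding time_of_def fst_conv snd_conv
  by (rule measurable_compose[OF point_measurable measurable_fst])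

lemma time_measurable:
  "e \<in> E \<Longrightarrow> (\<lambda>\<omega>. time_of \<omega> (e, i)) \<in> borel_measurable (mark_law E t u)"
  using measurable_compose[OF time_circle_measurable circle_borel] .

lemma mark_measurable:
  "e \<in> E \<Longrightarrow> (\<lambda>\<omega>. mark_of \<omega> (e, i)) \<in> mark_law E t u \<rightarrow>\<^sub>M count_space UNIV"
  unfolding mark_of_def fst_conv snd_conv
  using measurable_compose[OF point_measurable measurable_snd] by simp

text \<open>An event that is determined by finitely many measurable events is a finite union of their
  atoms.\<close>

lemma sets_of_finite_data:
  assumes B: "finite B" "\<And>P. P \<in> B \<Longrightarrow> {\<omega>\<in>space M. P \<omega>} \<in> sets M" and S: "S \<in> sets M"
    and det: "\<And>\<omega> \<omega>'. \<omega> \<in> S \<Longrightarrow> \<omega>' \<in> S \<Longrightarrow> (\<And>P. P \<in> B \<Longrightarrow> P \<omega> \<longleftrightarrow> P \<omega>') \<Longrightarrow> Q \<omega> \<longleftrightarrow> Q \<omega>'"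
  shows "{\<omega>\<in>S. Q \<omega>} \<in> sets M"
proof -
  let ?cell = "\<lambda>D. {\<omega>\<in>S. \<forall>P\<in>B. P \<omega> \<longleftrightarrow> P \<in> D}"
  let ?D = "(\<lambda>\<omega>. {P\<in>B. P \<omega>}) ` {\<omega>\<in>S. Q \<omega>}"
  have eq: "{\<omega>\<in>S. Q \<omega>} = (\<Union>D\<in>?D. ?cell D)"
  proof (intro equalityI subsetI)
    fix \<omega> assume "\<omega> \<in> (\<Union>D\<in>?D. ?cell D)"
    then obtain \<omega>' where "\<omega>' \<in> S" "Q \<omega>'" "\<omega> \<in> ?cell {P\<in>B. P \<omega>'}" by blast
    then show "\<omega> \<in> {\<omega>\<in>S. Q \<omega>}" using det[of \<omega> \<omega>'] by blast
  qed blast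
  have cell: "?cell D \<in> sets M" for D
  proof -
    have "?cell D = S \<inter> (\<Inter>P\<in>B. if P \<in> D then {\<omega>\<in>space M. P \<omega>} else space M - {\<omega>\<in>space M. P \<omega>}) \<inter> S"
      using sets.sets_into_space[OF S] by (auto split: if_splits)
    also have "\<dots> \<in> sets M"
    proof (cases "B = {}")
      case False
      then have "(\<Inter>P\<in>B. if P \<in> D then {\<omega>\<in>space M. P \<omega>} else space M - {\<omega>\<in>space M. P \<omega>}) \<in> sets M"
        using B by (intro sets.finite_INT) auto
      then show ?thesis using S by auto
    qed (use S in simp)
    finally show ?thesis .
  qed
  have "finite ?D" using B(1) by (intro finite_subset[of ?D "Pow B"]) auto
  then show ?thesis by (subst eq) (intro sets.finite_UN cell)
qed

text \<open>For given numbers of marks on the edges, a property that is invariant under changes of time is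
  determined by the types of the marks, by the order of their times and by which times equal \<open>0\<close>.
  The order may have ties: samples with simultaneous marks form a null set, but a measurable event has
  to be decided on them too.\<close>

lemma measurable_retime_invariant:
  fixes Q :: "'v sample \<Rightarrow> bool"
  assumes E: "finite E"
    and inv: "\<And>\<omega> \<omega>' \<phi>. \<omega> \<in> space (mark_law E t u) \<Longrightarrow> time_change \<phi> \<Longrightarrow>
      config E \<omega>' = retime \<phi> (config E \<omega>) \<Longrightarrow> Q \<omega>' \<longleftrightarrow> Q \<omega>"
  shows "{\<omega>\<in>space (mark_law E t u). Q \<omega>} \<in> sets (mark_law E t u)"
proof -
  let ?M = "mark_law E t u"
  let ?S = "\<lambda>\<nu>. {\<omega>\<in>space ?M. \<forall>e\<in>E. fst (\<omega> e) = \<nu> e}"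
  let ?N = "E \<rightarrow>\<^sub>E (UNIV :: nat set)"
  have "{\<omega>\<in>space ?M. Q \<omega>} = (\<Union>\<nu>\<in>?N. {\<omega>\<in>?S \<nu>. Q \<omega>})"
  proof (intro equalityI subsetI)
    fix \<omega> assume \<omega>: "\<omega> \<in> {\<omega>\<in>space ?M. Q \<omega>}"
    then have "\<omega> \<in> {\<omega>\<in>?S (\<lambda>e\<in>E. fst (\<omega> e)). Q \<omega>}" by simp
    moreover have "(\<lambda>e\<in>E. fst (\<omega> e)) \<in> ?N" by simp
    ultimately show "\<omega> \<in> (\<Union>\<nu>\<in>?N. {\<omega>\<in>?S \<nu>. Q \<omega>})" by blast
  qed auto
  moreover have "countable ?N" using E by (intro countable_PiE) auto
  moreover have "{\<omega>\<in>?S \<nu>. Q \<omega>} \<in> sets ?M" for \<nu>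
  proof -
    let ?J = "mark_indices E \<nu>"
    have JE: "fst j \<in> E" if "j \<in> ?J" for j using that by (auto simp: mark_indices_def)
    define B where "B = (\<lambda>(i, j) \<omega>. time_of \<omega> i \<le> time_of \<omega> j) ` (?J \<times> ?J) \<union>
      (\<lambda>j \<omega>. time_of \<omega> j = 0) ` ?J \<union> (\<lambda>j \<omega>. mark_of \<omega> j = Cross) ` ?J"
    have tm: "(\<lambda>\<omega>. time_of \<omega> j) \<in> borel_measurable ?M" if "j \<in> ?J" for j
      using time_measurable[OF JE[OF that], of "snd j"] by simp
    have mm: "(\<lambda>\<omega>. mark_of \<omega> j) \<in> ?M \<rightarrow>\<^sub>M count_space UNIV" if "j \<in> ?J" for j
      using mark_measurable[OF JE[OF that], of "snd j"] by simp
    show ?thesis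
    proof (rule sets_of_finite_data[of B])
      show "finite B" using finite_mark_indices[OF E] by (simp add: B_def)
      have "?S \<nu> = space ?M \<inter> (\<Inter>e\<in>E. (\<lambda>\<omega>. fst (\<omega> e)) -` {\<nu> e} \<inter> space ?M)" by auto
      also have "\<dots> \<in> sets ?M"
      proof (cases "E = {}")
        case False
        then have "(\<Inter>e\<in>E. (\<lambda>\<omega>. fst (\<omega> e)) -` {\<nu> e} \<inter> space ?M) \<in> sets ?M"
          using E by (intro sets.finite_INT measurable_sets[OF count_measurable]) auto
        then show ?thesis by auto
      qed simp
      finally show "?S \<nu> \<in> sets ?M" .
      fix P assume "P \<in> B"
      then consider i j where "i \<in> ?J" "j \<in> ?J" "P = (\<lambda>\<omega>. time_of \<omega> i \<le> time_of \<omega> j)"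
        | j where "j \<in> ?J" "P = (\<lambda>\<omega>. time_of \<omega> j = 0)" | j where "j \<in> ?J" "P = (\<lambda>\<omega>. mark_of \<omega> j = Cross)"
        by (auto simp: B_def)
      then show "{\<omega>\<in>space ?M. P \<omega>} \<in> sets ?M"
      proof cases
        case 1
        note [measurable] = tm[OF 1(1)] tm[OF 1(2)]
        show ?thesis unfolding 1 by measurable
      next
        case 2
        note [measurable] = tm[OF 2(1)]
        show ?thesis unfolding 2 by measurable
      next
        case 3
        have "{\<omega>\<in>space ?M. mark_of \<omega> j = Cross} = (\<lambda>\<omega>. mark_of \<omega> j) -` {Cross} \<inter> space ?M" by auto
        then show ?thesis unfolding 3 using measurable_sets[OF mm[OF 3(1)], of "{Cross}"] by simp
      qed
    next
      fix \<omega> \<omega>' assume \<omega>: "\<omega> \<in> ?S \<nu>" and \<omega>': "\<omega>' \<in> ?S \<nu>" and eq: "\<And>P. P \<in> B \<Longrightarrow> P \<omega> \<longleftrightarrow> P \<omega>'"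
      have idx: "mark_indices E (\<lambda>e. fst (\<omega> e)) = ?J" "mark_indices E (\<lambda>e. fst (\<omega>' e)) = ?J"
        using \<omega> \<omega>' by (auto simp: mark_indices_def)
      have ord: "time_of \<omega> i \<le> time_of \<omega> j \<longleftrightarrow> time_of \<omega>' i \<le> time_of \<omega>' j" if "i \<in> ?J" "j \<in> ?J" for i j
      proof -
        have "(\<lambda>\<omega>. time_of \<omega> i \<le> time_of \<omega> j) \<in> B" unfolding B_def using that by force
        from eq[OF this] show ?thesis .
      qed
      have zero: "time_of \<omega> j = 0 \<longleftrightarrow> time_of \<omega>' j = 0" if "j \<in> ?J" for j
      proof -
        have "(\<lambda>\<omega>. time_of \<omega> j = 0) \<in> B" unfolding B_def using that by force
        from eq[OF this] show ?thesis .
      qed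
      have marks: "mark_of \<omega> j = mark_of \<omega>' j" if "j \<in> ?J" for j
      proof -
        have "(\<lambda>\<omega>. mark_of \<omega> j = Cross) \<in> B" unfolding B_def using that by force
        from eq[OF this] show ?thesis by (cases "mark_of \<omega> j"; cases "mark_of \<omega>' j") auto
      qed
      have range: "0 \<le> time_of \<omega> j \<and> time_of \<omega> j < 1" "0 \<le> time_of \<omega>' j \<and> time_of \<omega>' j < 1" if "j \<in> ?J" for j
        using space_mark_law[of _ E t u "fst j" "snd j"] JE[OF that] \<omega> \<omega>' by simp_all
      have "\<exists>\<phi>. time_change \<phi> \<and> (\<lambda>j. (fst j, time_of \<omega>' j, mark_of \<omega> j)) ` ?J =
          retime \<phi> ((\<lambda>j. (fst j, time_of \<omega> j, mark_of \<omega> j)) ` ?J)"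
        by (rule retime_families) (use finite_mark_indices[OF E] range ord zero in auto)
      then obtain \<phi> where \<phi>: "time_change \<phi>" "(\<lambda>j. (fst j, time_of \<omega>' j, mark_of \<omega> j)) ` ?J = retime \<phi> (config E \<omega>)"
        unfolding config_image idx by blast
      have "config E \<omega>' = (\<lambda>j. (fst j, time_of \<omega>' j, mark_of \<omega> j)) ` ?J"
        unfolding config_image idx using marks by (intro image_cong) auto
      then have "config E \<omega>' = retime \<phi> (config E \<omega>)" using \<phi>(2) by simp
      from inv[OF _ \<phi>(1) this] \<omega> show "Q \<omega> \<longleftrightarrow> Q \<omega>'" by simp
    qed
  qed
  ultimately show ?thesis by (simp only: sets.countable_UN'')
qed

lemma num_loops_retime:
  assumes "time_change \<phi>" "timed (config E \<omega>)" "config E \<omega>' = retime \<phi> (config E \<omega>)"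
  shows "num_loops V E \<omega>' = num_loops V E \<omega>"
  unfolding num_loops_def assms(3) by (rule card_loops_retime[OF assms(1,2)])

lemma has_long_loop_retime:
  assumes "time_change \<phi>" "timed (config E \<omega>)" "config E \<omega>' = retime \<phi> (config E \<omega>)"
  shows "has_long_loop V E \<eta> \<omega>' \<longleftrightarrow> has_long_loop V E \<eta> \<omega>"
  unfolding has_long_loop_def assms(3) loops_retime[OF assms(1,2)]
  by (simp add: vertex_support_retime)

lemma num_loops_measurable:
  assumes "finite E" shows "num_loops V E \<in> mark_law E t u \<rightarrow>\<^sub>M count_space UNIV"
proof (rule measurable_count_space_eq2_countable[THEN iffD2], intro conjI ballI)
  fix m
  have "{\<omega>\<in>space (mark_law E t u). num_loops V E \<omega> = m} \<in> sets (mark_law E t u)"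
    by (rule measurable_retime_invariant[OF assms]) (use num_loops_retime timed_config in metis)
  then show "num_loops V E -` {m} \<inter> space (mark_law E t u) \<in> sets (mark_law E t u)"
    by (simp add: vimage_def Int_def conj_commute)
qed auto

lemma has_long_loop_sets:
  assumes "finite E"
  shows "{\<omega>\<in>space (mark_law E t u). has_long_loop V E \<eta> \<omega>} \<in> sets (mark_law E t u)"
  by (rule measurable_retime_invariant[OF assms]) (use has_long_loop_retime timed_config in metis)

text \<open>The map \<open>\<pi>\<close> lists the marks of the sample in increasing order of time, all times being positive and
  distinct, and \<open>w\<close> is the resulting word.\<close>

definition enumerates :: "'v set set \<Rightarrow> 'v letter list \<Rightarrow> (nat \<Rightarrow> 'v set \<times> nat) \<Rightarrow> 'v sample \<Rightarrow> bool" where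
  "enumerates E w \<pi> \<omega> \<longleftrightarrow> bij_betw \<pi> {..<length w} (mark_indices E (\<lambda>e. fst (\<omega> e))) \<and>
     (\<forall>i<length w. fst (\<pi> i) = fst (w ! i) \<and> mark_of \<omega> (\<pi> i) = snd (w ! i) \<and> 0 < time_of \<omega> (\<pi> i)) \<and>
     (\<forall>j<length w. \<forall>i<j. time_of \<omega> (\<pi> i) < time_of \<omega> (\<pi> j))"

lemma enumerates_retime:
  assumes \<omega>: "\<omega> \<in> space (mark_law E t u)" and en: "enumerates E w \<pi> \<omega>"
  shows "\<exists>\<phi>. time_change \<phi> \<and> canonical w = retime \<phi> (config E \<omega>)"
proof -
  let ?k = "length w"
  have bij: "\<pi> ` {..<?k} = mark_indices E (\<lambda>e. fst (\<omega> e))"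
    using en by (simp add: enumerates_def bij_betw_def)
  have conf: "config E \<omega> = (\<lambda>i. (fst (w ! i), time_of \<omega> (\<pi> i), snd (w ! i))) ` {..<?k}"
    unfolding config_image bij[symmetric] image_image using en
    by (intro image_cong) (auto simp: enumerates_def)
  have can: "canonical w = (\<lambda>i. (fst (w ! i), real (Suc i) / real (Suc ?k), snd (w ! i))) ` {..<?k}"
    by (auto simp: canonical_def)
  have range: "0 \<le> time_of \<omega> (\<pi> i) \<and> time_of \<omega> (\<pi> i) < 1" if "i \<in> {..<?k}" for i
  proof -
    have "\<pi> i \<in> mark_indices E (\<lambda>e. fst (\<omega> e))" using that bij by blast
    then show ?thesis using space_mark_law[OF \<omega>, of "fst (\<pi> i)" "snd (\<pi> i)"] by (auto simp: mark_indices_def)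
  qed
  have less: "time_of \<omega> (\<pi> i) < time_of \<omega> (\<pi> j)" if "i < j" "j < ?k" for i j
    using en that by (auto simp: enumerates_def)
  have ord: "time_of \<omega> (\<pi> i) \<le> time_of \<omega> (\<pi> j) \<longleftrightarrow> i \<le> j" if "i < ?k" "j < ?k" for i j
    using less[of i j] less[of j i] that by (cases i j rule: linorder_cases) auto
  have pos: "0 < time_of \<omega> (\<pi> i)" if "i < ?k" for i using en that by (auto simp: enumerates_def)
  have ord': "real (Suc i) / real (Suc ?k) \<le> real (Suc j) / real (Suc ?k) \<longleftrightarrow> i \<le> j" for i j
    by (simp add: divide_le_cancel)
  show ?thesis
    unfolding conf can
  proof (rule retime_families)
    show "time_of \<omega> (\<pi> i) \<le> time_of \<omega> (\<pi> j) \<longleftrightarrow> real (Suc i) / real (Suc ?k) \<le> real (Suc j) / real (Suc ?k)"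
      if "i \<in> {..<?k}" "j \<in> {..<?k}" for i j
      unfolding ord' using ord that by simp
    show "0 \<le> real (Suc i) / real (Suc ?k) \<and> real (Suc i) / real (Suc ?k) < 1" if "i \<in> {..<?k}" for i
      using that by (simp add: divide_less_eq)
    show "time_of \<omega> (\<pi> i) = 0 \<longleftrightarrow> real (Suc i) / real (Suc ?k) = 0" if "i \<in> {..<?k}" for i
      using pos[of i] that by (simp del: of_nat_Suc)
  qed (use range in auto)
qed

lemma num_loops_word:
  assumes V: "finite V" and w: "set w \<subseteq> edge_letters V"
    and \<omega>: "\<omega> \<in> space (mark_law E t u)" and en: "enumerates E w \<pi> \<omega>"
  shows "num_loops V E \<omega> = word_loops V w"
proof -
  interpret loop_word V w using V w by unfold_locales
  obtain \<phi> where \<phi>: "time_change \<phi>" "canonical w = retime \<phi> (config E \<omega>)" using enumerates_retime[OF \<omega> en] by blast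
  show ?thesis
    using card_loops_canonical card_loops_retime[OF \<phi>(1) timed_config[OF \<omega>], of V]
    unfolding \<phi>(2) num_loops_def by simp
qed

lemma has_long_loop_word:
  assumes V: "finite V" and w: "set w \<subseteq> edge_letters V"
    and \<omega>: "\<omega> \<in> space (mark_law E t u)" and en: "enumerates E w \<pi> \<omega>" and x: "x \<in> V"
    and long: "\<eta> * real (card V) < real (card {y \<in> V. ((0, x), (0, y)) \<in> glued (closing V w no_mark)})"
  shows "has_long_loop V E \<eta> \<omega>"
proof -
  interpret loop_word V w using V w by unfold_locales
  obtain \<phi> where \<phi>: "time_change \<phi>" "canonical w = retime \<phi> (config E \<omega>)" using enumerates_retime[OF \<omega> en] by blast
  obtain \<gamma> where \<gamma>: "\<gamma> \<in> loops V (canonical w)" "finite (vertex_support \<gamma>)"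
    "{y \<in> V. ((0, x), (0, y)) \<in> glued (closing V w no_mark)} \<subseteq> vertex_support \<gamma>"
    using loop_through[OF x] by blast
  have "card {y \<in> V. ((0, x), (0, y)) \<in> glued (closing V w no_mark)} \<le> card (vertex_support \<gamma>)"
    by (rule card_mono[OF \<gamma>(2,3)])
  moreover obtain \<gamma>' where "\<gamma>' \<in> loops V (config E \<omega>)" "\<gamma> = retime_point \<phi> ` \<gamma>'"
    using \<gamma>(1) unfolding \<phi>(2) loops_retime[OF \<phi>(1) timed_config[OF \<omega>]] by blast
  ultimately show ?thesis
    using long unfolding has_long_loop_def by (intro bexI[of _ \<gamma>']) (auto simp: vertex_support_retime)
qed

section \<open>Order statistics and labellings\<close>

text \<open>The upper bound \<open>s\<close> is the variable in which the volume of the simplex is integrated.\<close>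

definition increasing_in :: "real \<Rightarrow> nat \<Rightarrow> (nat \<Rightarrow> 'j) \<Rightarrow> ('j \<Rightarrow> real) \<Rightarrow> bool" where
  "increasing_in s k \<pi> T \<longleftrightarrow> (\<forall>i<k. 0 < T (\<pi> i) \<and> T (\<pi> i) < s) \<and> (\<forall>j<k. \<forall>i<j. T (\<pi> i) < T (\<pi> j))"

lemma increasing_in_Suc:
  "increasing_in s (Suc k) \<pi> T \<longleftrightarrow> 0 < T (\<pi> k) \<and> T (\<pi> k) < s \<and> increasing_in (T (\<pi> k)) k \<pi> T"
  unfolding increasing_in_def by (auto simp: less_Suc_eq intro: less_trans)

lemma increasing_in_cong:
  assumes "\<And>i. i < k \<Longrightarrow> T (\<pi> i) = T' (\<pi> i)"
  shows "increasing_in s k \<pi> T \<longleftrightarrow> increasing_in s k \<pi> T'"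
  unfolding increasing_in_def by (intro conj_cong all_cong) (simp_all add: assms)

lemma increasing_sets:
  assumes "\<pi> ` {..<k} \<subseteq> J"
  shows "{T \<in> space (\<Pi>\<^sub>M j\<in>J. circle). increasing_in s k \<pi> T} \<in> sets (\<Pi>\<^sub>M j\<in>J. circle)"
proof -
  have [measurable]: "(\<lambda>T. T (\<pi> i)) \<in> borel_measurable (\<Pi>\<^sub>M j\<in>J. circle)" if "i < k" for i
    by (rule measurable_compose[OF measurable_component_singleton[of "\<pi> i" J "\<lambda>_. circle"] circle_borel])
      (use that assms in auto)
  have 1: "{T \<in> space (\<Pi>\<^sub>M j\<in>J. circle). increasing_in s k \<pi> T} =
      {T \<in> space (\<Pi>\<^sub>M j\<in>J. circle). (\<forall>i\<in>{..<k}. 0 < T (\<pi> i) \<and> T (\<pi> i) < s) \<and> (\<forall>j\<in>{..<k}. \<forall>i\<in>{..<j}. T (\<pi> i) < T (\<pi> j))}"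
    by (auto simp: increasing_in_def)
  have a: "{T \<in> space (\<Pi>\<^sub>M j\<in>J. circle). 0 < T (\<pi> i) \<and> T (\<pi> i) < s} \<in> sets (\<Pi>\<^sub>M j\<in>J. circle)" if "i \<in> {..<k}" for i
  proof -
    have "i < k" using that by auto
    then show ?thesis by measurable
  qed
  have b: "{T \<in> space (\<Pi>\<^sub>M j\<in>J. circle). T (\<pi> i) < T (\<pi> j)} \<in> sets (\<Pi>\<^sub>M j\<in>J. circle)" if "j \<in> {..<k}" "i \<in> {..<j}" for i j
  proof -
    have "i < k" "j < k" using that by auto
    then show ?thesis by measurable
  qed
  show ?thesis unfolding 1
    by (intro sets.sets_Collect_conj sets.sets_Collect_finite_All' sets.sets_Collect_finite_All a b) auto
qed

lemma nn_integral_power_circle: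
  assumes s: "0 \<le> s" "s \<le> 1"
  shows "(\<integral>\<^sup>+y. ennreal (y ^ k / fact k) * indicator {0<..<s} y \<partial>circle) = ennreal (s ^ Suc k / fact (Suc k))"
proof -
  have "(\<integral>\<^sup>+y. ennreal (y ^ k / fact k) * indicator {0<..<s} y \<partial>circle) =
      (\<integral>\<^sup>+y. ennreal (y ^ k / fact k) * indicator {0<..<s} y * indicator {0..<1} y \<partial>lborel)"
    unfolding circle_def by (rule nn_integral_restrict_space) simp
  also have "\<dots> = (\<integral>\<^sup>+y. ennreal (y ^ k / fact k) * indicator {0..s} y \<partial>lborel)"
  proof (rule nn_integral_cong_AE)
    have "AE y in lborel. y \<noteq> 0 \<and> y \<noteq> s" using AE_lborel_singleton[of 0] AE_lborel_singleton[of s] by auto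
    then show "AE y in lborel. ennreal (y ^ k / fact k) * indicator {0<..<s} y * indicator {0..<1} y =
        ennreal (y ^ k / fact k) * indicator {0..s} y"
      by eventually_elim (use s in \<open>auto simp: indicator_def\<close>)
  qed
  also have "\<dots> = ennreal (s ^ Suc k / fact (Suc k) - 0 ^ Suc k / fact (Suc k))"
  proof (rule nn_integral_FTC_Icc)
    show "((\<lambda>x. x ^ Suc k / fact (Suc k)) has_real_derivative x ^ k / fact k) (at x)" for x :: real
      using DERIV_cdivide[OF DERIV_pow[of "Suc k" x UNIV], of "fact (Suc k)"]
      by (simp add: fact_Suc del: of_nat_Suc power_Suc)
  qed (use s in auto)
  finally show ?thesis by simp
qed

text \<open>The volume of a simplex, by integration over the largest coordinate.\<close>

lemma emeasure_increasing:
  assumes "inj_on \<pi> {..<k}" "0 \<le> s" "s \<le> 1"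
  shows "emeasure (\<Pi>\<^sub>M j\<in>\<pi> ` {..<k}. circle) {T \<in> space (\<Pi>\<^sub>M j\<in>\<pi> ` {..<k}. circle). increasing_in s k \<pi> T} =
    ennreal (s ^ k / fact k)"
  using assms
proof (induction k arbitrary: s)
  case 0
  have "{T \<in> space (\<Pi>\<^sub>M j\<in>\<pi> ` {..<0}. circle). increasing_in s 0 \<pi> T} = {\<lambda>x. undefined}"
    by (auto simp: increasing_in_def space_PiM)
  then show ?case by (simp add: PiM_empty)
next
  case (Suc k)
  interpret C: prob_space circle by (rule prob_space_circle)
  interpret P: product_sigma_finite "\<lambda>_. circle" by unfold_locales
  let ?I = "\<pi> ` {..<k}"
  let ?P = "\<lambda>I. \<Pi>\<^sub>M j\<in>I. circle"
  let ?A = "{T \<in> space (?P (\<pi> ` {..<Suc k})). increasing_in s (Suc k) \<pi> T}"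
  have inj: "inj_on \<pi> {..<k}" using Suc.prems(1) by (rule inj_on_subset) auto
  have new: "\<pi> k \<notin> ?I" 
  proof
    assume "\<pi> k \<in> ?I"
    then obtain i where "i < k" "\<pi> k = \<pi> i" by auto
    then show False using inj_onD[OF Suc.prems(1), of k i] by simp
  qed
  have ins: "\<pi> ` {..<Suc k} = insert (\<pi> k) ?I" by (simp add: lessThan_Suc)
  have A: "?A \<in> sets (?P (\<pi> ` {..<Suc k}))" by (rule increasing_sets) simp
  have "emeasure (?P (\<pi> ` {..<Suc k})) ?A = (\<integral>\<^sup>+T. indicator ?A T \<partial>?P (insert (\<pi> k) ?I))"
    using A by (simp add: ins)
  also have "\<dots> = (\<integral>\<^sup>+y. (\<integral>\<^sup>+x. indicator ?A (x(\<pi> k := y)) \<partial>?P ?I) \<partial>circle)"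
    using A new by (intro P.product_nn_integral_insert_rev) (auto simp: ins)
  also have "\<dots> = (\<integral>\<^sup>+y. ennreal (y ^ k / fact k) * indicator {0<..<s} y \<partial>circle)"
  proof (rule nn_integral_cong)
    fix y assume y: "y \<in> space circle"
    have y': "0 \<le> y" "y \<le> 1" using y by (auto simp: space_circle)
    let ?B = "{T \<in> space (?P ?I). increasing_in y k \<pi> T}"
    have B: "?B \<in> sets (?P ?I)" by (rule increasing_sets) simp
    have "indicator ?A (x(\<pi> k := y)) = indicator {0<..<s} y * (indicator ?B x :: ennreal)" if x: "x \<in> space (?P ?I)" for x
    proof -
      have sp: "x(\<pi> k := y) \<in> space (?P (\<pi> ` {..<Suc k}))"
        using x y unfolding ins by (auto simp: space_PiM PiE_def extensional_def)
      have eq: "(x(\<pi> k := y)) (\<pi> i) = x (\<pi> i)" if "i < k" for i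
      proof -
        have "\<pi> i \<in> ?I" using that by simp
        then have "\<pi> i \<noteq> \<pi> k" using new by metis
        then show ?thesis by simp
      qed
      have "increasing_in y k \<pi> (x(\<pi> k := y)) \<longleftrightarrow> increasing_in y k \<pi> x"
        by (rule increasing_in_cong) (rule eq)
      then show ?thesis using sp x by (auto simp: increasing_in_Suc indicator_def)
    qed
    then have "(\<integral>\<^sup>+x. indicator ?A (x(\<pi> k := y)) \<partial>?P ?I) = (\<integral>\<^sup>+x. indicator {0<..<s} y * indicator ?B x \<partial>?P ?I)"
      by (intro nn_integral_cong)
    also have "\<dots> = indicator {0<..<s} y * emeasure (?P ?I) ?B"
      using B by (rule nn_integral_cmult_indicator)
    also have "\<dots> = ennreal (y ^ k / fact k) * indicator {0<..<s} y"
      using Suc.IH[OF inj y'] by (simp add: mult.commute)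
    finally show "(\<integral>\<^sup>+x. indicator ?A (x(\<pi> k := y)) \<partial>?P ?I) = ennreal (y ^ k / fact k) * indicator {0<..<s} y" .
  qed
  also have "\<dots> = ennreal (s ^ Suc k / fact (Suc k))"
    by (rule nn_integral_power_circle[OF Suc.prems(2,3)])
  finally show ?case .
qed

lemma card_injections:
  assumes "finite A" "finite B" "card A = card B"
  shows "card {f \<in> A \<rightarrow>\<^sub>E B. inj_on f A} = fact (card A)"
  using assms
proof (induction A arbitrary: B rule: finite_induct)
  case empty
  have "{f \<in> {} \<rightarrow>\<^sub>E B. inj_on f {}} = {\<lambda>x. undefined}" by auto
  then show ?case by simp
next
  case (insert a A)
  let ?G = "\<lambda>b. {f \<in> A \<rightarrow>\<^sub>E (B - {b}). inj_on f A}"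
  have eq: "{f \<in> insert a A \<rightarrow>\<^sub>E B. inj_on f (insert a A)} = (\<Union>b\<in>B. (\<lambda>f. f(a := b)) ` ?G b)"
  proof (intro equalityI subsetI)
    fix f assume f: "f \<in> {f \<in> insert a A \<rightarrow>\<^sub>E B. inj_on f (insert a A)}"
    then have "f(a := undefined) \<in> ?G (f a)"
      using insert.hyps by (auto simp: PiE_def Pi_def extensional_def inj_on_def)
    moreover have "f = (f(a := undefined))(a := f a)" by simp
    moreover have "f a \<in> B" using f by auto
    ultimately show "f \<in> (\<Union>b\<in>B. (\<lambda>f. f(a := b)) ` ?G b)" by blast
  next
    fix f assume "f \<in> (\<Union>b\<in>B. (\<lambda>f. f(a := b)) ` ?G b)"
    then obtain b g where b: "b \<in> B" and g: "g \<in> A \<rightarrow>\<^sub>E (B - {b})" "inj_on g A" and f: "f = g(a := b)" by blast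
    have "inj_on f (insert a A)"
      using g insert.hyps unfolding f inj_on_def by (auto simp: PiE_def Pi_def)
    moreover have "f \<in> insert a A \<rightarrow>\<^sub>E B"
      using g b unfolding f by (auto simp: PiE_def Pi_def extensional_def)
    ultimately show "f \<in> {f \<in> insert a A \<rightarrow>\<^sub>E B. inj_on f (insert a A)}" by blast
  qed
  have fin: "finite (?G b)" for b
    by (rule finite_subset[of _ "A \<rightarrow>\<^sub>E (B - {b})"]) (use insert in \<open>auto intro!: finite_PiE\<close>)
  have "card {f \<in> insert a A \<rightarrow>\<^sub>E B. inj_on f (insert a A)} = (\<Sum>b\<in>B. card ((\<lambda>f. f(a := b)) ` ?G b))"
    unfolding eq
  proof (rule card_UN_disjoint)
    show "\<forall>b\<in>B. \<forall>c\<in>B. b \<noteq> c \<longrightarrow> (\<lambda>f. f(a := b)) ` ?G b \<inter> (\<lambda>f. f(a := c)) ` ?G c = {}"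
    proof (intro ballI impI)
      fix b c assume "b \<in> B" "c \<in> B" and ne: "b \<noteq> c"
      have val: "f a = b" if "f \<in> (\<lambda>f. f(a := b)) ` ?G b" for f b
        using that by (elim imageE) simp
      show "(\<lambda>f. f(a := b)) ` ?G b \<inter> (\<lambda>f. f(a := c)) ` ?G c = {}"
      proof (rule equals0I)
        fix f assume "f \<in> (\<lambda>f. f(a := b)) ` ?G b \<inter> (\<lambda>f. f(a := c)) ` ?G c"
        then show False using val[of f b] val[of f c] ne by (elim IntE) simp
      qed
    qed
  qed (use insert.prems fin in auto)
  also have "\<dots> = (\<Sum>b\<in>B. fact (card A))"
  proof (intro sum.cong refl)
    fix b assume b: "b \<in> B"
    have "inj_on (\<lambda>f. f(a := b)) (?G b)"
    proof (rule inj_onI)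
      fix f g assume f: "f \<in> ?G b" and g: "g \<in> ?G b" and eq: "f(a := b) = g(a := b)"
      have "f a = undefined" "g a = undefined"
        using f g insert.hyps by (auto simp: PiE_def extensional_def)
      then show "f = g" using eq by (metis fun_upd_triv fun_upd_upd)
    qed
    then have "card ((\<lambda>f. f(a := b)) ` ?G b) = card (?G b)" by (rule card_image)
    also have "\<dots> = fact (card A)"
      using insert b by (intro insert.IH) auto
    finally show "card ((\<lambda>f. f(a := b)) ` ?G b) = fact (card A)" .
  qed
  also have "\<dots> = fact (card (insert a A))" using insert by (simp flip: insert.prems(2))
  finally show ?case .
qed

text \<open>The marks on an edge \<open>e\<close> are numbered independently of their times, so the positions of \<open>e\<close> in the
  word can carry these numbers in any order.\<close>

lemma card_labellings:
  fixes g :: "nat \<Rightarrow> 'e"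
  assumes E: "finite E" and g: "\<And>i. i < k \<Longrightarrow> g i \<in> E"
  defines "\<nu> \<equiv> \<lambda>e. card {i. i < k \<and> g i = e}"
  shows "card {\<pi> \<in> {..<k} \<rightarrow>\<^sub>E (SIGMA e:E. {..<\<nu> e}). bij_betw \<pi> {..<k} (SIGMA e:E. {..<\<nu> e}) \<and> (\<forall>i<k. fst (\<pi> i) = g i)} =
    (\<Prod>e\<in>E. fact (\<nu> e))"
proof -
  let ?J = "SIGMA e:E. {..<\<nu> e}"
  let ?L = "{\<pi> \<in> {..<k} \<rightarrow>\<^sub>E ?J. bij_betw \<pi> {..<k} ?J \<and> (\<forall>i<k. fst (\<pi> i) = g i)}"
  let ?I = "\<lambda>e. {i. i < k \<and> g i = e}"
  let ?F = "\<lambda>e. {f \<in> ?I e \<rightarrow>\<^sub>E {..<\<nu> e}. inj_on f (?I e)}"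
  have cardJ: "card ?J = k"
  proof -
    have "card ?J = (\<Sum>e\<in>E. \<nu> e)" using E by simp
    also have "\<dots> = card (\<Union>e\<in>E. ?I e)"
      unfolding \<nu>_def using E by (intro card_UN_disjoint[symmetric]) auto
    also have "(\<Union>e\<in>E. ?I e) = {..<k}" using g by auto
    finally show ?thesis by simp
  qed
  have finJ: "finite ?J" using E by simp
  let ?to = "\<lambda>h. \<lambda>i\<in>{..<k}. (g i, h (g i) i)"
  let ?from = "\<lambda>\<pi>. \<lambda>e\<in>E. \<lambda>i\<in>?I e. snd (\<pi> i)"
  have "bij_betw ?to (PiE E ?F) ?L"
  proof (rule bij_betw_byWitness[where f' = ?from])
    show "\<forall>h\<in>PiE E ?F. ?from (?to h) = h"
    proof
      fix h assume h: "h \<in> PiE E ?F"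
      show "?from (?to h) = h"
      proof
        fix e
        show "?from (?to h) e = h e"
        proof (cases "e \<in> E")
          case True
          then have he: "h e \<in> ?I e \<rightarrow>\<^sub>E {..<\<nu> e}" using h by (auto simp: PiE_def Pi_def)
          have "?from (?to h) e i = h e i" for i
            using True PiE_arb[OF he, of i] by (cases "i \<in> ?I e") auto
          then show ?thesis by blast
        next
          case False
          then show ?thesis using PiE_arb[OF h] by simp
        qed
      qed
    qed
    show "\<forall>\<pi>\<in>?L. ?to (?from \<pi>) = \<pi>"
    proof
      fix \<pi> assume "\<pi> \<in> ?L"
      then have P: "\<pi> \<in> {..<k} \<rightarrow>\<^sub>E ?J" and f: "\<And>i. i < k \<Longrightarrow> fst (\<pi> i) = g i" by auto
      show "?to (?from \<pi>) = \<pi>"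
      proof
        fix i show "?to (?from \<pi>) i = \<pi> i"
          using g[of i] f[of i] PiE_arb[OF P, of i] by (cases "i < k") (auto intro: prod_eqI)
      qed
    qed
    show "?to ` PiE E ?F \<subseteq> ?L"
    proof (rule image_subsetI)
      fix h assume h: "h \<in> PiE E ?F"
      have hF: "h e \<in> ?F e" if "e \<in> E" for e using h that by (rule PiE_mem)
      have "(g i, h (g i) i) \<in> ?J" if "i < k" for i
        using hF[OF g[OF that]] g[OF that] that by (auto simp: PiE_def Pi_def)
      then have P: "?to h \<in> {..<k} \<rightarrow>\<^sub>E ?J" by auto
      have "inj_on (?to h) {..<k}"
      proof (rule inj_onI)
        fix i j assume ij: "i \<in> {..<k}" "j \<in> {..<k}" "?to h i = ?to h j"
        then have "g i = g j" "h (g i) i = h (g i) j" by auto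
        moreover have "inj_on (h (g i)) (?I (g i))" using hF[OF g[of i]] ij by simp
        ultimately show "i = j" using ij by (auto dest: inj_onD)
      qed
      then have "bij_betw (?to h) {..<k} ?J"
      proof -
        assume inj: "inj_on (?to h) {..<k}"
        have "?to h ` {..<k} = ?J"
        proof (rule card_subset_eq[OF finJ])
          show "?to h ` {..<k} \<subseteq> ?J" using PiE_mem[OF P] by (intro image_subsetI)
          show "card (?to h ` {..<k}) = card ?J" unfolding card_image[OF inj] cardJ by simp
        qed
        with inj show ?thesis unfolding bij_betw_def by (rule conjI)
      qed
      then show "?to h \<in> ?L" using P by simp
    qed
    show "?from ` ?L \<subseteq> PiE E ?F"
    proof (rule image_subsetI)
      fix \<pi> assume "\<pi> \<in> ?L"
      then have P: "\<pi> \<in> {..<k} \<rightarrow>\<^sub>E ?J" and b: "inj_on \<pi> {..<k}" and f: "\<And>i. i < k \<Longrightarrow> fst (\<pi> i) = g i"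
        by (auto simp: bij_betw_def)
      have "(\<lambda>i\<in>?I e. snd (\<pi> i)) \<in> ?F e" for e
      proof (intro CollectI conjI)
        have "snd (\<pi> i) < \<nu> e" if "i \<in> ?I e" for i
        proof -
          have "\<pi> i \<in> ?J" using P that by auto
          then show ?thesis using f[of i] that by auto
        qed
        then show "(\<lambda>i\<in>?I e. snd (\<pi> i)) \<in> ?I e \<rightarrow>\<^sub>E {..<\<nu> e}" by auto
        show "inj_on (\<lambda>i\<in>?I e. snd (\<pi> i)) (?I e)"
        proof (rule inj_onI)
          fix i j assume ij: "i \<in> ?I e" "j \<in> ?I e" "(\<lambda>i\<in>?I e. snd (\<pi> i)) i = (\<lambda>i\<in>?I e. snd (\<pi> i)) j"
          then have "\<pi> i = \<pi> j" using f by (intro prod_eqI) auto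
          then show "i = j" using inj_onD[OF b, of i j] ij by auto
        qed
      qed
      then show "?from \<pi> \<in> PiE E ?F" by auto
    qed
  qed
  then have "card ?L = card (PiE E ?F)" by (rule bij_betw_same_card[symmetric])
  also have "\<dots> = (\<Prod>e\<in>E. card (?F e))" using E by (rule card_PiE)
  also have "\<dots> = (\<Prod>e\<in>E. fact (\<nu> e))"
  proof (intro prod.cong refl)
    fix e
    have "card (?F e) = fact (card (?I e))"
      by (rule card_injections) (auto simp: \<nu>_def)
    then show "card (?F e) = fact (\<nu> e)" by (simp add: \<nu>_def)
  qed
  finally show ?thesis .
qed

section \<open>The law of the word of a sample\<close>

lemma pmf_mark: "0 \<le> u \<Longrightarrow> u \<le> 1 \<Longrightarrow> pmf (mark_pmf u) m = mark_weight u m"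
proof -
  assume u: "0 \<le> u" "u \<le> 1"
  have "(\<lambda>b. if b then Cross else Bar) -` {m} = {m = Cross}"
    by (cases m) (auto split: if_splits)
  then have "pmf (mark_pmf u) m = pmf (bernoulli_pmf u) (m = Cross)"
    unfolding mark_pmf_def pmf_map by (simp add: measure_pmf_single)
  then show ?thesis using u by (cases m) (simp_all add: mark_weight_def)
qed

lemma emeasure_process_box:
  assumes A: "\<And>i. i < n \<Longrightarrow> A i \<in> sets circle"
  shows "{\<xi> \<in> space (poisson_process t (mark_space u)). fst \<xi> = n \<and> (\<forall>i<n. snd (snd \<xi> i) = \<mu> i \<and> fst (snd \<xi> i) \<in> A i)}
      \<in> sets (poisson_process t (mark_space u))" (is "?R \<in> _")
    and "emeasure (poisson_process t (mark_space u))
      {\<xi> \<in> space (poisson_process t (mark_space u)). fst \<xi> = n \<and> (\<forall>i<n. snd (snd \<xi> i) = \<mu> i \<and> fst (snd \<xi> i) \<in> A i)} =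
      ennreal (pmf (poisson0_pmf t) n) * (\<Prod>i<n. ennreal (pmf (mark_pmf u) (\<mu> i)) * emeasure circle (A i))"
proof -
  interpret P: prob_space "mark_space u" by (rule prob_space_mark_space)
  interpret Q: product_prob_space "\<lambda>_::nat. mark_space u" UNIV by unfold_locales
  let ?Q = "\<Pi>\<^sub>M k\<in>(UNIV :: nat set). mark_space u"
  let ?X = "prod_emb UNIV (\<lambda>_. mark_space u) {..<n} (Pi\<^sub>E {..<n} (\<lambda>i. A i \<times> {\<mu> i}))"
  have box: "A i \<times> {\<mu> i} \<in> sets (mark_space u)" if "i < n" for i
    using A[OF that] by (intro pair_measureI) auto
  have X: "?X \<in> sets ?Q" using box by (intro sets_PiM_I) auto
  have eq: "?R = {n} \<times> ?X"
    unfolding prod_emb_def poisson_process_def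
    by (auto simp: space_pair_measure space_PiM PiE_iff mem_Times_iff)
  show "?R \<in> sets (poisson_process t (mark_space u))"
    unfolding eq unfolding poisson_process_def using X by (intro pair_measureI) auto
  have "emeasure (poisson_process t (mark_space u)) ?R = emeasure (measure_pmf (poisson0_pmf t)) {n} * emeasure ?Q ?X"
    unfolding eq unfolding poisson_process_def using X by (intro Q.emeasure_pair_measure_Times) auto
  also have "emeasure ?Q ?X = (\<Prod>i<n. emeasure (mark_space u) (A i \<times> {\<mu> i}))"
    using box by (intro Q.emeasure_PiM_emb) auto
  also have "\<dots> = (\<Prod>i<n. ennreal (pmf (mark_pmf u) (\<mu> i)) * emeasure circle (A i))"
  proof (intro prod.cong refl)
    fix i assume "i \<in> {..<n}"
    then have "emeasure (mark_space u) (A i \<times> {\<mu> i}) = emeasure circle (A i) * emeasure (measure_pmf (mark_pmf u)) {\<mu> i}"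
      using A by (intro measure_pmf.emeasure_pair_measure_Times) auto
    then show "emeasure (mark_space u) (A i \<times> {\<mu> i}) = ennreal (pmf (mark_pmf u) (\<mu> i)) * emeasure circle (A i)"
      by (simp add: emeasure_pmf_single mult.commute)
  qed
  finally show "emeasure (poisson_process t (mark_space u)) ?R =
      ennreal (pmf (poisson0_pmf t) n) * (\<Prod>i<n. ennreal (pmf (mark_pmf u) (\<mu> i)) * emeasure circle (A i))"
    by (simp add: emeasure_pmf_single)
qed

text \<open>Given the numbers and the types of the marks, their times are independent and uniform. Both sides
  are finite measures in \<open>B\<close>, and they agree on boxes by the product structure.\<close>

lemma emeasure_mark_law_times:
  fixes E :: "'v set set" and \<mu> :: "'v set \<times> nat \<Rightarrow> mark" and \<nu> :: "'v set \<Rightarrow> nat"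
  assumes E: "finite E"
  defines "J \<equiv> mark_indices E \<nu>"
  assumes B: "B \<in> sets (\<Pi>\<^sub>M j\<in>J. circle)"
  shows "{\<omega> \<in> space (mark_law E t u). (\<forall>e\<in>E. fst (\<omega> e) = \<nu> e) \<and> (\<forall>j\<in>J. mark_of \<omega> j = \<mu> j) \<and>
      (\<lambda>j\<in>J. time_of \<omega> j) \<in> B} \<in> sets (mark_law E t u)"
    and "emeasure (mark_law E t u) {\<omega> \<in> space (mark_law E t u). (\<forall>e\<in>E. fst (\<omega> e) = \<nu> e) \<and>
      (\<forall>j\<in>J. mark_of \<omega> j = \<mu> j) \<and> (\<lambda>j\<in>J. time_of \<omega> j) \<in> B} =
      ennreal ((\<Prod>e\<in>E. pmf (poisson0_pmf t) (\<nu> e)) * (\<Prod>j\<in>J. pmf (mark_pmf u) (\<mu> j))) *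
      emeasure (\<Pi>\<^sub>M j\<in>J. circle) B"
proof -
  let ?M = "mark_law E t u"
  let ?PP = "poisson_process t (mark_space u)"
  let ?C = "\<Pi>\<^sub>M j\<in>J. circle"
  let ?c = "(\<Prod>e\<in>E. pmf (poisson0_pmf t) (\<nu> e)) * (\<Prod>j\<in>J. pmf (mark_pmf u) (\<mu> j))"
  interpret PP: prob_space ?PP by (rule prob_space_poisson_process[OF prob_space_mark_space])
  interpret PM: product_sigma_finite "\<lambda>_ :: 'v set. ?PP" by unfold_locales
  interpret C: prob_space circle by (rule prob_space_circle)
  interpret CC: product_sigma_finite "\<lambda>_ :: 'v set \<times> nat. circle" by unfold_locales
  have J: "finite J" unfolding J_def by (rule finite_mark_indices[OF E])
  have JE: "fst j \<in> E" if "j \<in> J" for j using that by (auto simp: J_def mark_indices_def)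
  define S where "S = {\<omega> \<in> space ?M. (\<forall>e\<in>E. fst (\<omega> e) = \<nu> e) \<and> (\<forall>j\<in>J. mark_of \<omega> j = \<mu> j)}"
  let ?Y = "\<lambda>\<omega>. \<lambda>j\<in>J. time_of \<omega> j"
  have Y: "?Y \<in> ?M \<rightarrow>\<^sub>M ?C"
  proof (rule measurable_restrict)
    fix j assume "j \<in> J"
    then show "(\<lambda>\<omega>. time_of \<omega> j) \<in> ?M \<rightarrow>\<^sub>M circle"
      using time_circle_measurable[OF JE, of j "snd j"] by simp
  qed
  have box: "{\<omega> \<in> S. ?Y \<omega> \<in> Pi\<^sub>E J A} \<in> sets ?M \<and> emeasure ?M {\<omega> \<in> S. ?Y \<omega> \<in> Pi\<^sub>E J A} = ennreal ?c * emeasure ?C (Pi\<^sub>E J A)"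
    if A: "\<And>j. j \<in> J \<Longrightarrow> A j \<in> sets circle" for A
  proof -
    let ?R = "\<lambda>e. {\<xi> \<in> space ?PP. fst \<xi> = \<nu> e \<and> (\<forall>i<\<nu> e. snd (snd \<xi> i) = \<mu> (e, i) \<and> fst (snd \<xi> i) \<in> A (e, i))}"
    have A': "A (e, i) \<in> sets circle" if "e \<in> E" "i < \<nu> e" for e i
      using that by (intro A) (simp add: J_def mark_indices_def)
    have "{\<omega> \<in> S. ?Y \<omega> \<in> Pi\<^sub>E J A} = Pi\<^sub>E E ?R"
      unfolding S_def J_def mark_indices_def mark_of_def time_of_def
      by (auto simp: mark_law_def space_PiM PiE_iff extensional_def)
    moreover have "Pi\<^sub>E E ?R \<in> sets ?M"
      unfolding mark_law_def using E A' by (intro sets_PiM_I_finite emeasure_process_box(1)) auto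
    moreover have "emeasure ?M (Pi\<^sub>E E ?R) = (\<Prod>e\<in>E. emeasure ?PP (?R e))"
      unfolding mark_law_def using E A' by (intro PM.emeasure_PiM emeasure_process_box(1)) auto
    moreover have "\<dots> = (\<Prod>e\<in>E. ennreal (pmf (poisson0_pmf t) (\<nu> e)) *
        (\<Prod>i<\<nu> e. ennreal (pmf (mark_pmf u) (\<mu> (e, i))) * emeasure circle (A (e, i))))"
      using A' by (intro prod.cong refl emeasure_process_box(2)) auto
    moreover have "\<dots> = (\<Prod>e\<in>E. ennreal (pmf (poisson0_pmf t) (\<nu> e))) *
        (\<Prod>j\<in>J. ennreal (pmf (mark_pmf u) (\<mu> j)) * emeasure circle (A j))"
      unfolding prod.distrib[of _ _ E] J_def mark_indices_def using E
      by (simp add: prod.Sigma case_prod_beta)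
    moreover have "\<dots> = ennreal ?c * (\<Prod>j\<in>J. emeasure circle (A j))"
      by (simp add: prod.distrib prod_ennreal ennreal_mult prod_nonneg mult.assoc)
    moreover have "(\<Prod>j\<in>J. emeasure circle (A j)) = emeasure ?C (Pi\<^sub>E J A)"
      using J A by (intro CC.emeasure_PiM[symmetric]) auto
    ultimately show ?thesis by simp
  qed
  have fullY: "?Y \<omega> \<in> Pi\<^sub>E J (\<lambda>_. space circle)" if "\<omega> \<in> space ?M" for \<omega>
    using measurable_space[OF Y that] by (simp add: space_PiM)
  have "{\<omega> \<in> S. ?Y \<omega> \<in> Pi\<^sub>E J (\<lambda>_. space circle)} = S" using fullY by (auto simp: S_def)
  then have S: "S \<in> sets ?M" using box[of "\<lambda>_. space circle"] by simp
  \<comment> \<open>The distribution of the times on the event \<open>S\<close>, unnormalised.\<close>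
  define N1 where "N1 = distr (density ?M (indicator S)) ?C ?Y"
  have N1: "emeasure N1 B' = emeasure ?M {\<omega> \<in> S. ?Y \<omega> \<in> B'}" if B': "B' \<in> sets ?C" for B'
  proof -
    have pre: "?Y -` B' \<inter> space ?M \<in> sets ?M" using measurable_sets[OF Y B'] .
    have "emeasure N1 B' = emeasure (density ?M (indicator S)) (?Y -` B' \<inter> space ?M)"
      unfolding N1_def using Y B' by (subst emeasure_distr) auto
    also have "\<dots> = (\<integral>\<^sup>+\<omega>. indicator S \<omega> * indicator (?Y -` B' \<inter> space ?M) \<omega> \<partial>?M)"
      using S pre by (intro emeasure_density) auto
    also have "\<dots> = (\<integral>\<^sup>+\<omega>. indicator {\<omega> \<in> S. ?Y \<omega> \<in> B'} \<omega> \<partial>?M)"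
      by (intro nn_integral_cong) (auto simp: indicator_def S_def)
    also have "\<dots> = emeasure ?M {\<omega> \<in> S. ?Y \<omega> \<in> B'}"
    proof (rule nn_integral_indicator)
      have "{\<omega> \<in> S. ?Y \<omega> \<in> B'} = S \<inter> (?Y -` B' \<inter> space ?M)" by (auto simp: S_def)
      then show "{\<omega> \<in> S. ?Y \<omega> \<in> B'} \<in> sets ?M" using S pre by auto
    qed
    finally show ?thesis .
  qed
  have "N1 = scale_measure (ennreal ?c) ?C"
  proof (rule measure_eqI_PiM_finite[OF J, where A = "\<lambda>_ :: nat. Pi\<^sub>E J (\<lambda>_. space circle)"])
    show "emeasure N1 (Pi\<^sub>E J A) = emeasure (scale_measure (ennreal ?c) ?C) (Pi\<^sub>E J A)"
      if A: "\<And>j. j \<in> J \<Longrightarrow> A j \<in> sets circle" for A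
      using box[OF A] N1[of "Pi\<^sub>E J A"] J A by (simp add: sets_PiM_I_finite)
    show "range (\<lambda>_ :: nat. Pi\<^sub>E J (\<lambda>_. space circle)) \<subseteq> prod_algebra J (\<lambda>_. circle)"
      using J by (auto intro!: prod_algebraI_finite)
    have "emeasure N1 (Pi\<^sub>E J (\<lambda>_. space circle)) = ennreal ?c * 1"
      using N1[of "Pi\<^sub>E J (\<lambda>_. space circle)"] box[of "\<lambda>_. space circle"] J
      by (simp add: sets_PiM_I_finite CC.emeasure_PiM C.emeasure_space_1)
    then show "emeasure N1 (Pi\<^sub>E J (\<lambda>_. space circle)) \<noteq> \<infinity>" by simp
  qed (auto simp: N1_def space_PiM)
  then have "emeasure ?M {\<omega> \<in> S. ?Y \<omega> \<in> B} = ennreal ?c * emeasure ?C B"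
    using N1[OF B] by simp
  moreover have "{\<omega> \<in> S. ?Y \<omega> \<in> B} = {\<omega> \<in> space ?M. (\<forall>e\<in>E. fst (\<omega> e) = \<nu> e) \<and> (\<forall>j\<in>J. mark_of \<omega> j = \<mu> j) \<and> ?Y \<omega> \<in> B}"
    by (auto simp: S_def)
  moreover have "{\<omega> \<in> S. ?Y \<omega> \<in> B} = S \<inter> (?Y -` B \<inter> space ?M)" by (auto simp: S_def)
  then have "{\<omega> \<in> S. ?Y \<omega> \<in> B} \<in> sets ?M" using S measurable_sets[OF Y B] by auto
  ultimately show "{\<omega> \<in> space ?M. (\<forall>e\<in>E. fst (\<omega> e) = \<nu> e) \<and> (\<forall>j\<in>J. mark_of \<omega> j = \<mu> j) \<and> ?Y \<omega> \<in> B} \<in> sets ?M"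
    "emeasure ?M {\<omega> \<in> space ?M. (\<forall>e\<in>E. fst (\<omega> e) = \<nu> e) \<and> (\<forall>j\<in>J. mark_of \<omega> j = \<mu> j) \<and> ?Y \<omega> \<in> B} =
      ennreal ?c * emeasure ?C B"
    by simp_all
qed

text \<open>The list of times is strictly increasing, hence determined by the set of times.\<close>

lemma enumerates_unique:
  assumes a: "enumerates E w \<pi> \<omega>" and b: "enumerates E w' \<pi>' \<omega>"
  shows "w = w'" and "i < length w \<Longrightarrow> \<pi> i = \<pi>' i"
proof -
  let ?J = "mark_indices E (\<lambda>e. fst (\<omega> e))"
  have bij: "bij_betw \<pi> {..<length w} ?J" "bij_betw \<pi>' {..<length w'} ?J"
    using a b by (auto simp: enumerates_def)
  then have len: "length w = length w'" by (metis bij_betw_same_card card_lessThan)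
  define ts where "ts \<pi> = map (\<lambda>i. time_of \<omega> (\<pi> i)) [0..<length w]" for \<pi>
  have sorted: "sorted_wrt (<) (ts \<pi>)" "sorted_wrt (<) (ts \<pi>')"
    using a b len by (auto simp: ts_def sorted_wrt_iff_nth_less enumerates_def)
  have set: "set (ts p) = time_of \<omega> ` p ` {..<length w}" for p
    by (auto simp: ts_def)
  have "set (ts \<pi>) = set (ts \<pi>')" unfolding set using bij len by (simp add: bij_betw_def)
  then have eq: "ts \<pi> = ts \<pi>'" using sorted by (intro strict_sorted_equal) auto
  have t: "time_of \<omega> (\<pi> i) = time_of \<omega> (\<pi>' i)" if "i < length w" for i
    using arg_cong[OF eq, of "\<lambda>xs. xs ! i"] that by (simp add: ts_def)
  have inj: "inj_on (time_of \<omega>) ?J"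
  proof -
    have less: "time_of \<omega> (\<pi> i) < time_of \<omega> (\<pi> j)" if "i < j" "j < length w" for i j
      using a that by (simp add: enumerates_def)
    have "inj_on (\<lambda>i. time_of \<omega> (\<pi> i)) {..<length w}"
      by (rule linorder_inj_onI) (use less in fastforce)+
    then have "inj_on (time_of \<omega> \<circ> \<pi>) {..<length w}" by (simp add: o_def)
    then have "inj_on (time_of \<omega>) (\<pi> ` {..<length w})" by (rule inj_on_imageI)
    then show ?thesis using bij(1) by (simp add: bij_betw_def)
  qed
  have pi: "\<pi> i = \<pi>' i" if "i < length w" for i
    using inj_onD[OF inj t[OF that]] bij_betwE[OF bij(1)] bij_betwE[OF bij(2)] that len by auto
  then show "i < length w \<Longrightarrow> \<pi> i = \<pi>' i" .
  show "w = w'"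
  proof (rule nth_equalityI[OF len])
    fix i assume i: "i < length w"
    have "w ! i = (fst (\<pi> i), mark_of \<omega> (\<pi> i))" "w' ! i = (fst (\<pi>' i), mark_of \<omega> (\<pi>' i))"
      using a b i len by (auto simp: enumerates_def intro!: prod_eqI)
    then show "w ! i = w' ! i" using pi[OF i] by simp
  qed
qed

definition word_event :: "'v set set \<Rightarrow> real \<Rightarrow> real \<Rightarrow> 'v letter list \<Rightarrow> 'v sample set" where
  "word_event E t u w = {\<omega> \<in> space (mark_law E t u). \<exists>\<pi>. enumerates E w \<pi> \<omega>}"

text \<open>With \<open>\<nu>\<close> the numbers of occurrences of the edges, each of the \<open>(\<Prod>e. \<nu> e!)\<close> labellings contributes
  the Poisson probability of \<open>\<nu>\<close> times the volume \<open>1 / k!\<close>. The factorials of the Poisson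
  probabilities cancel against the number of labellings.\<close>

lemma emeasure_word_event:
  assumes E: "finite E" and t: "0 \<le> t" and u: "0 \<le> u" "u \<le> 1" and w: "w \<in> words E k"
  shows "word_event E t u w \<in> sets (mark_law E t u)"
    and "emeasure (mark_law E t u) (word_event E t u w) =
      ennreal (exp (- (t * real (card E))) * (t ^ k / fact k) * word_weight u w)"
proof -
  let ?M = "mark_law E t u"
  have len: "length w = k" and wE: "\<And>i. i < k \<Longrightarrow> fst (w ! i) \<in> E"
    using w nth_mem by (fastforce simp: words_def)+
  define \<nu> where "\<nu> e = card {i. i < k \<and> fst (w ! i) = e}" for e
  let ?J = "mark_indices E \<nu>"
  let ?L = "{\<pi> \<in> {..<k} \<rightarrow>\<^sub>E ?J. bij_betw \<pi> {..<k} ?J \<and> (\<forall>i<k. fst (\<pi> i) = fst (w ! i))}"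
  let ?W = "\<lambda>\<pi>. {\<omega> \<in> space ?M. enumerates E w \<pi> \<omega>}"
  let ?c = "(\<Prod>e\<in>E. pmf (poisson0_pmf t) (\<nu> e)) * word_weight u w"
  have finL: "finite ?L"
    using finite_mark_indices[OF E] by (intro finite_subset[of ?L "{..<k} \<rightarrow>\<^sub>E ?J"]) (auto intro!: finite_PiE)
  have counts: "fst (\<omega> e) = \<nu> e" if en: "enumerates E w \<pi> \<omega>" and e: "e \<in> E" for \<pi> \<omega> e
  proof -
    have b: "bij_betw \<pi> {..<k} (mark_indices E (\<lambda>e. fst (\<omega> e)))" and f: "\<And>i. i < k \<Longrightarrow> fst (\<pi> i) = fst (w ! i)"
      using en len by (auto simp: enumerates_def)
    have "bij_betw \<pi> {i. i < k \<and> fst (w ! i) = e} {j \<in> mark_indices E (\<lambda>e. fst (\<omega> e)). fst j = e}"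
      using b f by (auto simp: bij_betw_def inj_on_def image_iff) (metis fst_conv lessThan_iff imageE)
    then have "\<nu> e = card {j \<in> mark_indices E (\<lambda>e. fst (\<omega> e)). fst j = e}"
      unfolding \<nu>_def by (rule bij_betw_same_card)
    also have "{j \<in> mark_indices E (\<lambda>e. fst (\<omega> e)). fst j = e} = Pair e ` {..<fst (\<omega> e)}"
      using e by (auto simp: mark_indices_def)
    also have "card \<dots> = fst (\<omega> e)" by (simp add: card_image inj_on_def)
    finally show ?thesis by simp
  qed
  have union: "word_event E t u w = (\<Union>\<pi>\<in>?L. ?W \<pi>)"
  proof (intro equalityI subsetI)
    fix \<omega> assume "\<omega> \<in> word_event E t u w"
    then obtain \<pi> where \<omega>: "\<omega> \<in> space ?M" and en: "enumerates E w \<pi> \<omega>" by (auto simp: word_event_def)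
    let ?\<pi> = "restrict \<pi> {..<k}"
    have en': "enumerates E w ?\<pi> \<omega>"
      using en len unfolding enumerates_def by (auto simp: bij_betw_def inj_on_def)
    have "mark_indices E (\<lambda>e. fst (\<omega> e)) = ?J" using counts[OF en] by (auto simp: mark_indices_def)
    then have "?\<pi> \<in> ?L" using en' len unfolding enumerates_def by (auto dest: bij_betwE)
    then show "\<omega> \<in> (\<Union>\<pi>\<in>?L. ?W \<pi>)" using \<omega> en' by blast
  qed (auto simp: word_event_def)
  have cell: "?W \<pi> \<in> sets ?M \<and> emeasure ?M (?W \<pi>) = ennreal (?c / fact k)" if \<pi>: "\<pi> \<in> ?L" for \<pi>
  proof -
    have b: "bij_betw \<pi> {..<k} ?J" and f: "\<And>i. i < k \<Longrightarrow> fst (\<pi> i) = fst (w ! i)" using \<pi> by auto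
    have img: "\<pi> ` {..<k} = ?J" and inj: "inj_on \<pi> {..<k}" using b by (auto simp: bij_betw_def)
    define \<mu> where "\<mu> j = snd (w ! the_inv_into {..<k} \<pi> j)" for j
    have \<mu>: "\<mu> (\<pi> i) = snd (w ! i)" if "i < k" for i
      using the_inv_into_f_f[OF inj, of i] that by (simp add: \<mu>_def)
    let ?B = "{T \<in> space (\<Pi>\<^sub>M j\<in>?J. circle). increasing_in 1 k \<pi> T}"
    have B: "?B \<in> sets (\<Pi>\<^sub>M j\<in>?J. circle)" using img by (intro increasing_sets) simp
    have piJ: "\<pi> i \<in> ?J" if "i < k" for i using that img by blast
    have "?W \<pi> = {\<omega> \<in> space ?M. (\<forall>e\<in>E. fst (\<omega> e) = \<nu> e) \<and> (\<forall>j\<in>?J. mark_of \<omega> j = \<mu> j) \<and>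
        (\<lambda>j\<in>?J. time_of \<omega> j) \<in> ?B}" (is "_ = ?W'")
    proof (intro equalityI subsetI)
      fix \<omega> assume "\<omega> \<in> ?W \<pi>"
      then have \<omega>: "\<omega> \<in> space ?M" and en: "enumerates E w \<pi> \<omega>" by auto
      have range: "0 \<le> time_of \<omega> j \<and> time_of \<omega> j < 1" if "j \<in> ?J" for j
        using space_mark_law[OF \<omega>, of "fst j" "snd j"] that by (auto simp: mark_indices_def)
      have "(\<lambda>j\<in>?J. time_of \<omega> j) \<in> space (\<Pi>\<^sub>M j\<in>?J. circle)"
        using range by (auto simp: space_PiM space_circle)
      moreover have "increasing_in 1 k \<pi> (\<lambda>j\<in>?J. time_of \<omega> j)"
        using en len range[OF piJ] piJ unfolding enumerates_def increasing_in_def by auto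
      moreover have "mark_of \<omega> j = \<mu> j" if j: "j \<in> ?J" for j
      proof -
        obtain i where "i < k" "j = \<pi> i" using j unfolding img[symmetric] by auto
        then show ?thesis using en len \<mu> by (simp add: enumerates_def)
      qed
      ultimately show "\<omega> \<in> ?W'" using \<omega> counts[OF en] by auto
    next
      fix \<omega> assume \<omega>: "\<omega> \<in> ?W'"
      then have "mark_indices E (\<lambda>e. fst (\<omega> e)) = ?J" by (auto simp: mark_indices_def)
      moreover have "increasing_in 1 k \<pi> (\<lambda>j\<in>?J. time_of \<omega> j)" using \<omega> by simp
      ultimately have "enumerates E w \<pi> \<omega>"
        using b f \<omega> \<mu> piJ len unfolding enumerates_def increasing_in_def by auto
      then show "\<omega> \<in> ?W \<pi>" using \<omega> by simp
    qed
    moreover have "(\<Prod>j\<in>?J. pmf (mark_pmf u) (\<mu> j)) = word_weight u w"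
    proof -
      have "(\<Prod>j\<in>?J. pmf (mark_pmf u) (\<mu> j)) = (\<Prod>i<k. pmf (mark_pmf u) (\<mu> (\<pi> i)))"
        unfolding img[symmetric] by (rule prod.reindex[OF inj, unfolded o_def])
      also have "\<dots> = (\<Prod>i<k. mark_weight u (snd (w ! i)))"
        using \<mu> pmf_mark[OF u] by (intro prod.cong) auto
      also have "\<dots> = word_weight u w"
        unfolding word_weight_def len[symmetric] by (simp add: prod.list_conv_set_nth atLeast0LessThan)
      finally show ?thesis .
    qed
    moreover have "emeasure (\<Pi>\<^sub>M j\<in>?J. circle) ?B = ennreal (1 / fact k)"
      using emeasure_increasing[OF inj, of 1] unfolding img by simp
    moreover have "0 \<le> ?c" by (intro mult_nonneg_nonneg prod_nonneg word_weight_nonneg u) auto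
    ultimately show ?thesis
      using emeasure_mark_law_times[OF E B, where \<mu> = \<mu> and t = t and u = u]
      by (simp add: ennreal_mult[symmetric])
  qed
  show "word_event E t u w \<in> sets ?M" unfolding union using finL cell by auto
  have "disjoint_family_on ?W ?L"
    unfolding disjoint_family_on_def
  proof (intro ballI impI)
    fix \<pi> \<pi>' assume *: "\<pi> \<in> ?L" "\<pi>' \<in> ?L" "\<pi> \<noteq> \<pi>'"
    then obtain i where i: "i < k" "\<pi> i \<noteq> \<pi>' i" by (metis (no_types, lifting) PiE_ext lessThan_iff mem_Collect_eq)
    show "?W \<pi> \<inter> ?W \<pi>' = {}"
    proof (rule equals0I)
      fix \<omega> assume "\<omega> \<in> ?W \<pi> \<inter> ?W \<pi>'"
      then have "enumerates E w \<pi> \<omega>" "enumerates E w \<pi>' \<omega>" by auto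
      from enumerates_unique(2)[OF this, of i] show False using i len by simp
    qed
  qed
  then have "emeasure ?M (word_event E t u w) = (\<Sum>\<pi>\<in>?L. emeasure ?M (?W \<pi>))"
    unfolding union using finL cell by (intro sum_emeasure[symmetric]) auto
  also have "\<dots> = (\<Sum>\<pi>\<in>?L. ennreal (?c / fact k))" using cell by (intro sum.cong) auto
  also have "\<dots> = ennreal (real (card ?L) * (?c / fact k))"
  proof -
    have "0 \<le> ?c / fact k" by (intro divide_nonneg_nonneg mult_nonneg_nonneg prod_nonneg word_weight_nonneg u) auto
    then show ?thesis
      by (simp only: sum_constant ennreal_of_nat_eq_real_of_nat ennreal_mult[OF of_nat_0_le_iff])
  qed
  also have "card ?L = (\<Prod>e\<in>E. fact (\<nu> e))"
    using card_labellings[OF E, of k "\<lambda>i. fst (w ! i)"] wE unfolding mark_indices_def \<nu>_def by simp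
  also have "real (\<Prod>e\<in>E. fact (\<nu> e)) * (?c / fact k) = exp (- (t * real (card E))) * (t ^ k / fact k) * word_weight u w"
  proof -
    have "(\<Sum>e\<in>E. \<nu> e) = card (\<Union>e\<in>E. {i. i < k \<and> fst (w ! i) = e})"
      unfolding \<nu>_def using E by (intro card_UN_disjoint[symmetric]) auto
    also have "(\<Union>e\<in>E. {i. i < k \<and> fst (w ! i) = e}) = {..<k}" using wE by auto
    finally have total: "(\<Sum>e\<in>E. \<nu> e) = k" by simp
    have "real (\<Prod>e\<in>E. fact (\<nu> e)) * (\<Prod>e\<in>E. pmf (poisson0_pmf t) (\<nu> e)) = (\<Prod>e\<in>E. t ^ \<nu> e * exp (- t))"
      unfolding of_nat_prod prod.distrib[symmetric] using t
      by (intro prod.cong refl) (simp add: pmf_poisson0)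
    also have "\<dots> = t ^ k * exp (- (t * real (card E)))"
      using E by (simp add: prod.distrib power_sum[symmetric] total exp_of_nat2_mult[symmetric] mult.commute)
    finally show ?thesis by (simp add: mult.assoc[symmetric])
  qed
  finally show "emeasure ?M (word_event E t u w) =
      ennreal (exp (- (t * real (card E))) * (t ^ k / fact k) * word_weight u w)" .
qed

text \<open>The events of the single words are disjoint, and their probabilities sum to \<open>1\<close> by the exponential
  series. Almost every sample therefore has a word; in particular its marks have distinct positive
  times.\<close>

theorem word_law:
  fixes H :: "'v sample \<Rightarrow> ennreal" and F :: "'v letter list \<Rightarrow> real"
  assumes E: "finite E" and t: "0 \<le> t" and u: "0 \<le> u" "u \<le> 1"
    and HF: "\<And>w k \<omega>. w \<in> words E k \<Longrightarrow> \<omega> \<in> word_event E t u w \<Longrightarrow> H \<omega> = ennreal (F w)"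
    and F: "\<And>w. 0 \<le> F w"
  shows "(\<integral>\<^sup>+\<omega>. H \<omega> \<partial>mark_law E t u) =
    (\<Sum>k. ennreal (exp (- (t * real (card E))) * (t ^ k / fact k) * (\<Sum>w\<in>words E k. word_weight u w * F w)))"
proof -
  let ?M = "mark_law E t u" and ?W = "word_event E t u"
  interpret M: prob_space ?M
    unfolding mark_law_def by (intro prob_space_PiM prob_space_poisson_process prob_space_mark_space)
  note W = emeasure_word_event[OF E t u]
  have fin: "finite (words E k)" for k using E by (rule finite_words)
  have uniq: "w = w'" if "\<omega> \<in> ?W w" "\<omega> \<in> ?W w'" for \<omega> w w'
    using that enumerates_unique(1) by (auto simp: word_event_def)
  have len: "length w = k" if "w \<in> words E k" for w k using that by (simp add: words_def)
  let ?T = "\<lambda>(G :: _ \<Rightarrow> ennreal) \<omega>. \<Sum>k. \<Sum>w\<in>words E k. G w * indicator (?W w) \<omega>"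
  have single: "?T G \<omega> = G w" if w: "w \<in> words E k" and \<omega>: "\<omega> \<in> ?W w" for G w k \<omega>
  proof -
    have z: "indicator (?W w') \<omega> = (of_bool (w' = w) :: ennreal)" for w'
      using uniq[OF \<omega>, of w'] \<omega> by (cases "w' = w") (auto simp: indicator_def)
    have "(\<Sum>w'\<in>words E k'. G w' * indicator (?W w') \<omega>) = (if k' = k then G w else 0)" for k'
    proof -
      have "(\<Sum>w'\<in>words E k'. G w' * indicator (?W w') \<omega>) = (\<Sum>w'\<in>words E k'. if w' = w then G w else 0)"
        unfolding z by (intro sum.cong) auto
      also have "\<dots> = (if w \<in> words E k' then G w else 0)" using fin by simp
      also have "w \<in> words E k' \<longleftrightarrow> k' = k" using w len[OF w] by (auto simp: words_def)
      finally show ?thesis .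
    qed
    then show ?thesis by (subst suminf_finite[of "{k}"]) auto
  qed
  have int: "(\<integral>\<^sup>+\<omega>. ?T G \<omega> \<partial>?M) = (\<Sum>k. \<Sum>w\<in>words E k. G w * emeasure ?M (?W w))" for G
  proof -
    have "(\<integral>\<^sup>+\<omega>. ?T G \<omega> \<partial>?M) = (\<Sum>k. \<integral>\<^sup>+\<omega>. (\<Sum>w\<in>words E k. G w * indicator (?W w) \<omega>) \<partial>?M)"
      using W(1) by (intro nn_integral_suminf borel_measurable_sum) auto
    also have "\<dots> = (\<Sum>k. \<Sum>w\<in>words E k. G w * emeasure ?M (?W w))"
    proof (intro suminf_cong)
      fix k
      have "(\<integral>\<^sup>+\<omega>. (\<Sum>w\<in>words E k. G w * indicator (?W w) \<omega>) \<partial>?M) = (\<Sum>w\<in>words E k. \<integral>\<^sup>+\<omega>. G w * indicator (?W w) \<omega> \<partial>?M)"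
        using W(1) by (intro nn_integral_sum) auto
      also have "\<dots> = (\<Sum>w\<in>words E k. G w * emeasure ?M (?W w))"
        using W(1) by (intro sum.cong refl nn_integral_cmult_indicator) auto
      finally show "(\<integral>\<^sup>+\<omega>. (\<Sum>w\<in>words E k. G w * indicator (?W w) \<omega>) \<partial>?M) = (\<Sum>w\<in>words E k. G w * emeasure ?M (?W w))" .
    qed
    finally show ?thesis .
  qed
  have val: "(\<Sum>w\<in>words E k. ennreal (G w) * emeasure ?M (?W w)) =
      ennreal (exp (- (t * real (card E))) * (t ^ k / fact k) * (\<Sum>w\<in>words E k. word_weight u w * G w))"
    if G: "\<And>w. 0 \<le> G w" for G k
  proof -
    have "(\<Sum>w\<in>words E k. ennreal (G w) * emeasure ?M (?W w)) =
        (\<Sum>w\<in>words E k. ennreal (exp (- (t * real (card E))) * (t ^ k / fact k) * (word_weight u w * G w)))"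
    proof (intro sum.cong refl)
      fix w assume w: "w \<in> words E k"
      let ?a = "exp (- (t * real (card E))) * (t ^ k / fact k)"
      have "0 \<le> ?a * word_weight u w" using word_weight_nonneg[OF u] t by (intro mult_nonneg_nonneg) auto
      then have "ennreal (G w) * emeasure ?M (?W w) = ennreal (G w * (?a * word_weight u w))"
        unfolding W(2)[OF w] by (rule ennreal_mult[OF G, symmetric])
      then show "ennreal (G w) * emeasure ?M (?W w) = ennreal (?a * (word_weight u w * G w))"
        by (simp only: mult_ac)
    qed
    also have "\<dots> = ennreal (\<Sum>w\<in>words E k. exp (- (t * real (card E))) * (t ^ k / fact k) * (word_weight u w * G w))"
      by (intro sum_ennreal mult_nonneg_nonneg) (use G word_weight_nonneg[OF u] t in auto)
    finally show ?thesis by (simp add: sum_distrib_left)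
  qed
  \<comment> \<open>The union of all word events has probability \<open>1\<close>.\<close>
  let ?U = "\<Union>k. \<Union>w\<in>words E k. ?W w"
  have "(\<Union>w\<in>words E k. ?W w) \<in> sets ?M" for k using fin W(1) by (intro sets.finite_UN) auto
  then have U: "?U \<in> sets ?M" by (rule sets.countable_UN''[rotated]) simp
  have "emeasure ?M ?U = (\<integral>\<^sup>+\<omega>. indicator ?U \<omega> \<partial>?M)" using U by simp
  also have "\<dots> = (\<integral>\<^sup>+\<omega>. ?T (\<lambda>_. ennreal 1) \<omega> \<partial>?M)"
  proof (rule nn_integral_cong)
    fix \<omega>
    show "indicator ?U \<omega> = ?T (\<lambda>_. ennreal 1) \<omega>"
    proof (cases "\<omega> \<in> ?U")
      case True
      then obtain k w where "w \<in> words E k" "\<omega> \<in> ?W w" by blast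
      then show ?thesis using single[of w k \<omega> "\<lambda>_. ennreal 1"] True by simp
    qed (auto simp: indicator_def)
  qed
  also have "\<dots> = (\<Sum>k. ennreal (exp (- (t * real (card E))) * (t ^ k / fact k) * (\<Sum>w\<in>words E k. word_weight u w * 1)))"
    unfolding int by (subst val) auto
  also have "\<dots> = (\<Sum>k. ennreal (exp (- (t * real (card E))) * ((t * real (card E)) ^ k / fact k)))"
    by (simp add: sum_word_weight power_mult_distrib mult.assoc)
  also have "\<dots> = ennreal (exp (- (t * real (card E))) * exp (t * real (card E)))"
  proof (rule suminf_ennreal_eq)
    show "(\<lambda>k. exp (- (t * real (card E))) * ((t * real (card E)) ^ k / fact k)) sums (exp (- (t * real (card E))) * exp (t * real (card E)))"
      using exp_converges[of "t * real (card E)"] by (intro sums_mult) (simp add: divide_inverse mult.commute)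
  qed (use t in auto)
  also have "\<dots> = 1" by (simp flip: exp_add)
  finally have "M.prob ?U = 1" by (simp add: M.emeasure_eq_measure)
  then have "AE \<omega> in ?M. \<omega> \<in> ?U" by (rule M.AE_prob_1)
  then have "AE \<omega> in ?M. H \<omega> = ?T (\<lambda>w. ennreal (F w)) \<omega>"
  proof eventually_elim
    case (elim \<omega>)
    then obtain k w where "w \<in> words E k" "\<omega> \<in> ?W w" by blast
    then show ?case using single[of w k \<omega> "\<lambda>w. ennreal (F w)"] HF by simp
  qed
  then have "(\<integral>\<^sup>+\<omega>. H \<omega> \<partial>?M) = (\<integral>\<^sup>+\<omega>. ?T (\<lambda>w. ennreal (F w)) \<omega> \<partial>?M)"
    by (rule nn_integral_cong_AE)
  also have "\<dots> = (\<Sum>k. ennreal (exp (- (t * real (card E))) * (t ^ k / fact k) * (\<Sum>w\<in>words E k. word_weight u w * F w)))"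
    unfolding int val[OF F] ..
  finally show ?thesis .
qed

section \<open>Long loops\<close>

context loop_graph begin

lemma exp_weighted_series:
  assumes t: "0 \<le> t" and a: "geom_bounded a" "\<And>k. 0 \<le> a k"
  shows "(\<Sum>k. ennreal (exp (- (t * real (card E))) * (t ^ k / fact k) * a k)) =
    ennreal (exp (- (t * real (card E))) * exp_series a t)"
proof (rule suminf_ennreal_eq)
  have "(\<lambda>k. a k / fact k * t ^ k) sums exp_series a t"
    unfolding exp_series_def using a by (intro summable_sums summable_exp_series)
  then have "(\<lambda>k. exp (- (t * real (card E))) * (a k / fact k * t ^ k)) sums (exp (- (t * real (card E))) * exp_series a t)"
    by (rule sums_mult)
  then show "(\<lambda>k. exp (- (t * real (card E))) * (t ^ k / fact k) * a k) sums (exp (- (t * real (card E))) * exp_series a t)"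
    by (simp add: mult_ac)
qed (use t a in auto)

lemma num_loops_word_event:
  assumes "w \<in> words E k" "\<omega> \<in> word_event E t u w"
  shows "num_loops V E \<omega> = word_loops V w"
  using assms num_loops_word[OF finite_V words_edge_letters] by (auto simp: word_event_def)

lemma trace_series_pos: "0 \<le> t \<Longrightarrow> 0 < exp_series tr t"
  using exp_le_trace_series[of t] exp_gt_zero less_le_trans by blast

lemma nn_integral_num_loops:
  assumes t: "0 \<le> t"
  shows "(\<integral>\<^sup>+\<omega>. ennreal (real q ^ num_loops V E \<omega>) \<partial>mark_law E t u) =
    ennreal (exp (- (t * real (card E))) * exp_series tr t)"
proof -
  have "(\<integral>\<^sup>+\<omega>. ennreal (real q ^ num_loops V E \<omega>) \<partial>mark_law E t u) =
      (\<Sum>k. ennreal (exp (- (t * real (card E))) * (t ^ k / fact k) * (\<Sum>w\<in>words E k. word_weight u w * real q ^ word_loops V w)))"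
    using num_loops_word_event by (intro word_law finite_E t u) auto
  also have "\<dots> = ennreal (exp (- (t * real (card E))) * exp_series tr t)"
    unfolding trace_words[symmetric] using long_trace_bounds
    by (intro exp_weighted_series t geom_bounded_tr) (meson order_trans)
  finally show ?thesis .
qed

lemma loop_weight_measurable: "(\<lambda>\<omega>. real q ^ num_loops V E \<omega>) \<in> borel_measurable (mark_law E t u)"
  using measurable_compose[OF num_loops_measurable[OF finite_E], of "\<lambda>m. real q ^ m" borel V] by simp

lemma partition_function_eq:
  assumes t: "0 \<le> t"
  shows "partition_function V E (real q) t u = exp (- (t * real (card E))) * exp_series tr t"
proof -
  have "partition_function V E (real q) t u = enn2real (\<integral>\<^sup>+\<omega>. ennreal (real q ^ num_loops V E \<omega>) \<partial>mark_law E t u)"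
    unfolding partition_function_def by (intro integral_eq_nn_integral loop_weight_measurable) auto
  then show ?thesis unfolding nn_integral_num_loops[OF t] using trace_series_pos[OF t] by simp
qed

text \<open>A long cluster of the word forces a long loop of the sample, so the weight of the words with a
  long cluster bounds the probability from below.\<close>

lemma long_loop_probability:
  assumes t: "0 \<le> t"
  shows "exp_series (long_trace (\<eta> * real (card V))) t / exp_series tr t \<le>
    \<P>(\<omega> in loop_measure V E (real q) t u. has_long_loop V E \<eta> \<omega>)"
proof -
  let ?M = "mark_law E t u" and ?L = "\<eta> * real (card V)"
  let ?Z = "partition_function V E (real q) t u"
  let ?d = "\<lambda>\<omega>. ennreal (real q ^ num_loops V E \<omega> / ?Z)"
  let ?A = "{\<omega> \<in> space ?M. has_long_loop V E \<eta> \<omega>}"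
  have Z: "0 < ?Z" using partition_function_eq[OF t] trace_series_pos[OF t] by simp
  have d: "?d \<in> borel_measurable ?M" using loop_weight_measurable by measurable
  have A: "?A \<in> sets ?M" by (rule has_long_loop_sets[OF finite_E])
  have space: "space (loop_measure V E (real q) t u) = space ?M" by (simp add: loop_measure_def)
  have emeasure: "emeasure (loop_measure V E (real q) t u) B = (\<integral>\<^sup>+\<omega>. ?d \<omega> * indicator B \<omega> \<partial>?M)"
    if "B \<in> sets ?M" for B
    unfolding loop_measure_def using d that by (rule emeasure_density)
  \<comment> \<open>The weighted density, restricted to samples whose word has a long cluster.\<close>
  define H where "H \<omega> = (if \<exists>k. \<exists>w\<in>words E k. \<omega> \<in> word_event E t u w \<and> long_word ?L w then ?d \<omega> else 0)" for \<omega>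
  have "(\<integral>\<^sup>+\<omega>. H \<omega> \<partial>?M) \<le> (\<integral>\<^sup>+\<omega>. ?d \<omega> * indicator ?A \<omega> \<partial>?M)"
  proof (rule nn_integral_mono)
    fix \<omega> assume \<omega>: "\<omega> \<in> space ?M"
    have "has_long_loop V E \<eta> \<omega>" if w: "w \<in> words E k" "\<omega> \<in> word_event E t u w" "long_word ?L w" for k w
    proof -
      obtain \<pi> where "enumerates E w \<pi> \<omega>" using w by (auto simp: word_event_def)
      moreover obtain x where "x \<in> V" "?L < real (card (cluster w x))" using w by (auto simp: long_word_def)
      ultimately show ?thesis
        using has_long_loop_word[OF finite_V words_edge_letters[OF w(1)] \<omega>] unfolding cluster_def by blast
    qed
    then show "H \<omega> \<le> ?d \<omega> * indicator ?A \<omega>" unfolding H_def using \<omega> by (auto simp: indicator_def)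
  qed
  moreover have "(\<integral>\<^sup>+\<omega>. H \<omega> \<partial>?M) = (\<Sum>k. ennreal (exp (- (t * real (card E))) * (t ^ k / fact k) *
      (\<Sum>w\<in>words E k. word_weight u w * (real q ^ word_loops V w * of_bool (long_word ?L w) / ?Z))))"
  proof (rule word_law[OF finite_E t u])
    fix w k \<omega> assume w: "w \<in> words E k" "\<omega> \<in> word_event E t u w"
    have "(\<exists>k. \<exists>w\<in>words E k. \<omega> \<in> word_event E t u w \<and> long_word ?L w) \<longleftrightarrow> long_word ?L w"
    proof
      assume "\<exists>k. \<exists>w\<in>words E k. \<omega> \<in> word_event E t u w \<and> long_word ?L w"
      then obtain w' where w': "\<omega> \<in> word_event E t u w'" "long_word ?L w'" by blast
      have "w' = w" using w'(1) w(2) enumerates_unique(1) by (auto simp: word_event_def)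
      then show "long_word ?L w" using w'(2) by simp
    qed (use w in blast)
    then show "H \<omega> = ennreal (real q ^ word_loops V w * of_bool (long_word ?L w) / ?Z)"
      unfolding H_def using num_loops_word_event[OF w] by simp
  qed (use Z in simp)
  also have "\<dots> = (\<Sum>k. ennreal (exp (- (t * real (card E))) * (t ^ k / fact k) * (long_trace ?L k / ?Z)))"
    unfolding long_trace_def sum_divide_distrib by (simp add: mult.assoc)
  also have "\<dots> = ennreal (exp (- (t * real (card E))) * exp_series (\<lambda>k. long_trace ?L k / ?Z) t)"
  proof (rule exp_weighted_series[OF t])
    obtain C B where "\<And>k. \<bar>long_trace ?L k\<bar> \<le> C * B ^ k"
      using geom_bounded_long_trace unfolding geom_bounded_def by blast
    then have "\<bar>long_trace ?L k / ?Z\<bar> \<le> C / ?Z * B ^ k" for k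
      using Z by (simp add: divide_right_mono)
    then show "geom_bounded (\<lambda>k. long_trace ?L k / ?Z)" unfolding geom_bounded_def by blast
  qed (use Z long_trace_bounds in simp)
  also have "exp_series (\<lambda>k. long_trace ?L k / ?Z) t = exp_series (long_trace ?L) t / ?Z"
  proof -
    have "(\<Sum>k. (long_trace ?L k / fact k * t ^ k) / ?Z) = exp_series (long_trace ?L) t / ?Z"
      unfolding exp_series_def by (rule suminf_divide[OF summable_exp_series[OF geom_bounded_long_trace]])
    then show ?thesis by (simp add: exp_series_def mult.commute)
  qed
  also have "exp (- (t * real (card E))) * (exp_series (long_trace ?L) t / ?Z) = exp_series (long_trace ?L) t / exp_series tr t"
    unfolding partition_function_eq[OF t] by simp
  ultimately have le: "ennreal (exp_series (long_trace ?L) t / exp_series tr t) \<le> emeasure (loop_measure V E (real q) t u) ?A"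
    unfolding emeasure[OF A] by simp
  have "emeasure (loop_measure V E (real q) t u) ?A \<le> (\<integral>\<^sup>+\<omega>. ?d \<omega> \<partial>?M)"
    unfolding emeasure[OF A] by (intro nn_integral_mono) (auto simp: indicator_def)
  also have "\<dots> = (\<integral>\<^sup>+\<omega>. ennreal (real q ^ num_loops V E \<omega>) / ennreal ?Z \<partial>?M)"
    using Z by (intro nn_integral_cong) (simp add: divide_ennreal)
  also have "\<dots> = ennreal (exp (- (t * real (card E))) * exp_series tr t) / ennreal ?Z"
    unfolding nn_integral_num_loops[OF t, symmetric] using loop_weight_measurable
    by (intro nn_integral_divide) auto
  also have "\<dots> < top"
    using Z trace_series_pos[OF t] by (simp add: divide_ennreal)
  finally have "emeasure (loop_measure V E (real q) t u) ?A < top" .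
  then have "emeasure (loop_measure V E (real q) t u) ?A = ennreal (measure (loop_measure V E (real q) t u) ?A)"
    by (intro emeasure_eq_ennreal_measure) simp
  then have "ennreal (exp_series (long_trace ?L) t / exp_series tr t) \<le> ennreal (measure (loop_measure V E (real q) t u) ?A)"
    using le by simp
  then show ?thesis unfolding space by (subst (asm) ennreal_le_iff) (rule measure_nonneg)
qed

theorem long_loop_bound:
  assumes t: "0 < t" and eps: "0 \<le> \<epsilon>"
    and sparse: "\<And>S. S \<subseteq> V \<Longrightarrow> real (card S) \<le> \<eta> * real (card V) \<Longrightarrow>
      real (edges_within E S) \<le> (1 + \<epsilon>) * real (card S)"
  shows "real (card E) * (1 - 1 / real q) - real (card V) * ln (real q) / t - merge_gain * ((1 + \<epsilon>) * real (card V)) \<le>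
    merge_gain * real (card E) * \<P>(\<omega> in loop_measure V E (real q) t u. has_long_loop V E \<eta> \<omega>)"
proof -
  have "merge_gain * real (card E) * (exp_series (long_trace (\<eta> * real (card V))) t / exp_series tr t) \<le>
      merge_gain * real (card E) * \<P>(\<omega> in loop_measure V E (real q) t u. has_long_loop V E \<eta> \<omega>)"
    using t by (intro mult_left_mono long_loop_probability mult_nonneg_nonneg merge_gain_nonneg) auto
  moreover have "real (card E) * (1 - 1 / real q) - real (card V) * ln (real q) / t - merge_gain * ((1 + \<epsilon>) * real (card V)) \<le>
      merge_gain * real (card E) * (exp_series (long_trace (\<eta> * real (card V))) t / exp_series tr t)"
    by (rule long_fraction_bound[OF t eps sparse])
  ultimately show ?thesis by linarith
qed

lemma merge_gain_eq: "merge_gain = (1 - 1 / real q) * (1 + real q * max u (1 - u))"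
  using q by (simp add: merge_gain_def field_simps)

end

text \<open>The arithmetic of the threshold. Dividing by \<open>(1 - 1 / \<theta>) n\<close> and inserting
  \<open>ln \<theta> / t \<le> (1 - 1 / \<theta>) (\<alpha> - c) t0 / (t0 + \<delta>)\<close> leaves a margin \<open>d\<close>, of which the deviation of
  the edge density and the sparsity constant are allowed to use a quarter each.\<close>

lemma long_loop_constant:
  fixes \<theta> :: nat and u \<alpha> \<delta> t n m P :: real
  assumes \<theta>: "1 < \<theta>" and c: "c = 1 + real \<theta> * max u (1 - u)" and sup: "c < \<alpha>" and \<delta>: "0 < \<delta>" and n: "0 < n" and c0: "0 < c"
    and t0: "t0 = real \<theta> * ln (real \<theta>) / ((real \<theta> - 1) * (\<alpha> - c))" and t: "t0 + \<delta> \<le> t"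
    and d: "d = (\<alpha> - c) * \<delta> / (t0 + \<delta>)"
    and m: "\<bar>m / n - \<alpha>\<bar> \<le> min 1 (d / 4)" and P: "0 \<le> P"
    and main: "m * (1 - 1 / real \<theta>) - n * ln (real \<theta>) / t - ((1 - 1 / real \<theta>) * c) * ((1 + d / (4 * c)) * n) \<le>
      ((1 - 1 / real \<theta>) * c) * m * P"
  shows "d / (2 * (c * (\<alpha> + 1))) \<le> P"
proof -
  define r where "r = 1 - 1 / real \<theta>"
  define z where "z = 1 + d / (4 * c)"
  have r: "0 < r" using \<theta> by (simp add: r_def)
  have lnpos: "0 < ln (real \<theta>)" using \<theta> by simp
  have t0pos: "0 \<le> t0" unfolding t0 using \<theta> sup by (intro divide_nonneg_nonneg mult_nonneg_nonneg) auto
  have td: "0 < t0 + \<delta>" using t0pos \<delta> by linarith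
  have tpos: "0 < t" using td t by linarith
  have lnt0: "ln (real \<theta>) = r * (t0 * (\<alpha> - c))"
  proof -
    have ne: "real \<theta> - 1 \<noteq> 0" "\<alpha> - c \<noteq> 0" "real \<theta> \<noteq> 0" using \<theta> sup by auto
    have "t0 * (\<alpha> - c) = real \<theta> * ln (real \<theta>) / (real \<theta> - 1)" unfolding t0 using ne(2) by simp
    moreover have "r = (real \<theta> - 1) / real \<theta>" using ne(3) by (simp add: r_def diff_divide_distrib)
    ultimately show ?thesis using ne(1,3) by simp
  qed
  have "ln (real \<theta>) / t \<le> ln (real \<theta>) / (t0 + \<delta>)" using t td lnpos by (intro divide_left_mono) auto
  also have "\<dots> = r * ((\<alpha> - c) - d)"
    unfolding lnt0 d using td by (simp add: field_simps)
  finally have lt: "ln (real \<theta>) / t \<le> r * ((\<alpha> - c) - d)" .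
  define \<beta> where "\<beta> = m / n"
  have mb: "m = \<beta> * n" using n by (simp add: \<beta>_def)
  have b: "\<alpha> - d / 4 \<le> \<beta>" "\<beta> \<le> \<alpha> + 1" using m unfolding \<beta>_def by linarith+
  have "n * (r * (\<beta> - ((\<alpha> - c) - d) - c * z)) \<le>
      n * (\<beta> * r - ln (real \<theta>) / t - (r * c) * z)"
  proof (rule mult_left_mono)
    show "r * (\<beta> - ((\<alpha> - c) - d) - c * z) \<le> \<beta> * r - ln (real \<theta>) / t - (r * c) * z"
    proof -
      have "r * (\<beta> - ((\<alpha> - c) - d) - c * z) = \<beta> * r - r * ((\<alpha> - c) - d) - (r * c) * z"
        by (simp add: algebra_simps)
      with lt show ?thesis by linarith
    qed
  qed (use n in simp)
  also have "\<dots> = m * r - n * ln (real \<theta>) / t - (r * c) * (z * n)"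
    unfolding mb by (simp only: right_diff_distrib mult_ac times_divide_eq_right)
  also have "\<dots> \<le> (r * c) * m * P" by (rule main[folded r_def z_def])
  also have "\<dots> = n * (r * (c * \<beta> * P))" unfolding mb by (simp only: mult_ac)
  finally have "r * (\<beta> - ((\<alpha> - c) - d) - c * z) \<le> r * (c * \<beta> * P)"
    using n by (rule mult_left_le_imp_le)
  then have "\<beta> - ((\<alpha> - c) - d) - c * z \<le> c * \<beta> * P"
    using r by (rule mult_left_le_imp_le)
  moreover have "c * z = c + d / 4" using c0 by (simp add: z_def field_simps)
  ultimately have "d / 2 \<le> c * \<beta> * P" using b(1) by linarith
  also have "\<dots> \<le> c * (\<alpha> + 1) * P" using b(2) c0 P by (intro mult_right_mono mult_left_mono) auto
  finally have "d / 2 \<le> c * (\<alpha> + 1) * P" .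
  moreover have "0 < c * (\<alpha> + 1)" using c0 sup by simp
  ultimately show ?thesis by (simp add: field_simps)
qed

theorem theorem2p5:
  fixes G :: "nat \<Rightarrow> nat set set pmf"
    and u \<alpha> :: real and \<theta> :: nat
  defines "c\<^sub>\<theta>\<^sub>u \<equiv> 1 + real \<theta> * max u (1 - u)"
  assumes graph: "\<And>n E. E \<in> set_pmf (G n) \<Longrightarrow> simple_graph {1..n} E"
    and u: "0 \<le> u" "u \<le> 1"
    and \<theta>: "1 < \<theta>"
    and sparse: "\<And>\<epsilon>::real. 0 < \<epsilon> \<Longrightarrow> \<exists>\<eta>>0.
          (\<lambda>n. measure_pmf.prob (G n)
             {E. \<forall>S\<subseteq>{1..n}. real (card S) \<le> \<eta> * real n \<longrightarrow>
                   real (edges_within E S) \<le> (1 + \<epsilon>) * real (card S)}) \<longlonglongrightarrow> 1"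
    and \<alpha>: "0 < \<alpha>"
    and density: "\<And>\<epsilon>::real. 0 < \<epsilon> \<Longrightarrow>
          (\<lambda>n. measure_pmf.prob (G n) {E. \<bar>real (card E) / real n - \<alpha>\<bar> > \<epsilon>}) \<longlonglongrightarrow> 0"
    and supercritical: "c\<^sub>\<theta>\<^sub>u < \<alpha>"
  shows "\<forall>\<delta>>0. \<exists>\<eta>>0. \<exists>c>0. \<forall>t \<ge> real \<theta> * ln (real \<theta>) / ((real \<theta> - 1) * (\<alpha> - c\<^sub>\<theta>\<^sub>u)) + \<delta>.
          (\<lambda>n. measure_pmf.prob (G n)
             {E. \<P>(\<omega> in loop_measure {1..n} E (real \<theta>) t u. has_long_loop {1..n} E \<eta> \<omega>) \<ge> c})
          \<longlonglongrightarrow> 1"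
proof (intro allI impI)
  fix \<delta> :: real assume \<delta>: "0 < \<delta>"
  define t0 where "t0 = real \<theta> * ln (real \<theta>) / ((real \<theta> - 1) * (\<alpha> - c\<^sub>\<theta>\<^sub>u))"
  define d where "d = (\<alpha> - c\<^sub>\<theta>\<^sub>u) * \<delta> / (t0 + \<delta>)"
  have c_eq: "c\<^sub>\<theta>\<^sub>u = 1 + real \<theta> * max u (1 - u)" by (simp add: c\<^sub>\<theta>\<^sub>u_def)
  have c: "0 < c\<^sub>\<theta>\<^sub>u" unfolding c\<^sub>\<theta>\<^sub>u_def using u by (intro add_pos_nonneg mult_nonneg_nonneg) auto
  have t0: "0 \<le> t0" unfolding t0_def using \<theta> supercritical by (intro divide_nonneg_nonneg mult_nonneg_nonneg) auto
  have d: "0 < d" unfolding d_def using \<delta> t0 supercritical by (intro divide_pos_pos mult_pos_pos) auto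
  \<comment> \<open>A quarter of the margin \<open>d\<close> for the sparsity constant; \<open>min 1 (d / 4)\<close> below bounds the deviation of the edge density.\<close>
  define \<epsilon> where "\<epsilon> = d / (4 * c\<^sub>\<theta>\<^sub>u)"
  have \<epsilon>: "0 < \<epsilon>" using d c by (simp add: \<epsilon>_def)
  let ?Sp = "\<lambda>\<eta> n. {E. \<forall>S\<subseteq>{1..n}. real (card S) \<le> \<eta> * real n \<longrightarrow>
      real (edges_within E S) \<le> (1 + \<epsilon>) * real (card S)}"
  let ?De = "\<lambda>n. {E :: nat set set. \<bar>real (card E) / real n - \<alpha>\<bar> > min 1 (d / 4)}"
  obtain \<eta> where \<eta>: "0 < \<eta>" and lim: "(\<lambda>n. measure_pmf.prob (G n) (?Sp \<eta> n)) \<longlonglongrightarrow> 1"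
    using sparse[OF \<epsilon>] by blast
  define c0 where "c0 = d / (2 * (c\<^sub>\<theta>\<^sub>u * (\<alpha> + 1)))"
  have c0: "0 < c0" unfolding c0_def using d c \<alpha> by (intro divide_pos_pos mult_pos_pos) auto
  show "\<exists>\<eta>>0. \<exists>c>0. \<forall>t \<ge> real \<theta> * ln (real \<theta>) / ((real \<theta> - 1) * (\<alpha> - c\<^sub>\<theta>\<^sub>u)) + \<delta>.
          (\<lambda>n. measure_pmf.prob (G n)
             {E. \<P>(\<omega> in loop_measure {1..n} E (real \<theta>) t u. has_long_loop {1..n} E \<eta> \<omega>) \<ge> c})
          \<longlonglongrightarrow> 1"
  proof (rule exI[of _ \<eta>], intro conjI \<eta>, rule exI[of _ c0], intro conjI allI impI c0)
    fix t assume "t \<ge> real \<theta> * ln (real \<theta>) / ((real \<theta> - 1) * (\<alpha> - c\<^sub>\<theta>\<^sub>u)) + \<delta>"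
    then have t: "t0 + \<delta> \<le> t" by (simp add: t0_def)
    then have tpos: "0 < t" using t0 \<delta> by linarith
    let ?P = "\<lambda>n E. \<P>(\<omega> in loop_measure {1..n} E (real \<theta>) t u. has_long_loop {1..n} E \<eta> \<omega>)"
    have good: "c0 \<le> ?P n E" if n: "0 < n" and E: "E \<in> set_pmf (G n)" and S: "E \<in> ?Sp \<eta> n" and D: "E \<notin> ?De n" for n E
    proof -
      interpret loop_graph "{1..n}" E \<theta> u
        using graph[OF E] \<theta> u by unfold_locales auto
      have "real (card E) * (1 - 1 / real \<theta>) - real (card {1..n}) * ln (real \<theta>) / t -
          merge_gain * ((1 + \<epsilon>) * real (card {1..n})) \<le> merge_gain * real (card E) * ?P n E"
        by (rule long_loop_bound[OF tpos]) (use S \<epsilon> in auto)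
      moreover have D': "\<bar>real (card E) / real n - \<alpha>\<bar> \<le> min 1 (d / 4)"
        using D by (simp only: mem_Collect_eq not_less)
      ultimately show ?thesis
        unfolding merge_gain_eq c\<^sub>\<theta>\<^sub>u_def[symmetric] c0_def \<epsilon>_def
        by (intro long_loop_constant[OF \<theta> c_eq supercritical \<delta> _ c t0_def t d_def, where n = "real n" and m = "real (card E)"])
          (use n D' in \<open>simp_all only: measure_nonneg of_nat_0_less_iff card_atLeastAtMost diff_Suc_1 Suc_eq_plus1[symmetric] diff_Suc_1'\<close>)
    qed
    have bound: "measure_pmf.prob (G n) (?Sp \<eta> n) - measure_pmf.prob (G n) (?De n) \<le>
        measure_pmf.prob (G n) {E. c0 \<le> ?P n E}" if n: "0 < n" for n
    proof -
      have "measure_pmf.prob (G n) (?Sp \<eta> n) \<le> measure_pmf.prob (G n) ({E. c0 \<le> ?P n E} \<union> ?De n)"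
        using good[OF n] by (intro measure_pmf.finite_measure_mono_AE) (auto simp: AE_measure_pmf_iff)
      also have "\<dots> \<le> measure_pmf.prob (G n) {E. c0 \<le> ?P n E} + measure_pmf.prob (G n) (?De n)"
        by (rule measure_Un_le) auto
      finally show ?thesis by simp
    qed
    show "(\<lambda>n. measure_pmf.prob (G n) {E. c0 \<le> ?P n E}) \<longlonglongrightarrow> 1"
    proof (rule tendsto_sandwich[where h = "\<lambda>_. 1" and
        f = "\<lambda>n. measure_pmf.prob (G n) (?Sp \<eta> n) - measure_pmf.prob (G n) (?De n)"])
      show "\<forall>\<^sub>F n in sequentially. measure_pmf.prob (G n) (?Sp \<eta> n) - measure_pmf.prob (G n) (?De n) \<le>
          measure_pmf.prob (G n) {E. c0 \<le> ?P n E}"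
        using eventually_gt_at_top[of 0] by eventually_elim (rule bound)
      show "\<forall>\<^sub>F n in sequentially. measure_pmf.prob (G n) {E. c0 \<le> ?P n E} \<le> 1" by simp
      show "(\<lambda>_. 1 :: real) \<longlonglongrightarrow> 1" by simp
      have "(\<lambda>n. measure_pmf.prob (G n) (?De n)) \<longlonglongrightarrow> 0" using d by (intro density) simp
      from tendsto_diff[OF lim this]
      show "(\<lambda>n. measure_pmf.prob (G n) (?Sp \<eta> n) - measure_pmf.prob (G n) (?De n)) \<longlonglongrightarrow> 1" by simp
    qed
  qed
qed

end
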